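(* Let $\psi\in\mathcal{BF}$ be a Bernstein function and $g\in\mathcal{BCM}$ a bounded completely monotone function such that $J[g,\psi]<\infty$. Let $-A$ be the generator of a bounded $C_0$-semigroup $(e^{-tA})_{t\ge 0}$ on a Banach space $X$ satisfying the Yosida condition $Y(c_0,c_1)$. Then $\psi(A)g(A)\in\mathcal{L}(X)$ and $$\|\psi(A)g(A)\|\le \psi(0)\,\|g(A)\|+2\max(2M(A),c_1)\,J[g,\psi]+4M(A)\,g(0+)\,C[c_0;\psi],$$ where $$C[c_0;\psi]:=\int_0^\infty e^{-s/c_0}\psi'(s)\,ds\quad (c_0>0),\qquad C[0;\psi]:=0.$$
   Context: A positive (meaning $\ge 0$) function $g\in C^\infty(0,\infty)$ is completely monotone if $(-1)^n g^{(n)}(\tau)\ge 0$ for all $\tau>0$, $n\in\mathbb{N}$; $\mathcal{BCM}$ denotes the set of bounded completely monotone functions. A positive $\psi\in C^\infty(0,\infty)$ is a Bernstein function ($\psi\in\mathcal{BF}$) if $\psi'$ is completely monotone; equivalently there are unique $a,b\ge 0$ and a positive Radon measure $\gamma$ on $(0,\infty)$ with $\int_{0+}^\infty \frac{s}{1+s}\,\gamma(ds)<\infty$ such that $\psi(\tau)=a+b\tau+\int_{0+}^\infty(1-e^{-s\tau})\,\gamma(ds)$, $\tau>0$. We write $\psi(0)=\psi(0+)=a$ and $g(0+)=\lim_{\tau\to0+}g(\tau)$. $J[g,\psi]:=\int_0^\infty g(s)\psi'(s)\,ds\in[0,\infty]$. Functional calculus: let $-A$ generate a bounded $C_0$-semigroup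 $(e^{-tA})_{t\ge0}$ on $X$. If $f$ is the Laplace transform of a bounded Radon measure $\mu$ on $[0,\infty)$, $f(\tau)=\int_0^\infty e^{-\tau s}\mu(ds)$, then $f(A)x:=\int_0^\infty e^{-sA}x\,\mu(ds)$, $x\in X$, a bounded operator. Every $g\in\mathcal{BCM}$ is of this form (with a positive finite measure). For $\psi\in\mathcal{BF}$ the function $\psi(z)/(1+z)$ is of this form and $\psi(A):=(1+A)[\psi(z)(1+z)^{-1}](A)$, a closed operator; equivalently, $\psi(A)$ is the closure of the operator $x\mapsto ax+bAx+\int_{0+}^\infty(1-e^{-sA})x\,\gamma(ds)$ defined on $\mathrm{dom}(A)$. $M(A):=\sup_{t\ge0}\|e^{-tA}\|$. A bounded $C_0$-semigroup $(e^{-tA})_{t\ge0}$ satisfies the Yosida condition $Y(c_0,c_1)$, where $c_0\ge0$, $c_1>0$, if $e^{-tA}(X)\subset\mathrm{dom}(A)$ for all $t>0$ and $\|Ae^{-tA}\|\le c_0+c_1/t$ for all $t>0$. *)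

theory Defs
  imports "HOL-Analysis.Analysis"
begin

section \<open>Completely monotone and Bernstein functions\<close>

text \<open>
  Functions on \<open>(0,\<infinity>)\<close> are total functions \<open>real \<Rightarrow> real\<close> whose values outside
  \<open>{0<..}\<close> are irrelevant: \<open>(0,\<infinity>)\<close> is open, so iterated derivatives at \<open>t > 0\<close> do not
  see those values.
\<close>

definition smooth_pos :: "(real \<Rightarrow> real) \<Rightarrow> bool" where
  "smooth_pos f \<longleftrightarrow> (\<forall>n. \<forall>t>0. (deriv ^^ n) f differentiable (at t))"

definition completely_monotone :: "(real \<Rightarrow> real) \<Rightarrow> bool" where
  "completely_monotone g \<longleftrightarrow> smooth_pos g \<and> (\<forall>t>0. 0 \<le> g t) \<and>
     (\<forall>n. \<forall>t>0. 0 \<le> (-1) ^ n * (deriv ^^ n) g t)"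

definition BCM :: "(real \<Rightarrow> real) set" where
  "BCM = {g. completely_monotone g \<and> bounded (g ` {0<..})}"

definition BF :: "(real \<Rightarrow> real) set" where
  "BF = {psi. smooth_pos psi \<and> (\<forall>t>0. 0 \<le> psi t) \<and> completely_monotone (deriv psi)}"

definition at_zero_plus :: "(real \<Rightarrow> real) \<Rightarrow> real" where
  "at_zero_plus f = Lim (at_right 0) f"

definition J_functional :: "(real \<Rightarrow> real) \<Rightarrow> (real \<Rightarrow> real) \<Rightarrow> ennreal" where
  "J_functional g psi = (\<integral>\<^sup>+ s\<in>{0<..}. ennreal (g s * deriv psi s) \<partial>lborel)"

definition C_functional :: "real \<Rightarrow> (real \<Rightarrow> real) \<Rightarrow> ennreal" where
  "C_functional c0 psi =
     (if c0 = 0 then 0 else (\<integral>\<^sup>+ s\<in>{0<..}. ennreal (exp (- s / c0) * deriv psi s) \<partial>lborel))"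

section \<open>The Bochner integral in an arbitrary Banach space\<close>

text \<open>
  The library's \<^const>\<open>has_bochner_integral\<close> is restricted to second-countable (separable) target
  spaces. The same definition is used here without that restriction; the lemma below states
  that the two agree where both make sense.
\<close>

definition has_vec_integral ::
    "'s measure \<Rightarrow> ('s \<Rightarrow> 'a::real_normed_vector) \<Rightarrow> 'a \<Rightarrow> bool" where
  "has_vec_integral M f y \<longleftrightarrow> f \<in> borel_measurable M \<and>
     (\<exists>s. (\<forall>i. Bochner_Integration.simple_bochner_integrable M (s i)) \<and>
          (\<lambda>i. \<integral>\<^sup>+ x. ennreal (norm (f x - s i x)) \<partial>M) \<longlonglongrightarrow> 0 \<and>
          (\<lambda>i. Bochner_Integration.simple_bochner_integral M (s i)) \<longlonglongrightarrow> y)"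

lemma has_vec_integral_iff_has_bochner_integral:
  fixes f :: "'s \<Rightarrow> 'a::{real_normed_vector, second_countable_topology}"
  shows "has_vec_integral M f y \<longleftrightarrow> has_bochner_integral M f y"
  unfolding has_vec_integral_def has_bochner_integral.simps by auto

definition vec_integral :: "'s measure \<Rightarrow> ('s \<Rightarrow> 'a::real_normed_vector) \<Rightarrow> 'a" where
  "vec_integral M f = (THE y. has_vec_integral M f y)"

section \<open>Partial operators and semigroups\<close>

text \<open>
  An unbounded operator on \<open>X\<close> is a partial map \<open>'a \<rightharpoonup> 'a\<close>, so that \<^const>\<open>dom\<close> is its domain and
  \<open>B \<circ>\<^sub>m C\<close> is the product with its natural domain \<open>{x \<in> dom C. C x \<in> dom B}\<close>.
  \<open>is_bounded_op B S\<close> says that \<open>B\<close> is everywhere defined and equal to the bounded operator \<open>S\<close>.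
\<close>

definition of_blinfun :: "('a::real_normed_vector \<Rightarrow>\<^sub>L 'a) \<Rightarrow> ('a \<rightharpoonup> 'a)" where
  "of_blinfun S = (\<lambda>x. Some (blinfun_apply S x))"

definition is_bounded_op :: "('a::real_normed_vector \<rightharpoonup> 'a) \<Rightarrow> ('a \<Rightarrow>\<^sub>L 'a) \<Rightarrow> bool" where
  "is_bounded_op B S \<longleftrightarrow> B = of_blinfun S"

definition neg_op :: "('a::real_normed_vector \<rightharpoonup> 'a) \<Rightarrow> ('a \<rightharpoonup> 'a)" where
  "neg_op A = (\<lambda>x. map_option uminus (A x))"

definition one_plus_op :: "('a::real_normed_vector \<rightharpoonup> 'a) \<Rightarrow> ('a \<rightharpoonup> 'a)" where
  "one_plus_op A = (\<lambda>x. map_option (\<lambda>y. x + y) (A x))"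

text \<open>Only the values \<open>T t\<close> for \<open>t \<ge> 0\<close> are relevant below.\<close>

definition bounded_C0_semigroup :: "(real \<Rightarrow> 'a::banach \<Rightarrow>\<^sub>L 'a) \<Rightarrow> bool" where
  "bounded_C0_semigroup T \<longleftrightarrow>
     T 0 = id_blinfun \<and>
     (\<forall>s\<ge>0. \<forall>t\<ge>0. T (s + t) = T s o\<^sub>L T t) \<and>
     (\<forall>x. ((\<lambda>t. blinfun_apply (T t) x) \<longlongrightarrow> x) (at_right 0)) \<and>
     bounded (T ` {0..})"

definition generator :: "(real \<Rightarrow> 'a::banach \<Rightarrow>\<^sub>L 'a) \<Rightarrow> ('a \<rightharpoonup> 'a)" where
  "generator T = (\<lambda>x.
     if \<exists>y. ((\<lambda>t. (blinfun_apply (T t) x - x) /\<^sub>R t) \<longlongrightarrow> y) (at_right 0)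
     then Some (Lim (at_right 0) (\<lambda>t. (blinfun_apply (T t) x - x) /\<^sub>R t))
     else None)"

definition semigroup_bound :: "(real \<Rightarrow> 'a::banach \<Rightarrow>\<^sub>L 'a) \<Rightarrow> real" where
  "semigroup_bound T = (SUP t\<in>{0..}. norm (T t))"

definition yosida_condition ::
    "(real \<Rightarrow> 'a::banach \<Rightarrow>\<^sub>L 'a) \<Rightarrow> ('a \<rightharpoonup> 'a) \<Rightarrow> real \<Rightarrow> real \<Rightarrow> bool" where
  "yosida_condition T A c0 c1 \<longleftrightarrow>
     (\<forall>t>0. range (blinfun_apply (T t)) \<subseteq> dom A \<and>
        (\<exists>S. is_bounded_op (A \<circ>\<^sub>m of_blinfun (T t)) S \<and> norm S \<le> c0 + c1 / t))"

section \<open>Functional calculus\<close>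

text \<open>
  A bounded signed Radon measure on \<open>[0,\<infinity>)\<close> is represented as a difference \<open>\<mu> - \<nu>\<close> of two finite
  Borel measures. Since only real-valued \<open>f\<close> occur, complex measures give nothing more:
  by uniqueness of the Laplace transform the imaginary part of a representing measure vanishes.
  By the same uniqueness the operator below does not depend on the choice of \<open>\<mu>\<close> and \<open>\<nu>\<close>.
\<close>

definition finite_measure_halfline :: "real measure \<Rightarrow> bool" where
  "finite_measure_halfline \<mu> \<longleftrightarrow>
     finite_measure \<mu> \<and> space \<mu> = {0..} \<and> sets \<mu> = sets (restrict_space borel {0..})"

definition laplace_representation ::
    "(real \<Rightarrow> real) \<Rightarrow> real measure \<Rightarrow> real measure \<Rightarrow> bool" where
  "laplace_representation f \<mu> \<nu> \<longleftrightarrow>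
     finite_measure_halfline \<mu> \<and> finite_measure_halfline \<nu> \<and>
     (\<forall>t>0. f t = (LINT s|\<mu>. exp (- t * s)) - (LINT s|\<nu>. exp (- t * s)))"

definition calc :: "(real \<Rightarrow> 'a::banach \<Rightarrow>\<^sub>L 'a) \<Rightarrow> (real \<Rightarrow> real) \<Rightarrow> 'a \<Rightarrow>\<^sub>L 'a" where
  "calc T f = (THE F. \<exists>\<mu> \<nu>. laplace_representation f \<mu> \<nu> \<and>
     (\<forall>x. blinfun_apply F x =
        vec_integral \<mu> (\<lambda>s. blinfun_apply (T s) x) - vec_integral \<nu> (\<lambda>s. blinfun_apply (T s) x)))"

definition bernstein_op ::
    "(real \<Rightarrow> 'a::banach \<Rightarrow>\<^sub>L 'a) \<Rightarrow> ('a \<rightharpoonup> 'a) \<Rightarrow> (real \<Rightarrow> real) \<Rightarrow> ('a \<rightharpoonup> 'a)" where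
  "bernstein_op T A psi = one_plus_op A \<circ>\<^sub>m of_blinfun (calc T (\<lambda>z. psi z / (1 + z)))"

end

theory Submission
  imports Defs "HOL-Probability.Probability"
begin

text \<open>
  The quantity to be bounded is \<open>\<psi>(A)g(A)\<close>. Write \<open>g(t) = \<integral> e\<^sup>-\<^sup>t\<^sup>s \<mu>(ds)\<close> and, with the Levy measure \<open>\<gamma>\<close> of
  \<open>\<psi>\<close>, \<open>\<psi>(z) = a + b z + \<integral> (1 - e\<^sup>-\<^sup>s\<^sup>z) \<gamma>(ds)\<close>. Formally
  \<open>\<psi>(A)g(A) = a g(A) + \<integral> W(t) \<mu>(dt)\<close> with
  \<open>W(t) = b A e\<^sup>-\<^sup>t\<^sup>A + \<integral> (e\<^sup>-\<^sup>t\<^sup>A - e\<^sup>-\<^sup>(\<^sup>t\<^sup>+\<^sup>s\<^sup>)\<^sup>A) \<gamma>(ds)\<close>.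
  With \<open>M\<close> the bound of the semigroup, the Yosida condition shows that the norm of
  \<open>e\<^sup>-\<^sup>t\<^sup>A - e\<^sup>-\<^sup>(\<^sup>t\<^sup>+\<^sup>s\<^sup>)\<^sup>A\<close> is at most \<open>min(2M, s c\<^sub>0 + s c\<^sub>1/t)\<close>, and elementary algebra bounds this by
  \<open>2 max(2M, c\<^sub>1) s/(s+t) + 4M s/(s + 1/c\<^sub>0)\<close>, the last term being absent if \<open>c\<^sub>0 = 0\<close>. Since
  \<open>b/\<tau> + \<integral> s/(s+\<tau>) \<gamma>(ds) = \<integral> e\<^sup>-\<^sup>\<tau>\<^sup>r \<psi>'(r) dr\<close>, integrating the first term against \<open>\<mu>\<close> produces \<open>J[g,\<psi>]\<close>
  and the second one produces \<open>g(0+) C[c\<^sub>0;\<psi>]\<close>, because \<open>g(0+)\<close> is the total mass of \<open>\<mu>\<close>.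

  To treat \<open>b\<close> and \<open>\<gamma>\<close> on the same footing, the whole argument is written in terms of the finite
  measure \<open>\<rho> = b \<delta>\<^sub>0 + (1 - e\<^sup>-\<^sup>s) \<gamma>(ds)\<close>. It is nothing but the representing measure of the bounded
  completely monotone function \<open>\<psi>(z+1) - \<psi>(z)\<close>, so that Bernstein's theorem for bounded functions
  (\<open>bernstein_finite\<close>) yields both \<open>\<mu>\<close> and \<open>\<rho>\<close>, and \<open>BF_representation\<close> recovers \<open>\<psi>\<close> from \<open>\<rho>\<close>.
  Bernstein's theorem itself is obtained from the Hausdorff moment problem on the grids of mesh
  \<open>1/N\<close> and Helly's selection theorem.

  The operator side never leaves bounded operators. The calculus of \<open>\<psi>(z)/(1+z)\<close> is computed from an
  explicit signed measure (\<open>bernstein_regularized_calc\<close>); on the orbits it factors as the resolvent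
  \<open>R = (1+A)\<^sup>-\<^sup>1\<close> applied to \<open>a e\<^sup>-\<^sup>t\<^sup>A + W(t)\<close> (\<open>regularized_calc_on_orbit\<close>). Integrating over \<open>\<mu>\<close> gives
  \<open>[\<psi>(z)/(1+z)](A) g(A) = R S\<close> with \<open>S = a g(A) + \<integral> W(t) \<mu>(dt)\<close> bounded, hence \<open>\<psi>(A)g(A) = S\<close>.
\<close>

section \<open>Integration in Banach spaces that need not be separable\<close>

text \<open>
  Separability enters the Bochner integral only through the existence of simple approximations. Asking for
  them pointwise keeps sums and limits measurable in a space without a countable base, where a sum of
  Borel functions need not be Borel.
\<close>

definition strongly_measurable :: "'s measure \<Rightarrow> ('s \<Rightarrow> 'a::real_normed_vector) \<Rightarrow> bool" where
  "strongly_measurable M f \<longleftrightarrow>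
     (\<exists>s. (\<forall>i. simple_function M (s i)) \<and> (\<forall>x\<in>space M. (\<lambda>i. s i x) \<longlonglongrightarrow> f x))"

lemma strongly_measurable_simple: "simple_function M f \<Longrightarrow> strongly_measurable M f"
  unfolding strongly_measurable_def by (rule exI[of _ "\<lambda>_. f"]) auto

lemma strongly_measurable_const: "strongly_measurable M (\<lambda>x. c)"
  by (rule strongly_measurable_simple, rule simple_function_const)

lemma strongly_measurable_compose2:
  assumes "strongly_measurable M f" "strongly_measurable M g"
    and h: "continuous_on UNIV (\<lambda>p. h (fst p) (snd p))"
  shows "strongly_measurable M (\<lambda>x. h (f x) (g x))"
proof -
  obtain s where s: "\<And>i. simple_function M (s i)" "\<And>x. x \<in> space M \<Longrightarrow> (\<lambda>i. s i x) \<longlonglongrightarrow> f x"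
    using assms(1) unfolding strongly_measurable_def by blast
  obtain t where t: "\<And>i. simple_function M (t i)" "\<And>x. x \<in> space M \<Longrightarrow> (\<lambda>i. t i x) \<longlonglongrightarrow> g x"
    using assms(2) unfolding strongly_measurable_def by blast
  have "(\<lambda>i. h (s i x) (t i x)) \<longlonglongrightarrow> h (f x) (g x)" if "x \<in> space M" for x
  proof -
    have "(\<lambda>i. (s i x, t i x)) \<longlonglongrightarrow> (f x, g x)"
      using s(2)[OF that] t(2)[OF that] by (rule tendsto_Pair)
    from continuous_on_tendsto_compose[OF h this] show ?thesis by simp
  qed
  moreover have "simple_function M (\<lambda>x. h (s i x) (t i x))" for i
    using s(1) t(1) by (rule simple_function_compose2)
  ultimately show ?thesis unfolding strongly_measurable_def
    by (intro exI[of _ "\<lambda>i x. h (s i x) (t i x)"]) blast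
qed

lemma strongly_measurable_add:
  "strongly_measurable M f \<Longrightarrow> strongly_measurable M g \<Longrightarrow> strongly_measurable M (\<lambda>x. f x + g x)"
  by (rule strongly_measurable_compose2) (auto intro!: continuous_intros)

lemma strongly_measurable_diff:
  "strongly_measurable M f \<Longrightarrow> strongly_measurable M g \<Longrightarrow> strongly_measurable M (\<lambda>x. f x - g x)"
  by (rule strongly_measurable_compose2) (auto intro!: continuous_intros)

lemma strongly_measurable_scaleR:
  "strongly_measurable M f \<Longrightarrow> strongly_measurable M g \<Longrightarrow> strongly_measurable M (\<lambda>x. f x *\<^sub>R g x)"
  by (rule strongly_measurable_compose2) (auto intro!: continuous_intros)

lemma strongly_measurable_bounded_linear:
  assumes "strongly_measurable M f" "bounded_linear h"
  shows "strongly_measurable M (\<lambda>x. h (f x))"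
proof -
  have "continuous_on UNIV (\<lambda>p. h (fst p))"
    by (rule bounded_linear.continuous_on[OF assms(2)]) (intro continuous_intros)
  then show ?thesis
    by (rule strongly_measurable_compose2[OF assms(1) assms(1), where h = "\<lambda>a b. h a"])
qed

lemma strongly_measurable_sum:
  assumes "\<And>i. i \<in> I \<Longrightarrow> strongly_measurable M (f i)"
  shows "strongly_measurable M (\<lambda>x. \<Sum>i\<in>I. f i x)"
  using assms
proof (induction I rule: infinite_finite_induct)
  case (insert i I)
  then show ?case using strongly_measurable_add[of M "f i" "\<lambda>x. \<Sum>i\<in>I. f i x"] by simp
qed (simp_all add: strongly_measurable_const)

lemma strongly_measurable_cong:
  assumes "\<And>x. x \<in> space M \<Longrightarrow> f x = g x"
  shows "strongly_measurable M f \<longleftrightarrow> strongly_measurable M g"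
  unfolding strongly_measurable_def using assms by simp

lemma borel_measurable_strongly_measurable:
  assumes "strongly_measurable M f" shows "f \<in> borel_measurable M"
proof -
  obtain s where s: "\<And>i. simple_function M (s i)" "\<And>x. x \<in> space M \<Longrightarrow> (\<lambda>i. s i x) \<longlonglongrightarrow> f x"
    using assms unfolding strongly_measurable_def by blast
  show ?thesis by (rule borel_measurable_LIMSEQ_metric[OF borel_measurable_simple_function[OF s(1)] s(2)])
qed

lemma borel_measurable_norm_strongly_measurable:
  "strongly_measurable M f \<Longrightarrow> (\<lambda>x. norm (f x)) \<in> borel_measurable M"
  by (rule measurable_compose[OF borel_measurable_strongly_measurable])
     (auto intro!: borel_measurable_continuous_onI continuous_intros)

lemma strongly_measurable_real:
  fixes f :: "'s \<Rightarrow> real"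
  assumes "f \<in> borel_measurable M" shows "strongly_measurable M f"
proof -
  obtain s where "\<And>i. simple_function M (s i)" "\<And>x. x \<in> space M \<Longrightarrow> (\<lambda>i. s i x) \<longlonglongrightarrow> f x"
    using borel_measurable_implies_sequence_metric[OF assms, of 0] by blast
  then show ?thesis unfolding strongly_measurable_def by blast
qed

definition vec_integrable :: "'s measure \<Rightarrow> ('s \<Rightarrow> 'a::real_normed_vector) \<Rightarrow> bool" where
  "vec_integrable M f \<longleftrightarrow> strongly_measurable M f \<and> (\<integral>\<^sup>+x. ennreal (norm (f x)) \<partial>M) < \<infinity>"

text \<open>
  The integral converges along any simple approximation in mean. One is obtained from a pointwise one by
  cutting off large values and applying dominated convergence to the norms.
\<close>

lemma vec_integrable_approx:
  fixes f :: "'s \<Rightarrow> 'a::real_normed_vector"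
  assumes fin: "finite_measure M" and f: "vec_integrable M f"
  obtains s where "\<And>i. Bochner_Integration.simple_bochner_integrable M (s i)"
    "(\<lambda>i. \<integral>\<^sup>+x. ennreal (norm (f x - s i x)) \<partial>M) \<longlonglongrightarrow> 0"
proof -
  interpret finite_measure M by fact
  have sm: "strongly_measurable M f" and fi: "(\<integral>\<^sup>+x. ennreal (norm (f x)) \<partial>M) < \<infinity>"
    using f by (auto simp: vec_integrable_def)
  obtain s where s: "\<And>i. simple_function M (s i)" "\<And>x. x \<in> space M \<Longrightarrow> (\<lambda>i. s i x) \<longlonglongrightarrow> f x"
    using sm unfolding strongly_measurable_def by blast
  \<comment> \<open>truncating where \<open>s i\<close> is large compared with \<open>f\<close> makes \<open>3 * norm (f x)\<close> a dominating function\<close>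
  define t where "t i x = (if norm (s i x) \<le> 2 * norm (f x) then s i x else 0)" for i x
  have ns[measurable]: "(\<lambda>x. norm (s i x)) \<in> borel_measurable M" for i
    by (rule borel_measurable_norm_strongly_measurable[OF strongly_measurable_simple[OF s(1)]])
  have nf[measurable]: "(\<lambda>x. norm (f x)) \<in> borel_measurable M"
    by (rule borel_measurable_norm_strongly_measurable[OF sm])
  have t_simple: "simple_function M (t i)" for i
    unfolding t_def by (rule simple_function_If[OF s(1)]) auto
  have t_lim: "(\<lambda>i. t i x) \<longlonglongrightarrow> f x" if x: "x \<in> space M" for x
  proof (cases "f x = 0")
    case True
    then have "t i x = 0" for i by (auto simp: t_def)
    then show ?thesis using True by simp
  next
    case False
    have "(\<lambda>i. norm (s i x)) \<longlonglongrightarrow> norm (f x)" by (rule tendsto_norm[OF s(2)[OF x]])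
    moreover have "norm (f x) < 2 * norm (f x)" using False by simp
    ultimately have "eventually (\<lambda>i. norm (s i x) < 2 * norm (f x)) sequentially"
      by (rule order_tendstoD(2))
    then have "eventually (\<lambda>i. s i x = t i x) sequentially"
      by eventually_elim (auto simp: t_def)
    then show ?thesis using s(2)[OF x] by (rule Lim_transform_eventually[rotated])
  qed
  have meas: "(\<lambda>x. ennreal (norm (f x - t i x))) \<in> borel_measurable M" for i
    using borel_measurable_norm_strongly_measurable[OF
        strongly_measurable_diff[OF sm strongly_measurable_simple[OF t_simple[of i]]]]
    by measurable
  have "(\<lambda>i. \<integral>\<^sup>+x. ennreal (norm (f x - t i x)) \<partial>M) \<longlonglongrightarrow> (\<integral>\<^sup>+x. 0 \<partial>M)"
  proof (rule nn_integral_dominated_convergence[where w = "\<lambda>x. ennreal 3 * ennreal (norm (f x))"])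
    show "AE x in M. ennreal (norm (f x - t j x)) \<le> ennreal 3 * ennreal (norm (f x))" for j
    proof (rule AE_I2)
      fix x
      have "norm (f x - t j x) \<le> norm (f x) + norm (t j x)" by (rule norm_triangle_ineq4)
      also have "norm (t j x) \<le> 2 * norm (f x)" by (auto simp: t_def)
      finally have "norm (f x - t j x) \<le> 3 * norm (f x)" by simp
      then show "ennreal (norm (f x - t j x)) \<le> ennreal 3 * ennreal (norm (f x))"
        by (metis ennreal_leI ennreal_mult' norm_ge_zero zero_le_numeral)
    qed
    show "(\<integral>\<^sup>+x. ennreal 3 * ennreal (norm (f x)) \<partial>M) < \<infinity>"
      using fi by (subst nn_integral_cmult) (auto simp: ennreal_mult_less_top)
    show "AE x in M. (\<lambda>i. ennreal (norm (f x - t i x))) \<longlonglongrightarrow> 0"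
    proof (rule AE_I2)
      fix x assume "x \<in> space M"
      then have "(\<lambda>i. norm (f x - t i x)) \<longlonglongrightarrow> norm (f x - f x)"
        by (intro tendsto_intros t_lim)
      then show "(\<lambda>i. ennreal (norm (f x - t i x))) \<longlonglongrightarrow> 0"
        using tendsto_ennrealI by fastforce
    qed
  qed (use meas in auto)
  moreover have "Bochner_Integration.simple_bochner_integrable M (t i)" for i
    by (rule simple_bochner_integrable.intros[OF t_simple]) (simp add: emeasure_eq_measure)
  ultimately show ?thesis by (intro that[of t]) simp_all
qed

lemma borel_measurable_norm_diff_simple:
  assumes "strongly_measurable M f" "Bochner_Integration.simple_bochner_integrable M s"
  shows "(\<lambda>x. norm (f x - s x)) \<in> borel_measurable M"
proof -
  have "strongly_measurable M s"
    using assms(2) by (auto elim!: simple_bochner_integrable.cases intro: strongly_measurable_simple)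
  then show ?thesis
    by (intro borel_measurable_norm_strongly_measurable strongly_measurable_diff assms(1))
qed

lemma ennreal_norm_triangle:
  "ennreal (norm (a - b)) \<le> ennreal (norm (c - a)) + ennreal (norm (c - b))"
proof -
  have "norm (a - b) \<le> norm (c - a) + norm (c - b)"
    using norm_triangle_ineq4[of "c - b" "c - a"] by simp
  then show ?thesis by (simp add: ennreal_leI flip: ennreal_plus)
qed

lemma simple_bochner_integral_close:
  fixes f :: "'s \<Rightarrow> 'a::real_normed_vector"
  assumes f: "strongly_measurable M f"
    and s: "Bochner_Integration.simple_bochner_integrable M s"
    and t: "Bochner_Integration.simple_bochner_integrable M t"
  shows "ennreal (norm (Bochner_Integration.simple_bochner_integral M s -
           Bochner_Integration.simple_bochner_integral M t)) \<le>
         (\<integral>\<^sup>+ x. norm (f x - s x) \<partial>M) + (\<integral>\<^sup>+ x. norm (f x - t x) \<partial>M)"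
proof -
  have [measurable]: "(\<lambda>x. norm (f x - s x)) \<in> borel_measurable M"
    "(\<lambda>x. norm (f x - t x)) \<in> borel_measurable M"
    using f s t
    by (auto intro: borel_measurable_norm_diff_simple)
  have st: "Bochner_Integration.simple_bochner_integrable M (\<lambda>x. s x - t x)"
    using simple_bochner_integrable_compose2[of "(-)" M s t] s t by simp
  have nst: "Bochner_Integration.simple_bochner_integrable M (\<lambda>x. norm (s x - t x))"
    using simple_bochner_integrable_compose2[of "\<lambda>x y. norm (x - y)" M s t] s t by simp
  have "ennreal (norm (Bochner_Integration.simple_bochner_integral M s -
           Bochner_Integration.simple_bochner_integral M t))
       = norm (Bochner_Integration.simple_bochner_integral M (\<lambda>x. s x - t x))"
    using s t by (subst simple_bochner_integral_diff) auto
  also have "\<dots> \<le> Bochner_Integration.simple_bochner_integral M (\<lambda>x. norm (s x - t x))"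
    using st by (auto intro!: simple_bochner_integral_norm_bound)
  also have "\<dots> = (\<integral>\<^sup>+x. norm (s x - t x) \<partial>M)"
    using nst by (auto intro!: simple_bochner_integral_eq_nn_integral)
  also have "\<dots> \<le> (\<integral>\<^sup>+x. ennreal (norm (f x - s x)) + ennreal (norm (f x - t x)) \<partial>M)"
    by (intro nn_integral_mono ennreal_norm_triangle)
  also have "\<dots> = (\<integral>\<^sup>+ x. norm (f x - s x) \<partial>M) + (\<integral>\<^sup>+ x. norm (f x - t x) \<partial>M)"
    by (rule nn_integral_add) auto
  finally show ?thesis .
qed

text \<open>
  Simple integrals of two approximations differ by at most the sum of the two errors in mean.
\<close>

lemma has_vec_integral_unique:
  fixes f :: "'s \<Rightarrow> 'a::real_normed_vector"
  assumes sm: "strongly_measurable M f" and y: "has_vec_integral M f y" and z: "has_vec_integral M f z"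
  shows "y = z"
proof -
  obtain s where s: "\<And>i. Bochner_Integration.simple_bochner_integrable M (s i)"
    "(\<lambda>i. \<integral>\<^sup>+x. ennreal (norm (f x - s i x)) \<partial>M) \<longlonglongrightarrow> 0"
    "(\<lambda>i. Bochner_Integration.simple_bochner_integral M (s i)) \<longlonglongrightarrow> y"
    using y unfolding has_vec_integral_def by blast
  obtain t where t: "\<And>i. Bochner_Integration.simple_bochner_integrable M (t i)"
    "(\<lambda>i. \<integral>\<^sup>+x. ennreal (norm (f x - t i x)) \<partial>M) \<longlonglongrightarrow> 0"
    "(\<lambda>i. Bochner_Integration.simple_bochner_integral M (t i)) \<longlonglongrightarrow> z"
    using z unfolding has_vec_integral_def by blast
  have "(\<lambda>i. ennreal (norm (Bochner_Integration.simple_bochner_integral M (s i) -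
           Bochner_Integration.simple_bochner_integral M (t i)))) \<longlonglongrightarrow> ennreal (norm (y - z))"
    by (intro tendsto_intros tendsto_ennrealI s t)
  moreover have "(\<lambda>i. ennreal (norm (Bochner_Integration.simple_bochner_integral M (s i) -
           Bochner_Integration.simple_bochner_integral M (t i)))) \<longlonglongrightarrow> 0"
  proof (rule tendsto_sandwich[OF always_eventually always_eventually tendsto_const])
    show "(\<lambda>i. (\<integral>\<^sup>+x. ennreal (norm (f x - s i x)) \<partial>M) + (\<integral>\<^sup>+x. ennreal (norm (f x - t i x)) \<partial>M)) \<longlonglongrightarrow> 0"
      using tendsto_add[OF s(2) t(2)] by simp
    show "\<forall>i. ennreal (norm (Bochner_Integration.simple_bochner_integral M (s i) -
           Bochner_Integration.simple_bochner_integral M (t i))) \<le>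
        (\<integral>\<^sup>+x. ennreal (norm (f x - s i x)) \<partial>M) + (\<integral>\<^sup>+x. ennreal (norm (f x - t i x)) \<partial>M)"
      using simple_bochner_integral_close[OF sm s(1) t(1)] by blast
  qed auto
  ultimately have "ennreal (norm (y - z)) = 0" by (rule LIMSEQ_unique)
  then show ?thesis by simp
qed

lemma vec_integral_eqI:
  "strongly_measurable M f \<Longrightarrow> has_vec_integral M f y \<Longrightarrow> vec_integral M f = y"
  unfolding vec_integral_def by (rule the_equality) (auto intro: has_vec_integral_unique)

text \<open>
  The simple integrals form a Cauchy sequence, so completeness supplies the limit.
\<close>

lemma has_vec_integral_exists:
  fixes f :: "'s \<Rightarrow> 'a::banach"
  assumes sm: "strongly_measurable M f"
    and s: "\<And>i. Bochner_Integration.simple_bochner_integrable M (s i)"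
    and lim: "(\<lambda>i. \<integral>\<^sup>+x. ennreal (norm (f x - s i x)) \<partial>M) \<longlonglongrightarrow> 0"
  shows "\<exists>y. has_vec_integral M f y \<and> (\<lambda>i. Bochner_Integration.simple_bochner_integral M (s i)) \<longlonglongrightarrow> y"
proof -
  let ?I = "\<lambda>i. Bochner_Integration.simple_bochner_integral M (s i)"
  let ?d = "\<lambda>i. \<integral>\<^sup>+x. ennreal (norm (f x - s i x)) \<partial>M"
  have "Cauchy ?I"
  proof (rule metric_CauchyI)
    fix e :: real assume e: "0 < e"
    have "eventually (\<lambda>i. ?d i < ennreal (e / 2)) sequentially"
      using lim e by (intro order_tendstoD(2)[OF lim]) auto
    then obtain N where N: "\<And>i. i \<ge> N \<Longrightarrow> ?d i < ennreal (e / 2)"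
      unfolding eventually_sequentially by blast
    have "dist (?I m) (?I n) < e" if "m \<ge> N" "n \<ge> N" for m n
    proof -
      have "ennreal (norm (?I m - ?I n)) \<le> ?d m + ?d n"
        by (rule simple_bochner_integral_close[OF sm s s])
      also have "\<dots> < ennreal (e / 2) + ennreal (e / 2)"
        using N[OF that(1)] N[OF that(2)] by (rule add_strict_mono)
      also have "\<dots> = ennreal e" using e by (simp flip: ennreal_plus)
      finally show ?thesis using e by (simp add: dist_norm ennreal_less_iff)
    qed
    then show "\<exists>N. \<forall>m\<ge>N. \<forall>n\<ge>N. dist (?I m) (?I n) < e" by blast
  qed
  then obtain y where y: "?I \<longlonglongrightarrow> y"
    using Cauchy_convergent_iff convergent_def by blast
  have "has_vec_integral M f y"
    unfolding has_vec_integral_def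
    using borel_measurable_strongly_measurable[OF sm] s lim y by blast
  then show ?thesis using y by blast
qed

lemma vec_integral_limit:
  fixes f :: "'s \<Rightarrow> 'a::banach"
  assumes sm: "strongly_measurable M f"
    and s: "\<And>i. Bochner_Integration.simple_bochner_integrable M (s i)"
    and lim: "(\<lambda>i. \<integral>\<^sup>+x. ennreal (norm (f x - s i x)) \<partial>M) \<longlonglongrightarrow> 0"
  shows "has_vec_integral M f (vec_integral M f)"
    "(\<lambda>i. Bochner_Integration.simple_bochner_integral M (s i)) \<longlonglongrightarrow> vec_integral M f"
  using has_vec_integral_exists[OF assms] vec_integral_eqI[OF sm] by auto

context
  fixes M :: "'s measure"
  assumes fin: "finite_measure M"
begin

lemma vec_integral_add:
  fixes f g :: "'s \<Rightarrow> 'a::banach"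
  assumes f: "vec_integrable M f" and g: "vec_integrable M g"
  shows "vec_integral M (\<lambda>x. f x + g x) = vec_integral M f + vec_integral M g"
proof -
  have smf: "strongly_measurable M f" and smg: "strongly_measurable M g"
    using f g by (auto simp: vec_integrable_def)
  obtain s where s: "\<And>i. Bochner_Integration.simple_bochner_integrable M (s i)"
    "(\<lambda>i. \<integral>\<^sup>+x. ennreal (norm (f x - s i x)) \<partial>M) \<longlonglongrightarrow> 0"
    using vec_integrable_approx[OF fin f] by blast
  obtain t where t: "\<And>i. Bochner_Integration.simple_bochner_integrable M (t i)"
    "(\<lambda>i. \<integral>\<^sup>+x. ennreal (norm (g x - t i x)) \<partial>M) \<longlonglongrightarrow> 0"
    using vec_integrable_approx[OF fin g] by blast
  have st: "Bochner_Integration.simple_bochner_integrable M (\<lambda>x. s i x + t i x)" for i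
    using simple_bochner_integrable_compose2[of "(+)" M "s i" "t i"] s t by simp
  have [measurable]: "(\<lambda>x. norm (f x - s i x)) \<in> borel_measurable M"
    "(\<lambda>x. norm (g x - t i x)) \<in> borel_measurable M" for i
    using smf smg s t
    by (auto intro: borel_measurable_norm_diff_simple)
  have lim: "(\<lambda>i. \<integral>\<^sup>+x. ennreal (norm (f x + g x - (s i x + t i x))) \<partial>M) \<longlonglongrightarrow> 0"
  proof (rule tendsto_sandwich[OF always_eventually always_eventually tendsto_const])
    show "(\<lambda>i. (\<integral>\<^sup>+x. ennreal (norm (f x - s i x)) \<partial>M) + (\<integral>\<^sup>+x. ennreal (norm (g x - t i x)) \<partial>M)) \<longlonglongrightarrow> 0"
      using tendsto_add[OF s(2) t(2)] by simp
    have "(\<integral>\<^sup>+x. ennreal (norm (f x + g x - (s i x + t i x))) \<partial>M)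
        \<le> (\<integral>\<^sup>+x. ennreal (norm (f x - s i x)) + ennreal (norm (g x - t i x)) \<partial>M)" for i
      by (intro nn_integral_mono)
         (simp add: ennreal_leI norm_diff_triangle_ineq flip: ennreal_plus)
    then show "\<forall>i. (\<integral>\<^sup>+x. ennreal (norm (f x + g x - (s i x + t i x))) \<partial>M) \<le>
        (\<integral>\<^sup>+x. ennreal (norm (f x - s i x)) \<partial>M) + (\<integral>\<^sup>+x. ennreal (norm (g x - t i x)) \<partial>M)"
      by (subst (asm) nn_integral_add) auto
  qed auto
  have 1: "(\<lambda>i. Bochner_Integration.simple_bochner_integral M (\<lambda>x. s i x + t i x))
        \<longlonglongrightarrow> vec_integral M (\<lambda>x. f x + g x)"
    by (rule vec_integral_limit(2)[OF strongly_measurable_add[OF smf smg] st lim])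
  have "(\<lambda>i. Bochner_Integration.simple_bochner_integral M (\<lambda>x. s i x + t i x))
        \<longlonglongrightarrow> vec_integral M f + vec_integral M g"
    using tendsto_add[OF vec_integral_limit(2)[OF smf s] vec_integral_limit(2)[OF smg t]]
    by (simp add: simple_bochner_integral_add[OF s(1) t(1)])
  with 1 show ?thesis by (rule LIMSEQ_unique)
qed

text \<open>
  Closed formulas for operators are obtained by pulling bounded operators (the semigroup, the resolvent,
  the regularised operator) through integrals over orbits.
\<close>

lemma vec_integral_bounded_linear:
  fixes f :: "'s \<Rightarrow> 'a::banach" and h :: "'a \<Rightarrow> 'b::banach"
  assumes f: "vec_integrable M f" and h: "bounded_linear h"
  shows "vec_integral M (\<lambda>x. h (f x)) = h (vec_integral M f)"
proof -
  have smf: "strongly_measurable M f" using f by (auto simp: vec_integrable_def)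
  obtain s where s: "\<And>i. Bochner_Integration.simple_bochner_integrable M (s i)"
    "(\<lambda>i. \<integral>\<^sup>+x. ennreal (norm (f x - s i x)) \<partial>M) \<longlonglongrightarrow> 0"
    using vec_integrable_approx[OF fin f] by blast
  obtain K where K: "K > 0" "\<And>x. norm (h x) \<le> norm x * K"
    using bounded_linear.pos_bounded[OF h] by blast
  have lin: "linear h" using h by (rule bounded_linear.linear)
  have hs: "Bochner_Integration.simple_bochner_integrable M (\<lambda>x. h (s i x))" for i
    using simple_bochner_integrable_compose2[of "\<lambda>x y. h x" M "s i" "s i"] s linear_0[OF lin] by simp
  have [measurable]: "(\<lambda>x. norm (f x - s i x)) \<in> borel_measurable M" for i
    using smf s
    by (auto intro: borel_measurable_norm_diff_simple)
  have lim: "(\<lambda>i. \<integral>\<^sup>+x. ennreal (norm (h (f x) - h (s i x))) \<partial>M) \<longlonglongrightarrow> 0"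
  proof (rule tendsto_sandwich[OF always_eventually always_eventually tendsto_const])
    show "(\<lambda>i. ennreal K * (\<integral>\<^sup>+x. ennreal (norm (f x - s i x)) \<partial>M)) \<longlonglongrightarrow> 0"
      using ennreal_tendsto_cmult[OF _ s(2), of "ennreal K"] by simp
    have "(\<integral>\<^sup>+x. ennreal (norm (h (f x) - h (s i x))) \<partial>M)
        \<le> (\<integral>\<^sup>+x. ennreal K * ennreal (norm (f x - s i x)) \<partial>M)" for i
    proof (intro nn_integral_mono)
      fix x
      have "norm (h (f x) - h (s i x)) \<le> K * norm (f x - s i x)"
        using K(2)[of "f x - s i x"] by (simp add: linear_diff[OF lin] mult.commute)
      then show "ennreal (norm (h (f x) - h (s i x))) \<le> ennreal K * ennreal (norm (f x - s i x))"
        using K(1) by (simp add: ennreal_leI flip: ennreal_mult)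
    qed
    then show "\<forall>i. (\<integral>\<^sup>+x. ennreal (norm (h (f x) - h (s i x))) \<partial>M)
        \<le> ennreal K * (\<integral>\<^sup>+x. ennreal (norm (f x - s i x)) \<partial>M)"
      by (subst (asm) nn_integral_cmult) auto
  qed auto
  have 1: "(\<lambda>i. Bochner_Integration.simple_bochner_integral M (\<lambda>x. h (s i x)))
        \<longlonglongrightarrow> vec_integral M (\<lambda>x. h (f x))"
    by (rule vec_integral_limit(2)[OF strongly_measurable_bounded_linear[OF smf h] hs lim])
  have "(\<lambda>i. Bochner_Integration.simple_bochner_integral M (\<lambda>x. h (s i x)))
        \<longlonglongrightarrow> h (vec_integral M f)"
    using bounded_linear.tendsto[OF h vec_integral_limit(2)[OF smf s]]
    by (simp add: simple_bochner_integral_linear[OF lin s(1)])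
  with 1 show ?thesis by (rule LIMSEQ_unique)
qed

lemma norm_vec_integral_le:
  fixes f :: "'s \<Rightarrow> 'a::banach"
  assumes f: "vec_integrable M f"
  shows "ennreal (norm (vec_integral M f)) \<le> (\<integral>\<^sup>+x. ennreal (norm (f x)) \<partial>M)"
proof -
  have smf: "strongly_measurable M f" using f by (auto simp: vec_integrable_def)
  obtain s where s: "\<And>i. Bochner_Integration.simple_bochner_integrable M (s i)"
    "(\<lambda>i. \<integral>\<^sup>+x. ennreal (norm (f x - s i x)) \<partial>M) \<longlonglongrightarrow> 0"
    using vec_integrable_approx[OF fin f] by blast
  have 0: "Bochner_Integration.simple_bochner_integrable M (\<lambda>x. 0::'a)"
    by (rule simple_bochner_integrable.intros) auto
  have simple_0: "Bochner_Integration.simple_bochner_integral M (\<lambda>x. 0::'a) = 0"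
    unfolding simple_bochner_integral_def by (rule sum.neutral) auto
  have "(\<lambda>i. ennreal (norm (Bochner_Integration.simple_bochner_integral M (s i))))
     \<longlonglongrightarrow> ennreal (norm (vec_integral M f))"
    by (intro tendsto_ennrealI tendsto_norm vec_integral_limit(2)[OF smf s])
  moreover have "(\<lambda>i. (\<integral>\<^sup>+x. ennreal (norm (f x - s i x)) \<partial>M) + (\<integral>\<^sup>+x. ennreal (norm (f x)) \<partial>M))
     \<longlonglongrightarrow> 0 + (\<integral>\<^sup>+x. ennreal (norm (f x)) \<partial>M)"
    by (intro tendsto_intros s)
  ultimately have "ennreal (norm (vec_integral M f)) \<le> 0 + (\<integral>\<^sup>+x. ennreal (norm (f x)) \<partial>M)"
  proof (rule LIMSEQ_le)
    have "ennreal (norm (Bochner_Integration.simple_bochner_integral M (s i)))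
      \<le> (\<integral>\<^sup>+x. ennreal (norm (f x - s i x)) \<partial>M) + (\<integral>\<^sup>+x. ennreal (norm (f x)) \<partial>M)" for i
      using simple_bochner_integral_close[OF smf s(1)[of i] 0]
      by (simp add: simple_0)
    then show "\<exists>N. \<forall>n\<ge>N. ennreal (norm (Bochner_Integration.simple_bochner_integral M (s n)))
      \<le> (\<integral>\<^sup>+x. ennreal (norm (f x - s n x)) \<partial>M) + (\<integral>\<^sup>+x. ennreal (norm (f x)) \<partial>M)" by blast
  qed
  then show ?thesis by simp
qed

lemma vec_integrable_bounded:
  assumes "strongly_measurable M f" "\<And>x. x \<in> space M \<Longrightarrow> norm (f x) \<le> B"
  shows "vec_integrable M f"
proof -
  interpret finite_measure M by fact
  have "(\<integral>\<^sup>+x. ennreal (norm (f x)) \<partial>M) \<le> (\<integral>\<^sup>+x. ennreal B \<partial>M)"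
    by (intro nn_integral_mono ennreal_leI assms(2))
  also have "\<dots> < \<infinity>" by (simp add: emeasure_eq_measure ennreal_mult_less_top)
  finally show ?thesis using assms(1) by (simp add: vec_integrable_def)
qed

lemma vec_integrable_add:
  assumes f: "vec_integrable M f" and g: "vec_integrable M g"
  shows "vec_integrable M (\<lambda>x. f x + g x)"
proof -
  have [measurable]: "(\<lambda>x. norm (f x)) \<in> borel_measurable M" "(\<lambda>x. norm (g x)) \<in> borel_measurable M"
    using f g by (auto simp: vec_integrable_def borel_measurable_norm_strongly_measurable)
  have "(\<integral>\<^sup>+x. ennreal (norm (f x + g x)) \<partial>M) \<le> (\<integral>\<^sup>+x. ennreal (norm (f x)) + ennreal (norm (g x)) \<partial>M)"
    by (intro nn_integral_mono) (simp add: ennreal_leI norm_triangle_ineq flip: ennreal_plus)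
  also have "\<dots> = (\<integral>\<^sup>+x. ennreal (norm (f x)) \<partial>M) + (\<integral>\<^sup>+x. ennreal (norm (g x)) \<partial>M)"
    by (rule nn_integral_add) auto
  also have "\<dots> < \<infinity>" using f g by (auto simp: vec_integrable_def)
  finally show ?thesis using f g by (auto simp: vec_integrable_def intro: strongly_measurable_add)
qed

lemma vec_integrable_bounded_linear:
  assumes f: "vec_integrable M f" and h: "bounded_linear h"
  shows "vec_integrable M (\<lambda>x. h (f x))"
proof -
  have [measurable]: "(\<lambda>x. norm (f x)) \<in> borel_measurable M"
    using f by (auto simp: vec_integrable_def borel_measurable_norm_strongly_measurable)
  obtain K where K: "K > 0" "\<And>x. norm (h x) \<le> norm x * K"
    using bounded_linear.pos_bounded[OF h] by blast
  have "(\<integral>\<^sup>+x. ennreal (norm (h (f x))) \<partial>M) \<le> (\<integral>\<^sup>+x. ennreal (norm (f x)) * ennreal K \<partial>M)"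
    using K by (intro nn_integral_mono) (simp add: ennreal_leI flip: ennreal_mult)
  also have "\<dots> = (\<integral>\<^sup>+x. ennreal (norm (f x)) \<partial>M) * ennreal K"
    by (rule nn_integral_multc) auto
  also have "\<dots> < \<infinity>" using f by (auto simp: vec_integrable_def ennreal_mult_less_top)
  finally show ?thesis
    using f h by (auto simp: vec_integrable_def intro: strongly_measurable_bounded_linear)
qed

lemma vec_integral_diff:
  fixes f g :: "'s \<Rightarrow> 'a::banach"
  assumes f: "vec_integrable M f" and g: "vec_integrable M g"
  shows "vec_integral M (\<lambda>x. f x - g x) = vec_integral M f - vec_integral M g"
  using vec_integral_add[OF f vec_integrable_bounded_linear[OF g bounded_linear_minus[OF bounded_linear_ident]]]
    vec_integral_bounded_linear[OF g bounded_linear_minus[OF bounded_linear_ident]] by simp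

lemma vec_integral_real:
  fixes f :: "'s \<Rightarrow> real"
  assumes "integrable M f" shows "vec_integrable M f" "vec_integral M f = integral\<^sup>L M f"
proof -
  have m: "f \<in> borel_measurable M" using assms by simp
  show "vec_integrable M f"
    using assms strongly_measurable_real[OF m] by (simp add: vec_integrable_def integrable_iff_bounded)
  show "vec_integral M f = integral\<^sup>L M f"
    by (rule vec_integral_eqI[OF strongly_measurable_real[OF m]])
       (simp add: has_vec_integral_iff_has_bochner_integral has_bochner_integral_integrable assms)
qed

lemma vec_integral_scaleR_const:
  fixes c :: "'a::banach"
  assumes "integrable M (f :: 's \<Rightarrow> real)"
  shows "vec_integrable M (\<lambda>x. f x *\<^sub>R c)" "vec_integral M (\<lambda>x. f x *\<^sub>R c) = integral\<^sup>L M f *\<^sub>R c"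
proof -
  note bl = bounded_linear_scaleR_left[of c]
  show "vec_integrable M (\<lambda>x. f x *\<^sub>R c)"
    by (rule vec_integrable_bounded_linear[OF vec_integral_real(1)[OF assms] bl])
  show "vec_integral M (\<lambda>x. f x *\<^sub>R c) = integral\<^sup>L M f *\<^sub>R c"
    unfolding vec_integral_bounded_linear[OF vec_integral_real(1)[OF assms] bl]
      vec_integral_real(2)[OF assms] ..
qed

lemma vec_integrable_sum:
  assumes "\<And>i. i \<in> I \<Longrightarrow> vec_integrable M (f i)"
  shows "vec_integrable M (\<lambda>x. \<Sum>i\<in>I. f i x)"
  using assms
proof (induction I rule: infinite_finite_induct)
  case (insert i I)
  then show ?case using vec_integrable_add[of "f i" "\<lambda>x. \<Sum>i\<in>I. f i x"] by simp
qed (auto simp: vec_integrable_def strongly_measurable_const)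

lemma vec_integral_sum:
  fixes f :: "'i \<Rightarrow> 's \<Rightarrow> 'a::banach"
  assumes "finite I" "\<And>i. i \<in> I \<Longrightarrow> vec_integrable M (f i)"
  shows "vec_integral M (\<lambda>x. \<Sum>i\<in>I. f i x) = (\<Sum>i\<in>I. vec_integral M (f i))"
  using assms
proof (induction I rule: finite_induct)
  case empty
  show ?case using vec_integral_scaleR_const(2)[of "\<lambda>x. 0" 0] by simp
next
  case (insert i I)
  then show ?case
    using vec_integral_add[of "f i" "\<lambda>x. \<Sum>i\<in>I. f i x"] vec_integrable_sum[of I f] by simp
qed

text \<open>
  A constant bound suffices because the measure is finite; the error is controlled by the scalar integral of
  the norm of the difference.
\<close>

lemma vec_integral_dominated_convergence:
  fixes f :: "'s \<Rightarrow> 'a::banach"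
  assumes u: "\<And>i. strongly_measurable M (u i)" and f: "strongly_measurable M f"
    and lim: "\<And>x. x \<in> space M \<Longrightarrow> (\<lambda>i. u i x) \<longlonglongrightarrow> f x"
    and B: "\<And>i x. x \<in> space M \<Longrightarrow> norm (u i x) \<le> B"
  shows "(\<lambda>i. vec_integral M (u i)) \<longlonglongrightarrow> vec_integral M f"
proof -
  interpret finite_measure M by fact
  have Bf: "norm (f x) \<le> B" if "x \<in> space M" for x
    by (rule LIMSEQ_le_const2[OF tendsto_norm[OF lim[OF that]]]) (use B that in auto)
  have ui: "vec_integrable M (u i)" for i by (rule vec_integrable_bounded[OF u B])
  have fi: "vec_integrable M f" by (rule vec_integrable_bounded[OF f Bf])
  have "(\<lambda>i. \<integral>\<^sup>+x. ennreal (norm (u i x - f x)) \<partial>M) \<longlonglongrightarrow> (\<integral>\<^sup>+x. 0 \<partial>M)"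
  proof (rule nn_integral_dominated_convergence[where w = "\<lambda>x. ennreal (2 * B)"])
    show "AE x in M. ennreal (norm (u j x - f x)) \<le> ennreal (2 * B)" for j
    proof (rule AE_I2)
      fix x assume x: "x \<in> space M"
      show "ennreal (norm (u j x - f x)) \<le> ennreal (2 * B)"
        using norm_triangle_ineq4[of "u j x" "f x"] B[OF x, of j] Bf[OF x] by (intro ennreal_leI) linarith
    qed
    show "AE x in M. (\<lambda>i. ennreal (norm (u i x - f x))) \<longlonglongrightarrow> 0"
    proof (rule AE_I2)
      fix x assume "x \<in> space M"
      then have "(\<lambda>i. norm (u i x - f x)) \<longlonglongrightarrow> norm (f x - f x)"
        by (intro tendsto_intros lim)
      then show "(\<lambda>i. ennreal (norm (u i x - f x))) \<longlonglongrightarrow> 0"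
        using tendsto_ennrealI by fastforce
    qed
    show "(\<integral>\<^sup>+x. ennreal (2 * B) \<partial>M) < \<infinity>" by (simp add: emeasure_eq_measure ennreal_mult_less_top)
    show "(\<lambda>x. ennreal (norm (u i x - f x))) \<in> borel_measurable M" for i
      using borel_measurable_norm_strongly_measurable[OF strongly_measurable_diff[OF u[of i] f]]
      by measurable
  qed auto
  then have lim0: "(\<lambda>i. \<integral>\<^sup>+x. ennreal (norm (u i x - f x)) \<partial>M) \<longlonglongrightarrow> 0" by simp
  have "(\<lambda>i. ennreal (norm (vec_integral M (u i) - vec_integral M f))) \<longlonglongrightarrow> 0"
  proof (rule tendsto_sandwich[OF always_eventually always_eventually tendsto_const lim0])
    have "ennreal (norm (vec_integral M (u i) - vec_integral M f))
         \<le> (\<integral>\<^sup>+x. ennreal (norm (u i x - f x)) \<partial>M)" for i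
      using norm_vec_integral_le[of "\<lambda>x. u i x - f x"]
        vec_integrable_add[OF ui vec_integrable_bounded_linear[OF fi bounded_linear_minus[OF bounded_linear_ident]]]
      by (simp add: vec_integral_diff[OF ui fi])
    then show "\<forall>i. ennreal (norm (vec_integral M (u i) - vec_integral M f))
         \<le> (\<integral>\<^sup>+x. ennreal (norm (u i x - f x)) \<partial>M)" by blast
  qed auto
  then have "(\<lambda>i. ennreal (norm (vec_integral M (u i) - vec_integral M f))) \<longlonglongrightarrow> ennreal 0"
    by simp
  then have "(\<lambda>i. norm (vec_integral M (u i) - vec_integral M f)) \<longlonglongrightarrow> 0"
    by (subst (asm) tendsto_ennreal_iff) auto
  then have "(\<lambda>i. vec_integral M (u i) - vec_integral M f) \<longlonglongrightarrow> 0"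
    by (rule tendsto_norm_zero_cancel)
  then show ?thesis by (rule LIM_zero_cancel)
qed

end

lemma vec_integral_cong:
  assumes "\<And>x. x \<in> space M \<Longrightarrow> f x = g x"
  shows "vec_integral M f = vec_integral M g"
proof -
  have "f \<in> borel_measurable M \<longleftrightarrow> g \<in> borel_measurable M"
    using assms by (rule measurable_cong)
  moreover have "(\<integral>\<^sup>+x. ennreal (norm (f x - s x)) \<partial>M) = (\<integral>\<^sup>+x. ennreal (norm (g x - s x)) \<partial>M)" for s
    using assms by (intro nn_integral_cong) simp
  ultimately show ?thesis unfolding vec_integral_def has_vec_integral_def by simp
qed

lemma vec_integral_cong_AE:
  assumes "strongly_measurable M f" "strongly_measurable M g" "AE x in M. f x = g x"
  shows "vec_integral M f = vec_integral M g"
proof -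
  have "(\<integral>\<^sup>+x. ennreal (norm (f x - s x)) \<partial>M) = (\<integral>\<^sup>+x. ennreal (norm (g x - s x)) \<partial>M)" for s
    using assms(3) by (intro nn_integral_cong_AE) auto
  with assms(1,2)[THEN borel_measurable_strongly_measurable] show ?thesis
    unfolding vec_integral_def has_vec_integral_def by simp
qed

section \<open>Integrals over the half-line and uniqueness of Laplace transforms\<close>

lemma halflineD:
  assumes "finite_measure_halfline \<mu>"
  shows "finite_measure \<mu>" "space \<mu> = {0..}" "sets \<mu> = sets (restrict_space borel {0..})"
  using assms by (auto simp: finite_measure_halfline_def)

lemma halfline_sets: "finite_measure_halfline \<mu> \<Longrightarrow> B \<in> sets borel \<Longrightarrow> B \<subseteq> {0..} \<Longrightarrow> B \<in> sets \<mu>"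
  by (simp add: halflineD(3) sets_restrict_space_iff)

lemma halfline_measurable:
  assumes "finite_measure_halfline \<mu>" "f \<in> measurable borel N"
  shows "f \<in> measurable \<mu> N"
  using measurable_restrict_space1[OF assms(2), of "{0..}"]
  by (simp add: measurable_cong_sets[OF halflineD(3)[OF assms(1)] refl])

text \<open>
  The cells \<open>{0}\<close> and \<open>((k-1)/N, k/N]\<close> with \<open>N = Suc n\<close> carry the sample points \<open>k/N\<close> at their right ends, so
  that no cell meeting \<open>(0,\<infinity>)\<close> is sampled at 0, where integrands may jump.
\<close>

definition grid_cell :: "nat \<Rightarrow> nat \<Rightarrow> real set" where
  "grid_cell n k = (if k = 0 then {0} else {(real k - 1) / real (Suc n) <.. real k / real (Suc n)})"

lemma grid_cell_iff:
  assumes "0 \<le> s" shows "s \<in> grid_cell n k \<longleftrightarrow> k = nat \<lceil>s * real (Suc n)\<rceil>"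
proof (cases "k = 0")
  case True
  have "\<lceil>s * real (Suc n)\<rceil> \<le> 0 \<longleftrightarrow> s * real (Suc n) \<le> 0" by (simp add: ceiling_le_iff)
  also have "\<dots> \<longleftrightarrow> s = 0" using assms by (simp add: mult_le_0_iff)
  finally show ?thesis using True assms by (auto simp: grid_cell_def)
next
  case False
  have "s \<in> grid_cell n k \<longleftrightarrow> real k - 1 < s * real (Suc n) \<and> s * real (Suc n) \<le> real k"
    using False by (simp add: grid_cell_def field_simps)
  also have "\<dots> \<longleftrightarrow> \<lceil>s * real (Suc n)\<rceil> = int k"
    by (simp add: ceiling_eq_iff)
  also have "\<dots> \<longleftrightarrow> k = nat \<lceil>s * real (Suc n)\<rceil>" using False by auto
  finally show ?thesis .
qed

lemma grid_cell_borel [measurable]: "grid_cell n k \<in> sets borel"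
  by (simp add: grid_cell_def)

lemma grid_cell_nonneg: "grid_cell n k \<subseteq> {0..}"
proof (cases k)
  case (Suc m)
  have "0 \<le> x" if "real m / real (Suc n) < x" for x
    using that by (rule order_trans[OF _ less_imp_le, rotated]) simp
  then show ?thesis using Suc by (auto simp: grid_cell_def)
qed (simp add: grid_cell_def)

definition grid_step :: "nat \<Rightarrow> (real \<Rightarrow> 'a::real_vector) \<Rightarrow> real \<Rightarrow> 'a" where
  "grid_step n f s = (\<Sum>k\<le>(Suc n)\<^sup>2. indicator (grid_cell n k) s *\<^sub>R f (real k / real (Suc n)))"

text \<open>
  The Riemann sum of mesh \<open>1/(n+1)\<close>, truncated at \<open>n+1\<close>. It depends on the measure only through the masses of
  half-open intervals, which is what makes uniqueness and mixture arguments elementary.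
\<close>

abbreviation grid_sum :: "real measure \<Rightarrow> nat \<Rightarrow> (real \<Rightarrow> 'a::real_vector) \<Rightarrow> 'a" where
  "grid_sum \<mu> n f \<equiv> (\<Sum>k\<le>(Suc n)\<^sup>2. measure \<mu> (grid_cell n k) *\<^sub>R f (real k / real (Suc n)))"

lemma grid_step_eq:
  assumes s: "0 \<le> s"
  shows "grid_step n f s =
    (if nat \<lceil>s * real (Suc n)\<rceil> \<le> (Suc n)\<^sup>2 then f (real (nat \<lceil>s * real (Suc n)\<rceil>) / real (Suc n)) else 0)"
proof -
  have "grid_step n f s =
     (\<Sum>k\<le>(Suc n)\<^sup>2. if k = nat \<lceil>s * real (Suc n)\<rceil> then f (real k / real (Suc n)) else 0)"
    unfolding grid_step_def by (intro sum.cong refl) (simp add: indicator_def grid_cell_iff[OF s])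
  then show ?thesis by (simp add: sum.delta')
qed

lemma grid_step_tendsto:
  fixes f :: "real \<Rightarrow> 'a::real_normed_vector"
  assumes f: "continuous_on {0<..} f" and s: "0 \<le> s"
  shows "(\<lambda>n. grid_step n f s) \<longlonglongrightarrow> f s"
proof (cases "s = 0")
  case True
  then show ?thesis by (simp add: grid_step_eq)
next
  case False
  then have spos: "0 < s" using s by simp
  let ?q = "\<lambda>n. real (nat \<lceil>s * real (Suc n)\<rceil>) / real (Suc n)"
  have q: "real (nat \<lceil>s * real (Suc n)\<rceil>) = of_int \<lceil>s * real (Suc n)\<rceil>" for n
    using s by simp
  have lb: "s \<le> ?q n" for n
    unfolding q by (simp add: field_simps del: of_nat_Suc)
  have ub: "?q n \<le> s + 1 / real (Suc n)" for n
  proof -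
    have "of_int \<lceil>s * real (Suc n)\<rceil> \<le> s * real (Suc n) + 1" by linarith
    then show ?thesis unfolding q by (simp add: field_simps del: of_nat_Suc)
  qed
  have "?q \<longlonglongrightarrow> s"
  proof (rule tendsto_sandwich[OF always_eventually always_eventually tendsto_const])
    show "(\<lambda>n. s + 1 / real (Suc n)) \<longlonglongrightarrow> s"
      using tendsto_add[OF tendsto_const[of s] LIMSEQ_inverse_real_of_nat] by (simp add: inverse_eq_divide)
  qed (use lb ub in blast)+
  moreover have "isCont f s"
    using f spos by (simp add: continuous_on_eq_continuous_at)
  ultimately have "(\<lambda>n. f (?q n)) \<longlonglongrightarrow> f s" by (rule isCont_tendsto_compose[rotated])
  moreover have "eventually (\<lambda>n. f (?q n) = grid_step n f s) sequentially"
  proof -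
    obtain N where N: "s \<le> real N" using real_arch_simple by blast
    have "f (?q n) = grid_step n f s" if "n \<ge> N" for n
    proof -
      have "s \<le> real (Suc n)" using N that by simp
      then have "s * real (Suc n) \<le> real (Suc n) * real (Suc n)" by (rule mult_right_mono) simp
      also have "\<dots> = of_int (int ((Suc n)\<^sup>2))" by (simp add: power2_eq_square algebra_simps)
      finally have "\<lceil>s * real (Suc n)\<rceil> \<le> int ((Suc n)\<^sup>2)" unfolding ceiling_le_iff .
      then have "nat \<lceil>s * real (Suc n)\<rceil> \<le> (Suc n)\<^sup>2" by (simp only: nat_le_iff)
      then show ?thesis by (simp only: grid_step_eq[OF s] if_True)
    qed
    then show ?thesis unfolding eventually_sequentially by blast
  qed
  ultimately show ?thesis by (rule Lim_transform_eventually)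
qed

context
  fixes \<mu> :: "real measure"
  assumes hl: "finite_measure_halfline \<mu>"
begin

lemma grid_cell_sets: "grid_cell n k \<in> sets \<mu>"
  by (rule halfline_sets[OF hl grid_cell_borel grid_cell_nonneg])

lemma grid_cell_integrable: "integrable \<mu> (indicator (grid_cell n k) :: real \<Rightarrow> real)"
proof -
  interpret finite_measure \<mu> by (rule halflineD(1)[OF hl])
  show ?thesis by (simp add: grid_cell_sets emeasure_eq_measure)
qed

lemma strongly_measurable_grid_step:
  "strongly_measurable \<mu> (grid_step n (f :: real \<Rightarrow> 'a::real_normed_vector))"
  unfolding grid_step_def
proof (rule strongly_measurable_sum)
  fix k
  have m: "(indicator (grid_cell n k) :: real \<Rightarrow> real) \<in> borel_measurable \<mu>"
    using grid_cell_sets by simp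
  show "strongly_measurable \<mu> (\<lambda>x. indicator (grid_cell n k) x *\<^sub>R f (real k / real (Suc n)))"
    by (rule strongly_measurable_scaleR[OF strongly_measurable_real[OF m] strongly_measurable_const])
qed

lemma vec_integral_grid_step:
  "vec_integral \<mu> (grid_step n (f :: real \<Rightarrow> 'a::banach)) =
     grid_sum \<mu> n f"
proof -
  have fin: "finite_measure \<mu>" by (rule halflineD(1)[OF hl])
  have "vec_integral \<mu> (grid_step n f) = (\<Sum>k\<le>(Suc n)\<^sup>2. vec_integral \<mu>
          (\<lambda>s. indicator (grid_cell n k) s *\<^sub>R f (real k / real (Suc n))))"
    unfolding grid_step_def
    by (rule vec_integral_sum[OF fin])
       (simp_all only: finite_atMost vec_integral_scaleR_const(1)[OF fin grid_cell_integrable])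
  also have "\<dots> = grid_sum \<mu> n f"
    using grid_cell_sets[THEN sets.sets_into_space]
    by (intro sum.cong refl) (simp add: vec_integral_scaleR_const(2)[OF fin grid_cell_integrable] Int_absorb2)
  finally show ?thesis .
qed

lemma strongly_measurable_continuous:
  fixes f :: "real \<Rightarrow> 'a::real_normed_vector"
  assumes f: "continuous_on {0<..} f" shows "strongly_measurable \<mu> f"
proof -
  have "simple_function \<mu> (grid_step n f)" for n
  proof -
    have "simple_function \<mu> (\<lambda>s. indicator (grid_cell n k) s *\<^sub>R f (real k / real (Suc n)))" for k
      by (rule simple_function_compose1[where g = "\<lambda>r::real. r *\<^sub>R f (real k / real (Suc n))"])
         (rule simple_function_indicator[OF grid_cell_sets])
    then show ?thesis unfolding grid_step_def[abs_def] by (intro simple_function_sum)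
  qed
  then show ?thesis unfolding strongly_measurable_def
    using grid_step_tendsto[OF f] by (intro exI[of _ "\<lambda>n. grid_step n f"]) (auto simp: halflineD(2)[OF hl])
qed

lemma norm_grid_step_le:
  fixes f :: "real \<Rightarrow> 'a::real_normed_vector"
  assumes "\<And>s. 0 \<le> s \<Longrightarrow> norm (f s) \<le> B" "0 \<le> s"
  shows "norm (grid_step n f s) \<le> B"
  unfolding grid_step_eq[OF assms(2)]
  using order_trans[OF norm_ge_zero assms(1)[OF assms(2)]] by (auto intro: assms(1) simp del: of_nat_nat)

text \<open>
  The step functions converge pointwise and inherit the bound of the integrand.
\<close>

lemma vec_integral_continuous_limit:
  fixes f :: "real \<Rightarrow> 'a::banach"
  assumes f: "continuous_on {0<..} f" and B: "\<And>s. 0 \<le> s \<Longrightarrow> norm (f s) \<le> B"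
  shows "(\<lambda>n. grid_sum \<mu> n f)
     \<longlonglongrightarrow> vec_integral \<mu> f"
  unfolding vec_integral_grid_step[symmetric]
  by (rule vec_integral_dominated_convergence[OF halflineD(1)[OF hl] strongly_measurable_grid_step
        strongly_measurable_continuous[OF f], where B = B])
     (auto simp: halflineD(2)[OF hl] intro: grid_step_tendsto[OF f] norm_grid_step_le B)

lemma halfline_integrable_bounded:
  fixes f :: "real \<Rightarrow> real"
  assumes "f \<in> borel_measurable borel" "\<And>s. 0 \<le> s \<Longrightarrow> \<bar>f s\<bar> \<le> B"
  shows "integrable \<mu> f"
proof -
  interpret finite_measure \<mu> by (rule halflineD(1)[OF hl])
  show ?thesis
    by (rule integrable_const_bound[of _ B])
       (use assms halfline_measurable[OF hl assms(1)] in \<open>auto simp: halflineD(2)[OF hl]\<close>)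
qed

lemma halfline_integral_limit:
  fixes f :: "real \<Rightarrow> real"
  assumes m: "\<And>n. u n \<in> borel_measurable borel" "f \<in> borel_measurable borel"
    and lim: "\<And>s. 0 \<le> s \<Longrightarrow> (\<lambda>n. u n s) \<longlonglongrightarrow> f s"
    and B: "\<And>n s. 0 \<le> s \<Longrightarrow> \<bar>u n s\<bar> \<le> B"
  shows "(\<lambda>n. integral\<^sup>L \<mu> (u n)) \<longlonglongrightarrow> integral\<^sup>L \<mu> f"
proof -
  interpret finite_measure \<mu> by (rule halflineD(1)[OF hl])
  show ?thesis
    by (rule integral_dominated_convergence[where w = "\<lambda>_. B"])
       (use B lim halfline_measurable[OF hl m(1)] halfline_measurable[OF hl m(2)] in
         \<open>auto simp: halflineD(2)[OF hl]\<close>)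
qed

end

lemma exp_power: "exp (- s) ^ k = exp (- (real k * s))" for s :: real
  by (simp add: exp_of_nat_mult[symmetric])

text \<open>
  In the variable \<open>x = e\<^sup>-\<^sup>s\<close> the hypothesis says that all moments \<open>k \<ge> 1\<close> of the signed measure vanish, and
  letting \<open>t\<close> tend to 0 adds the moment \<open>k = 0\<close>. Bernstein polynomials are dense in the continuous functions.
\<close>

lemma laplace_unique_continuous:
  fixes c :: "'i \<Rightarrow> real" and \<mu> :: "'i \<Rightarrow> real measure"
  assumes I: "finite I" and hl: "\<And>i. i \<in> I \<Longrightarrow> finite_measure_halfline (\<mu> i)"
    and z: "\<And>t. t > 0 \<Longrightarrow> (\<Sum>i\<in>I. c i * (LINT s|\<mu> i. exp (- t * s))) = 0"
    and \<phi>: "continuous_on {0..1} \<phi>" and m: "\<phi> \<in> borel_measurable borel"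
  shows "(\<Sum>i\<in>I. c i * (LINT s|\<mu> i. \<phi> (exp (- s)))) = (0::real)"
proof -
  define L where "L f = (\<Sum>i\<in>I. c i * (LINT s|\<mu> i. f (exp (- s))))" for f :: "real \<Rightarrow> real"
  have int: "integrable (\<mu> i) (\<lambda>s. f (exp (- s)))"
    if "i \<in> I" "f \<in> borel_measurable borel" "\<And>x. 0 \<le> x \<Longrightarrow> x \<le> 1 \<Longrightarrow> \<bar>f x\<bar> \<le> B" for i f and B :: real
    by (rule halfline_integrable_bounded[OF hl[OF that(1)], of _ B]) (use that in auto)
  have Lk: "L (\<lambda>x. x ^ k) = 0" for k
  proof (cases "k = 0")
    case True
    have "(\<lambda>n. \<Sum>i\<in>I. c i * (LINT s|\<mu> i. exp (- (1 / real (Suc n)) * s)))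
       \<longlonglongrightarrow> (\<Sum>i\<in>I. c i * (LINT s|\<mu> i. 1))"
    proof (intro tendsto_intros halfline_integral_limit[OF hl, where B = 1])
      fix s :: real
      have "(\<lambda>n. exp (- (1 / real (Suc n)) * s)) \<longlonglongrightarrow> exp (- 0 * s)"
        by (intro tendsto_intros LIMSEQ_Suc[OF lim_1_over_n])
      then show "(\<lambda>n. exp (- (1 / real (Suc n)) * s)) \<longlonglongrightarrow> 1" by simp
    qed auto
    moreover have "(\<Sum>i\<in>I. c i * (LINT s|\<mu> i. exp (- (1 / real (Suc n)) * s))) = 0" for n
      by (rule z) simp
    ultimately have "(\<Sum>i\<in>I. c i * (LINT s|\<mu> i. 1)) = 0"
      by (simp only: LIMSEQ_const_iff)
    then show ?thesis using True by (simp add: L_def)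
  next
    case False
    then show ?thesis using z[of "real k"] by (simp add: L_def exp_power)
  qed
  have Lb: "L (\<lambda>x. x ^ k * (1 - x) ^ j) = 0" for k j
  proof (induction j arbitrary: k)
    case 0
    then show ?case by (simp add: Lk)
  next
    case (Suc j)
    have "L (\<lambda>x. x ^ k * (1 - x) ^ Suc j) = L (\<lambda>x. x ^ k * (1 - x) ^ j) - L (\<lambda>x. x ^ Suc k * (1 - x) ^ j)"
      unfolding L_def sum_subtractf[symmetric] right_diff_distrib[symmetric]
    proof (intro sum.cong refl arg_cong2[where f = "(*)"])
      fix i assume i: "i \<in> I"
      have b: "\<bar>x ^ k * (1 - x) ^ j\<bar> \<le> 1" if "0 \<le> x" "x \<le> 1" for x :: real and k j
        using that by (auto simp: abs_mult power_abs intro!: mult_le_one power_le_one)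
      have "(LINT s|\<mu> i. exp (- s) ^ k * (1 - exp (- s)) ^ Suc j) =
         (LINT s|\<mu> i. exp (- s) ^ k * (1 - exp (- s)) ^ j - exp (- s) ^ Suc k * (1 - exp (- s)) ^ j)"
        by (simp add: algebra_simps)
      also have "\<dots> = (LINT s|\<mu> i. exp (- s) ^ k * (1 - exp (- s)) ^ j)
          - (LINT s|\<mu> i. exp (- s) ^ Suc k * (1 - exp (- s)) ^ j)"
        using int[OF i, of "\<lambda>x. x ^ k * (1 - x) ^ j", OF _ b] int[OF i, of "\<lambda>x. x ^ Suc k * (1 - x) ^ j", OF _ b]
        by (intro Bochner_Integration.integral_diff) auto
      finally show "(LINT s|\<mu> i. exp (- s) ^ k * (1 - exp (- s)) ^ Suc j) =
         (LINT s|\<mu> i. exp (- s) ^ k * (1 - exp (- s)) ^ j)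
          - (LINT s|\<mu> i. exp (- s) ^ Suc k * (1 - exp (- s)) ^ j)" .
    qed
    also have "\<dots> = 0" unfolding Suc.IH by simp
    finally show ?case .
  qed
  have bern_m: "Bernstein n k \<in> borel_measurable borel" for n k
    unfolding Bernstein_def by measurable
  have bern_b: "\<bar>Bernstein n k x\<bar> \<le> 1" if "0 \<le> x" "x \<le> 1" "k \<le> n" for n k x
  proof -
    have "Bernstein n k x \<le> (\<Sum>k\<le>n. Bernstein n k x)"
      using that by (intro member_le_sum) (auto intro: Bernstein_nonneg)
    then show ?thesis using that by (simp add: Bernstein_nonneg)
  qed
  have LB: "L (\<lambda>x. \<Sum>k\<le>n. \<phi> (real k / real n) * Bernstein n k x) = 0" for n
  proof -
    have "L (\<lambda>x. \<Sum>k\<le>n. \<phi> (real k / real n) * Bernstein n k x)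
       = (\<Sum>i\<in>I. c i * (\<Sum>k\<le>n. \<phi> (real k / real n) * (LINT s|\<mu> i. Bernstein n k (exp (- s)))))"
      unfolding L_def
    proof (intro sum.cong refl arg_cong2[where f = "(*)"])
      fix i assume i: "i \<in> I"
      have "integrable (\<mu> i) (\<lambda>s. Bernstein n k (exp (- s)))" if "k \<le> n" for k
        by (rule int[OF i bern_m bern_b]) (use that in auto)
      then show "(LINT s|\<mu> i. (\<Sum>k\<le>n. \<phi> (real k / real n) * Bernstein n k (exp (- s))))
        = (\<Sum>k\<le>n. \<phi> (real k / real n) * (LINT s|\<mu> i. Bernstein n k (exp (- s))))"
        by (subst Bochner_Integration.integral_sum) auto
    qed
    also have "\<dots> = (\<Sum>k\<le>n. \<phi> (real k / real n) * (\<Sum>i\<in>I. c i * (LINT s|\<mu> i. Bernstein n k (exp (- s)))))"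
      by (simp add: sum_distrib_left mult_ac) (rule sum.swap)
    also have "\<dots> = 0"
    proof (intro sum.neutral ballI)
      fix k
      have "(\<Sum>i\<in>I. c i * (LINT s|\<mu> i. Bernstein n k (exp (- s))))
          = real (n choose k) * L (\<lambda>x. x ^ k * (1 - x) ^ (n - k))"
        unfolding L_def Bernstein_def by (simp add: sum_distrib_left mult_ac)
      then show "\<phi> (real k / real n) * (\<Sum>i\<in>I. c i * (LINT s|\<mu> i. Bernstein n k (exp (- s)))) = 0"
        by (simp add: Lb)
    qed
    finally show ?thesis .
  qed
  obtain C where C: "\<And>x. 0 \<le> x \<Longrightarrow> x \<le> 1 \<Longrightarrow> \<bar>\<phi> x\<bar> \<le> C"
    using compact_imp_bounded[OF compact_continuous_image[OF \<phi> compact_Icc]]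
    unfolding bounded_iff by force
  define K where "K = (\<Sum>i\<in>I. \<bar>c i\<bar> * measure (\<mu> i) {0..})"
  have "\<bar>L \<phi>\<bar> \<le> e * K" if e: "0 < e" for e
  proof -
    obtain n where n: "\<And>x. x \<in> {0..1} \<Longrightarrow> \<bar>\<phi> x - (\<Sum>k\<le>n. \<phi> (real k / real n) * Bernstein n k x)\<bar> < e"
      using Bernstein_Weierstrass[OF \<phi> e] by blast
    let ?p = "\<lambda>x. \<Sum>k\<le>n. \<phi> (real k / real n) * Bernstein n k x"
    have pm: "?p \<in> borel_measurable borel" using bern_m by measurable
    have pb: "\<bar>?p x\<bar> \<le> C + e" if "0 \<le> x" "x \<le> 1" for x
      using n[of x] C[of x] that by force
    have "\<bar>L \<phi>\<bar> = \<bar>L \<phi> - L ?p\<bar>" using LB by simp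
    also have "L \<phi> - L ?p = (\<Sum>i\<in>I. c i * (LINT s|\<mu> i. \<phi> (exp (- s)) - ?p (exp (- s))))"
      unfolding L_def sum_subtractf[symmetric] right_diff_distrib[symmetric]
      by (intro sum.cong refl arg_cong2[where f = "(*)"] Bochner_Integration.integral_diff[symmetric]
            int[OF _ m C] int[OF _ pm pb]) auto
    also have "\<bar>\<dots>\<bar> \<le> (\<Sum>i\<in>I. \<bar>c i\<bar> * (e * measure (\<mu> i) {0..}))"
    proof (rule order_trans[OF sum_abs], rule sum_mono)
      fix i assume i: "i \<in> I"
      interpret finite_measure "\<mu> i" by (rule halflineD(1)[OF hl[OF i]])
      have "\<bar>LINT s|\<mu> i. \<phi> (exp (- s)) - ?p (exp (- s))\<bar> \<le> (LINT s|\<mu> i. \<bar>\<phi> (exp (- s)) - ?p (exp (- s))\<bar>)"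
        by (rule integral_abs_bound)
      also have "\<dots> \<le> (LINT s|\<mu> i. e)"
      proof (rule integral_mono)
        show "integrable (\<mu> i) (\<lambda>s. \<bar>\<phi> (exp (- s)) - ?p (exp (- s))\<bar>)"
          by (intro integrable_abs Bochner_Integration.integrable_diff int[OF i m C] int[OF i pm pb]) auto
        show "\<bar>\<phi> (exp (- s)) - ?p (exp (- s))\<bar> \<le> e" if "s \<in> space (\<mu> i)" for s
          using n[of "exp (- s)"] that by (auto simp: halflineD(2)[OF hl[OF i]])
      qed simp
      also have "\<dots> = e * measure (\<mu> i) {0..}" by (simp add: halflineD(2)[OF hl[OF i]])
      finally show "\<bar>c i * (LINT s|\<mu> i. \<phi> (exp (- s)) - ?p (exp (- s)))\<bar> \<le> \<bar>c i\<bar> * (e * measure (\<mu> i) {0..})"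
        by (simp add: abs_mult mult_left_mono)
    qed
    also have "\<dots> = e * K" by (simp add: K_def sum_distrib_left mult_ac)
    finally show ?thesis .
  qed
  then have 1: "\<bar>L \<phi>\<bar> \<le> inverse (real (Suc n)) * K" for n by simp
  have "(\<lambda>n. inverse (real (Suc n)) * K) \<longlonglongrightarrow> 0 * K"
    by (intro tendsto_intros LIMSEQ_inverse_real_of_nat)
  then have "\<bar>L \<phi>\<bar> \<le> 0 * K" by (rule LIMSEQ_le_const) (use 1 in blast)
  then show ?thesis by (simp add: L_def)
qed

text \<open>
  Indicators of \<open>[0,b]\<close> are pointwise limits of continuous functions of \<open>e\<^sup>-\<^sup>s\<close>.
\<close>

lemma laplace_unique_interval:
  fixes c :: "'i \<Rightarrow> real" and \<mu> :: "'i \<Rightarrow> real measure"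
  assumes I: "finite I" and hl: "\<And>i. i \<in> I \<Longrightarrow> finite_measure_halfline (\<mu> i)"
    and z: "\<And>t. t > 0 \<Longrightarrow> (\<Sum>i\<in>I. c i * (LINT s|\<mu> i. exp (- t * s))) = 0"
  shows "(\<Sum>i\<in>I. c i * measure (\<mu> i) {0..b}) = 0"
proof -
  \<comment> \<open>a ramp of width \<open>1/n\<close> just below \<open>e\<^sup>-\<^sup>b\<close>, constant 1 to its right\<close>
  define \<phi> where "\<phi> n x = max 0 (min 1 (real n * (x - exp (- b)) + 1))" for n :: nat and x :: real
  have \<phi>c: "continuous_on UNIV (\<phi> n)" for n unfolding \<phi>_def by (intro continuous_intros)
  have \<phi>m: "\<phi> n \<in> borel_measurable borel" for n
    by (rule borel_measurable_continuous_onI[OF \<phi>c])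
  have lim: "(\<lambda>n. \<phi> n (exp (- s))) \<longlonglongrightarrow> indicator {0..b} s" if s: "0 \<le> s" for s
  proof (cases "s \<le> b")
    case True
    then have "\<phi> n (exp (- s)) = indicator {0..b} s" for n
      using s by (simp add: \<phi>_def indicator_def)
    then show ?thesis by simp
  next
    case False
    then have d: "0 < exp (- b) - exp (- s)" by simp
    obtain N where N: "1 < real N * (exp (- b) - exp (- s))"
      using reals_Archimedean3[OF d] by blast
    have "\<phi> n (exp (- s)) = indicator {0..b} s" if "n \<ge> N" for n
    proof -
      have "real N * (exp (- b) - exp (- s)) \<le> real n * (exp (- b) - exp (- s))"
        using that d by (intro mult_right_mono) auto
      then have "real n * (exp (- s) - exp (- b)) + 1 \<le> 0" using N by (simp add: algebra_simps)
      then show ?thesis using False by (simp add: \<phi>_def indicator_def)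
    qed
    then show ?thesis by (intro tendsto_eventually) (auto simp: eventually_sequentially)
  qed
  have "(\<lambda>n. \<Sum>i\<in>I. c i * (LINT s|\<mu> i. \<phi> n (exp (- s)))) \<longlonglongrightarrow> (\<Sum>i\<in>I. c i * (LINT s|\<mu> i. indicator {0..b} s))"
  proof (intro tendsto_intros halfline_integral_limit[OF hl, where B = 1] lim)
    show "(\<lambda>s. \<phi> n (exp (- s))) \<in> borel_measurable borel" for n using \<phi>m by measurable
    show "\<bar>\<phi> n (exp (- s))\<bar> \<le> 1" for n s by (auto simp: \<phi>_def)
  qed auto
  moreover have "(\<Sum>i\<in>I. c i * (LINT s|\<mu> i. \<phi> n (exp (- s)))) = 0" for n
    by (rule laplace_unique_continuous[OF I hl z]) (use \<phi>m continuous_on_subset[OF \<phi>c] in auto)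
  ultimately have "(\<Sum>i\<in>I. c i * (LINT s|\<mu> i. indicator {0..b} s)) = 0"
    by (simp only: LIMSEQ_const_iff)
  moreover have "(LINT s|\<mu> i. indicator {0..b} s) = measure (\<mu> i) {0..b}" if "i \<in> I" for i
  proof -
    have "{0..b} \<inter> space (\<mu> i) = {0..b}" by (auto simp: halflineD(2)[OF hl[OF that]])
    then show ?thesis by simp
  qed
  ultimately show ?thesis by simp
qed

lemma laplace_unique_grid:
  fixes c :: "'i \<Rightarrow> real" and \<mu> :: "'i \<Rightarrow> real measure"
  assumes I: "finite I" and hl: "\<And>i. i \<in> I \<Longrightarrow> finite_measure_halfline (\<mu> i)"
    and z: "\<And>t. t > 0 \<Longrightarrow> (\<Sum>i\<in>I. c i * (LINT s|\<mu> i. exp (- t * s))) = 0"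
  shows "(\<Sum>i\<in>I. c i * measure (\<mu> i) (grid_cell n k)) = 0"
proof (cases k)
  case 0
  then show ?thesis using laplace_unique_interval[OF assms, of 0] by (simp add: grid_cell_def)
next
  case (Suc m)
  let ?a = "real m / real (Suc n)" and ?b = "real k / real (Suc n)"
  have ab: "0 \<le> ?a" "?a \<le> ?b" using Suc by (auto intro: divide_right_mono)
  have "measure (\<mu> i) (grid_cell n k) = measure (\<mu> i) {0..?b} - measure (\<mu> i) {0..?a}" if "i \<in> I" for i
  proof -
    interpret finite_measure "\<mu> i" by (rule halflineD(1)[OF hl[OF that]])
    have "grid_cell n k = {?a<..?b}" using Suc by (simp add: grid_cell_def)
    also have "\<dots> = {0..?b} - {0..?a}"
    proof -
      have "{x<..y} = {0..y} - {0..x}" if "0 \<le> x" for x y :: real using that by auto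
      then show ?thesis using ab(1) .
    qed
    finally have "grid_cell n k = {0..?b} - {0..?a}" .
    moreover have "{0..?a} \<in> sets (\<mu> i)" "{0..?b} \<in> sets (\<mu> i)"
      by (rule halfline_sets[OF hl[OF that]]; auto)+
    ultimately show ?thesis using ab by (simp add: finite_measure_Diff)
  qed
  then have "(\<Sum>i\<in>I. c i * measure (\<mu> i) (grid_cell n k)) =
     (\<Sum>i\<in>I. c i * measure (\<mu> i) {0..?b}) - (\<Sum>i\<in>I. c i * measure (\<mu> i) {0..?a})"
    by (simp add: sum_subtractf right_diff_distrib)
  then show ?thesis using laplace_unique_interval[OF assms] by simp
qed

text \<open>
  Riemann sums see only the masses of intervals, so a linear relation between Laplace transforms passes to
  the integrals of every bounded continuous vector-valued function.
\<close>

lemma laplace_unique_vec_integral: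
  fixes c :: "'i \<Rightarrow> real" and \<mu> :: "'i \<Rightarrow> real measure" and f :: "real \<Rightarrow> 'a::banach"
  assumes I: "finite I" and hl: "\<And>i. i \<in> I \<Longrightarrow> finite_measure_halfline (\<mu> i)"
    and z: "\<And>t. t > 0 \<Longrightarrow> (\<Sum>i\<in>I. c i * (LINT s|\<mu> i. exp (- t * s))) = 0"
    and f: "continuous_on {0<..} f" and B: "\<And>s. 0 \<le> s \<Longrightarrow> norm (f s) \<le> B"
  shows "(\<Sum>i\<in>I. c i *\<^sub>R vec_integral (\<mu> i) f) = 0"
proof -
  have "(\<lambda>n. \<Sum>i\<in>I. c i *\<^sub>R grid_sum (\<mu> i) n f)
      \<longlonglongrightarrow> (\<Sum>i\<in>I. c i *\<^sub>R vec_integral (\<mu> i) f)"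
    by (intro tendsto_intros vec_integral_continuous_limit[OF hl f B])
  moreover have "(\<Sum>i\<in>I. c i *\<^sub>R grid_sum (\<mu> i) n f) = 0"
    for n
  proof -
    have "(\<Sum>i\<in>I. c i *\<^sub>R grid_sum (\<mu> i) n f)
      = (\<Sum>k\<le>(Suc n)\<^sup>2. (\<Sum>i\<in>I. c i * measure (\<mu> i) (grid_cell n k)) *\<^sub>R f (real k / real (Suc n)))"
      by (simp add: scaleR_sum_right scaleR_sum_left) (subst sum.swap, rule refl)
    then show ?thesis by (simp add: laplace_unique_grid[OF I hl z])
  qed
  ultimately show ?thesis by (simp add: LIMSEQ_const_iff)
qed

section \<open>Bernstein's theorem for bounded completely monotone functions\<close>

definition backward_diff :: "real \<Rightarrow> (real \<Rightarrow> real) \<Rightarrow> real \<Rightarrow> real" where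
  "backward_diff h f t = f t - f (t + h)"

lemma alternating_derivs_antimono:
  assumes der: "\<And>n t. t > 0 \<Longrightarrow> (G n has_real_derivative G (Suc n) t) (at t)"
    and sgn: "\<And>n t. t > 0 \<Longrightarrow> 0 \<le> (-1) ^ n * G n t"
    and "0 < s" "s \<le> t"
  shows "(-1) ^ n * G n t \<le> (-1) ^ n * G n s"
proof (rule DERIV_nonpos_imp_nonincreasing[OF assms(4), of "\<lambda>t. (-1) ^ n * G n t"])
  fix x assume "s \<le> x" "x \<le> t"
  then have x: "x > 0" using assms(3) by simp
  show "\<exists>y. ((\<lambda>t. (-1) ^ n * G n t) has_real_derivative y) (at x) \<and> y \<le> 0"
    using DERIV_cmult[OF der[OF x], of "(-1) ^ n" n] sgn[OF x, of "Suc n"] by (intro exI conjI) auto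
qed

text \<open>
  The family \<open>G n t - G n (t + h)\<close> again consists of successive derivatives with alternating signs, because each
  \<open>(-1)\<^sup>n G n\<close> is decreasing.
\<close>

lemma alternating_derivs_backward_diff:
  assumes h: "h > 0"
    and der: "\<And>n t. t > 0 \<Longrightarrow> (G n has_real_derivative G (Suc n) t) (at t)"
    and sgn: "\<And>n t. t > 0 \<Longrightarrow> 0 \<le> (-1) ^ n * G n t"
    and t: "t > 0"
  shows "0 \<le> (backward_diff h ^^ m) (G 0) t"
  using der sgn t
proof (induction m arbitrary: G t)
  case 0
  then show ?case using 0(2)[of t 0] by simp
next
  case (Suc m)
  have "0 \<le> (backward_diff h ^^ m) (backward_diff h (G 0)) t"
  proof (rule Suc.IH)
    fix n and s :: real assume s: "s > 0"
    have "((\<lambda>x. G n (x + h)) has_real_derivative G (Suc n) (s + h)) (at s)"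
      using Suc.prems(1)[of "s + h" n] s h by (simp add: DERIV_shift)
    then show "(backward_diff h (G n) has_real_derivative backward_diff h (G (Suc n)) s) (at s)"
      unfolding backward_diff_def using Suc.prems(1)[OF s] by (intro DERIV_diff)
    show "0 \<le> (-1) ^ n * backward_diff h (G n) s"
      using alternating_derivs_antimono[of G s "s + h" n] Suc.prems(1,2) s h
      by (simp add: backward_diff_def right_diff_distrib)
  qed (rule Suc.prems(3))
  then show ?case by (simp add: funpow_Suc_right del: funpow.simps)
qed

text \<open>
  This is \<open>(D + S)\<^sup>N = 1\<close> for the difference operator \<open>D\<close> and the shift \<open>S\<close>, which commute and add up to the identity.
\<close>

lemma binomial_telescope:
  fixes u :: "nat \<Rightarrow> nat \<Rightarrow> real"
  assumes u: "\<And>m i. u m i = u (Suc m) i + u m (Suc i)"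
  shows "(\<Sum>i\<le>N. real (N choose i) * u (N - i) i) = u 0 0"
proof (induction N)
  case 0
  show ?case by simp
next
  case (Suc N)
  have "(\<Sum>i\<le>Suc N. real (Suc N choose i) * u (Suc N - i) i)
      = u (Suc N) 0 + (\<Sum>i\<le>N. real (Suc N choose Suc i) * u (N - i) (Suc i))"
    by (subst sum.atMost_Suc_shift) simp
  also have "(\<Sum>i\<le>N. real (Suc N choose Suc i) * u (N - i) (Suc i))
      = (\<Sum>i\<le>N. real (N choose i) * u (N - i) (Suc i)) + (\<Sum>i\<le>N. real (N choose Suc i) * u (N - i) (Suc i))"
    by (simp add: algebra_simps sum.distrib)
  also have "u (Suc N) 0 + ((\<Sum>i\<le>N. real (N choose i) * u (N - i) (Suc i))
        + (\<Sum>i\<le>N. real (N choose Suc i) * u (N - i) (Suc i)))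
      = (\<Sum>i\<le>N. real (N choose i) * u (N - i) (Suc i)) + (\<Sum>i\<le>Suc N. real (N choose i) * u (Suc N - i) i)"
    by (subst sum.atMost_Suc_shift) simp
  also have "(\<Sum>i\<le>Suc N. real (N choose i) * u (Suc N - i) i) = (\<Sum>i\<le>N. real (N choose i) * u (Suc (N - i)) i)"
    by (simp add: Suc_diff_le)
  also have "(\<Sum>i\<le>N. real (N choose i) * u (N - i) (Suc i)) + \<dots> = (\<Sum>i\<le>N. real (N choose i) * u (N - i) i)"
    unfolding sum.distrib[symmetric] by (intro sum.cong refl) (subst (3) u, simp add: algebra_simps)
  also have "\<dots> = u 0 0" by (rule Suc.IH)
  finally show ?case .
qed

lemma binomial_falling:
  assumes "j \<le> m" "k \<le> m"
  shows "real (m choose k) * (\<Prod>i<j. real k - real i) =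
    (if j \<le> k then real ((m - j) choose (k - j)) else 0) * (\<Prod>i<j. real m - real i)"
  using assms
proof (induction j)
  case 0
  show ?case by simp
next
  case (Suc j)
  have IH: "real (m choose k) * (\<Prod>i<j. real k - real i) =
    (if j \<le> k then real ((m - j) choose (k - j)) else 0) * (\<Prod>i<j. real m - real i)"
    using Suc by simp
  show ?case
  proof (cases "Suc j \<le> k")
    case True
    then obtain a where a: "k = Suc j + a" by (metis le_Suc_ex)
    obtain b where b: "m = Suc j + b" using Suc.prems(1) by (metis le_Suc_ex)
    have "Suc a * (Suc b choose Suc a) = Suc b * (b choose a)" by (rule Suc_times_binomial)
    then have e: "real (Suc a) * real (Suc b choose Suc a) = real (Suc b) * real (b choose a)"
      by (metis of_nat_mult)
    have "real (m choose k) * (\<Prod>i<Suc j. real k - real i)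
       = (real (m choose k) * (\<Prod>i<j. real k - real i)) * (real k - real j)" by simp
    also have "\<dots> = (real (Suc b choose Suc a) * (\<Prod>i<j. real m - real i)) * real (Suc a)"
      unfolding IH using True by (simp add: a b)
    also have "\<dots> = (real (b choose a) * (\<Prod>i<j. real m - real i)) * real (Suc b)"
    proof -
      have "x * p * a' = y * p * b'" if "a' * x = b' * y" for x y a' b' p :: real
        using arg_cong[OF that, of "(*) p"] by (simp add: ac_simps)
      then show ?thesis using e .
    qed
    finally show ?thesis using True by (simp add: a b algebra_simps)
  next
    case False
    then have "k \<in> {..<Suc j}" by simp
    then have "(\<Prod>i<Suc j. real k - real i) = 0" by (intro prod_zero) auto
    then show ?thesis using False by simp
  qed
qed

text \<open>
  If \<open>c k = \<integral> x\<^sup>k d\<tau>\<close>, this is the integral of the Bernstein basis polynomial \<open>Bernstein m k\<close> against \<open>\<tau>\<close>.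
\<close>

definition hausdorff_weight :: "(nat \<Rightarrow> real) \<Rightarrow> nat \<Rightarrow> nat \<Rightarrow> real" where
  "hausdorff_weight c m k = real (m choose k) * ((\<lambda>c k. c k - c (Suc k)) ^^ (m - k)) c k"

text \<open>
  The expansion of \<open>x\<^sup>j\<close> in the Bernstein basis of degree \<open>m\<close> is exact, with a ratio of falling factorials as
  coefficient; that ratio is close to \<open>(k/m)\<^sup>j\<close>.
\<close>

lemma hausdorff_weight_moment:
  assumes "j \<le> m"
  shows "c j = (\<Sum>k\<le>m. hausdorff_weight c m k * (\<Prod>i<j. (real k - real i) / (real m - real i)))"
proof -
  let ?D = "\<lambda>(c :: nat \<Rightarrow> real) k. c k - c (Suc k)"
  let ?P = "\<Prod>i<j. real m - real i"
  have P0: "?P \<noteq> 0" using assms by simp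
  have "(\<Sum>k\<le>m. hausdorff_weight c m k * (\<Prod>i<j. (real k - real i) / (real m - real i)))
     = (\<Sum>k\<le>m. (if j \<le> k then real ((m - j) choose (k - j)) else 0) * (?D ^^ (m - k)) c k)"
  proof (intro sum.cong refl)
    fix k assume k: "k \<in> {..m}"
    have "hausdorff_weight c m k * (\<Prod>i<j. (real k - real i) / (real m - real i))
       = (real (m choose k) * (\<Prod>i<j. real k - real i)) * (?D ^^ (m - k)) c k / ?P"
      by (simp add: hausdorff_weight_def prod_dividef)
    also have "\<dots> = (if j \<le> k then real ((m - j) choose (k - j)) else 0) * (?D ^^ (m - k)) c k"
      using binomial_falling[OF assms, of k] k P0 by simp
    finally show "hausdorff_weight c m k * (\<Prod>i<j. (real k - real i) / (real m - real i))
       = (if j \<le> k then real ((m - j) choose (k - j)) else 0) * (?D ^^ (m - k)) c k" .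
  qed
  also have "\<dots> = (\<Sum>k\<in>{j..m}. real ((m - j) choose (k - j)) * (?D ^^ (m - k)) c k)"
    by (intro sum.mono_neutral_cong_right) auto
  also have "\<dots> = (\<Sum>i\<le>m - j. real ((m - j) choose i) * (?D ^^ (m - j - i)) c (j + i))"
    by (rule sum.reindex_bij_witness[of _ "\<lambda>i. j + i" "\<lambda>k. k - j"]) (use assms in auto)
  also have "\<dots> = (?D ^^ 0) c (j + 0)"
    by (rule binomial_telescope[of "\<lambda>m i. (?D ^^ m) c (j + i)"]) simp
  finally show ?thesis by simp
qed

lemma falling_ratio_close:
  assumes "2 * j \<le> m" "0 < m" "k \<le> m"
  shows "\<bar>(\<Prod>i<j. (real k - real i) / (real m - real i)) - (real k / real m) ^ j\<bar>
    \<le> (real j)\<^sup>2 / (real m - real j)"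
proof -
  have "\<bar>(\<Prod>i<j. (real k - real i) / (real m - real i)) - (\<Prod>i<j. real k / real m)\<bar>
    \<le> (\<Sum>i<j. \<bar>(real k - real i) / (real m - real i) - real k / real m\<bar>)"
    unfolding real_norm_def[symmetric]
  proof (rule norm_prod_diff)
    fix i assume "i \<in> {..<j}"
    then have i: "2 * real i \<le> real m" "real i < real m" using assms by auto
    have "\<bar>real k - real i\<bar> \<le> real m - real i" using i assms(3) by auto
    then show "norm ((real k - real i) / (real m - real i)) \<le> 1"
      using i by (simp add: abs_divide divide_le_eq_1)
    show "norm (real k / real m) \<le> 1" using assms by simp
  qed
  also have "\<dots> \<le> (\<Sum>i<j. real j / (real m - real j))"
  proof (rule sum_mono)
    fix i assume "i \<in> {..<j}"
    then have i: "real i < real j" "real j < real m" "real i < real m" using assms by auto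
    have "real k / real m - (real k - real i) / (real m - real i)
       = (real i / (real m - real i)) * ((real m - real k) / real m)"
      using i assms(2) by (simp add: field_simps)
    moreover have b: "0 \<le> (real m - real k) / real m" "(real m - real k) / real m \<le> 1"
      using assms by auto
    moreover have a: "0 \<le> real i / (real m - real i)" "real i / (real m - real i) \<le> real j / (real m - real j)"
      using i by (auto intro!: frac_le)
    ultimately have "0 \<le> real k / real m - (real k - real i) / (real m - real i)"
      "real k / real m - (real k - real i) / (real m - real i) \<le> real j / (real m - real j)"
      using mult_nonneg_nonneg[OF a(1) b(1)] order_trans[OF mult_left_le[OF b(2) a(1)] a(2)] by linarith+
    then show "\<bar>(real k - real i) / (real m - real i) - real k / real m\<bar> \<le> real j / (real m - real j)"
      by linarith
  qed
  also have "\<dots> = (real j)\<^sup>2 / (real m - real j)" by (simp add: power2_eq_square)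
  finally show ?thesis by simp
qed

lemma hausdorff_moment_approx:
  assumes pos: "\<And>m k. 0 \<le> ((\<lambda>c k. c k - c (Suc k)) ^^ m) c k"
    and "2 * j \<le> m" "0 < m"
  shows "\<bar>c j - (\<Sum>k\<le>m. hausdorff_weight c m k * (real k / real m) ^ j)\<bar>
    \<le> c 0 * ((real j)\<^sup>2 / (real m - real j))"
proof -
  have w: "0 \<le> hausdorff_weight c m k" for k by (simp add: hausdorff_weight_def pos)
  have "\<bar>c j - (\<Sum>k\<le>m. hausdorff_weight c m k * (real k / real m) ^ j)\<bar>
    = \<bar>\<Sum>k\<le>m. hausdorff_weight c m k *
        ((\<Prod>i<j. (real k - real i) / (real m - real i)) - (real k / real m) ^ j)\<bar>"
    using assms(2) by (subst hausdorff_weight_moment[of j m]) (auto simp: right_diff_distrib sum_subtractf)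
  also have "\<dots> \<le> (\<Sum>k\<le>m. hausdorff_weight c m k * ((real j)\<^sup>2 / (real m - real j)))"
    using falling_ratio_close[OF assms(2,3)] w
    by (intro order_trans[OF sum_abs] sum_mono) (simp add: abs_mult mult_left_mono del: times_divide_eq_right)
  also have "\<dots> = (\<Sum>k\<le>m. hausdorff_weight c m k) * ((real j)\<^sup>2 / (real m - real j))"
    by (simp only: sum_distrib_right)
  also have "(\<Sum>k\<le>m. hausdorff_weight c m k) = c 0"
    using hausdorff_weight_moment[of 0 m c] by simp
  finally show ?thesis .
qed

lemma backward_diff_funpow_sample:
  "((\<lambda>c k. c k - c (Suc k)) ^^ m) (\<lambda>k. f (real k * h)) k = (backward_diff h ^^ m) f (real k * h)"
  by (induction m arbitrary: k) (simp_all add: backward_diff_def algebra_simps)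

text \<open>
  Allows sampling at 0, where the value of the function is replaced by its right limit.
\<close>

lemma backward_diff_funpow_right_limit:
  assumes "\<And>s. t \<le> s \<Longrightarrow> (f \<longlongrightarrow> f s) (at_right s)" "h > 0"
  shows "((backward_diff h ^^ m) f \<longlongrightarrow> (backward_diff h ^^ m) f t) (at_right t)"
  using assms(1)
proof (induction m arbitrary: t)
  case 0
  then show ?case by simp
next
  case (Suc m)
  let ?g = "(backward_diff h ^^ m) f"
  have "(?g \<longlongrightarrow> ?g t) (at_right t)" "(?g \<longlongrightarrow> ?g (t + h)) (at_right (t + h))"
    using Suc.prems assms(2) by (auto intro!: Suc.IH)
  moreover have "filterlim (\<lambda>x. x + h) (at_right (t + h)) (at_right t)"
    unfolding filterlim_at
    by (auto intro!: tendsto_intros simp: eventually_at_right_field intro: exI[of _ "t + 1"])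
  ultimately have "((\<lambda>x. ?g x - ?g (x + h)) \<longlongrightarrow> ?g t - ?g (t + h)) (at_right t)"
    by (intro tendsto_diff) (auto intro: filterlim_compose)
  then show ?case by (simp add: backward_diff_def[abs_def])
qed

text \<open>
  Helly's theorem delivers a law on the whole line. Clamping to the unit interval turns the powers into bounded
  continuous test functions on the line.
\<close>

definition unit_clamp :: "real \<Rightarrow> real" where "unit_clamp x = max 0 (min 1 x)"

lemma unit_clamp_bounds: "0 \<le> unit_clamp x" "unit_clamp x \<le> 1"
  by (auto simp: unit_clamp_def)

lemma continuous_unit_clamp_powr:
  assumes "t > 0" shows "isCont (\<lambda>x. unit_clamp x powr t) x"
proof -
  have "isCont unit_clamp x" unfolding unit_clamp_def[abs_def] by (intro continuous_intros)
  then show ?thesis unfolding isCont_def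
    by (rule tendsto_powr'[OF _ tendsto_const]) (use assms unit_clamp_bounds in \<open>auto intro: always_eventually\<close>)
qed

lemma unit_clamp_powr_bounds: "0 \<le> unit_clamp x powr t" "0 \<le> t \<Longrightarrow> unit_clamp x powr t \<le> 1"
  by (auto simp: unit_clamp_bounds intro: powr_le1)

text \<open>
  On the grid of mesh \<open>1/N\<close> the samples of \<open>f\<close> satisfy the hypotheses of the Hausdorff moment problem. Placing the
  weights of order \<open>m = N\<^sup>3\<close> at the points \<open>(k/m)\<^sup>N\<close> gives a law whose \<open>t\<close>-th moments are close to \<open>f t / L\<close> for all \<open>t\<close>
  on the grid; the cube makes the error \<open>j\<^sup>2/(m-j)\<close> vanish as \<open>N\<close> grows, for fixed \<open>t = j/N\<close>.
\<close>

lemma completely_monotone_sample_moments: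
  fixes f :: "real \<Rightarrow> real"
  assumes diff: "\<And>h m t. h > 0 \<Longrightarrow> t > 0 \<Longrightarrow> 0 \<le> (backward_diff h ^^ m) f t"
    and cont: "continuous_on {0<..} f"
    and L: "(f \<longlongrightarrow> L) (at_right 0)" "L > 0" and N: "N \<ge> 1"
  obtains \<nu> where "real_distribution \<nu>" "measure \<nu> {-1<..1} = 1"
    "\<And>t j. t > 0 \<Longrightarrow> t * real N = real j \<Longrightarrow> 2 * j \<le> N ^ 3 \<Longrightarrow>
       \<bar>f t / L - (LINT x|\<nu>. unit_clamp x powr t)\<bar> \<le> (t * real N)\<^sup>2 / (real N ^ 3 - t * real N)"
proof -
  define h where "h = 1 / real N"
  have h: "h > 0" using N by (simp add: h_def)
  \<comment> \<open>the sample at 0 enters the moment problem with the limiting value\<close>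
  define F where "F t = (if t \<le> 0 then L else f t)" for t
  have F_lim: "(F \<longlongrightarrow> F s) (at_right s)" if "0 \<le> s" for s
  proof (cases "s = 0")
    case True
    have "\<forall>\<^sub>F x in at_right 0. f x = F x"
      unfolding eventually_at_right_field by (auto simp: F_def intro: exI[of _ 1])
    then show ?thesis using L(1) True by (auto simp: F_def intro: Lim_transform_eventually)
  next
    case False
    then have s: "s > 0" using that by simp
    have "(f \<longlongrightarrow> f s) (at_right s)"
      using cont s by (simp add: continuous_on_eq_continuous_at isCont_def filterlim_at_split)
    moreover have "\<forall>\<^sub>F x in at_right s. f x = F x"
      unfolding eventually_at_right_field using s by (auto simp: F_def intro!: exI[of _ "s + 1"])
    ultimately show ?thesis using s by (auto simp: F_def intro: Lim_transform_eventually)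
  qed
  have F_diff_pos: "0 \<le> (backward_diff h ^^ m) F t" if t: "t > 0" for m t
  proof -
    have "(backward_diff h ^^ m) F t = (backward_diff h ^^ m) f t"
      using t
    proof (induction m arbitrary: t)
      case (Suc m)
      then show ?case using h by (simp add: backward_diff_def)
    qed (simp add: F_def)
    then show ?thesis using diff[OF h t] by simp
  qed
  have F_diff: "0 \<le> (backward_diff h ^^ m) F t" if t: "t \<ge> 0" for m t
  proof (rule tendsto_lowerbound)
    show "((backward_diff h ^^ m) F \<longlongrightarrow> (backward_diff h ^^ m) F t) (at_right t)"
      by (rule backward_diff_funpow_right_limit[OF F_lim h]) (use t in auto)
    show "\<forall>\<^sub>F x in at_right t. 0 \<le> (backward_diff h ^^ m) F x"
      unfolding eventually_at_right_field using t by (auto intro!: exI[of _ "t + 1"] F_diff_pos)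
  qed simp
  define c where "c k = F (real k * h)" for k
  define m where "m = N ^ 3"
  have m: "m > 0" using N by (simp add: m_def)
  have c_pos: "0 \<le> ((\<lambda>c k. c k - c (Suc k)) ^^ i) c k" for i k
    unfolding c_def using F_diff h by (simp add: backward_diff_funpow_sample)
  have c0: "c 0 = L" by (simp add: c_def F_def)
  let ?w = "\<lambda>k. hausdorff_weight c m k / L"
  have w: "0 \<le> ?w k" for k using L c_pos by (simp add: hausdorff_weight_def)
  define P where "P = point_measure {..m} ?w"
  define \<nu> where "\<nu> = distr P borel (\<lambda>k. (real k / real m) ^ N)"
  have Pm: "g \<in> measurable P borel" for g :: "nat \<Rightarrow> real"
    by (simp add: P_def point_measure_def)
  have sum_w: "(\<Sum>k\<le>m. ?w k) = 1"
    using hausdorff_weight_moment[of 0 m c] L by (simp add: c0 sum_divide_distrib[symmetric])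
  have "emeasure P {..m} = (\<Sum>k\<le>m. ennreal (?w k))"
    unfolding P_def by (rule emeasure_point_measure_finite) auto
  also have "\<dots> = 1" using w sum_w by (simp add: sum_ennreal)
  finally have P1: "prob_space P" by (intro prob_spaceI) (simp add: P_def space_point_measure)
  then have nu: "real_distribution \<nu>"
    unfolding \<nu>_def real_distribution_def real_distribution_axioms_def
    by (auto intro: prob_space.prob_space_distr Pm)
  moreover have "measure \<nu> {-1<..1} = 1"
  proof -
    interpret P: prob_space P by (rule P1)
    have sub: "(real k / real m) ^ N \<in> {-1<..1}" if "k \<in> space P" for k
    proof -
      have "real k / real m \<le> 1" "0 \<le> real k / real m"
        using that m by (auto simp: P_def space_point_measure)
      then have "(real k / real m) ^ N \<le> 1" "0 \<le> (real k / real m) ^ N" by (auto intro: power_le_one)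
      then show ?thesis unfolding greaterThanAtMost_iff by linarith
    qed
    have "measure \<nu> {-1<..1} = measure P ((\<lambda>k. (real k / real m) ^ N) -` {-1<..1} \<inter> space P)"
      unfolding \<nu>_def by (rule measure_distr[OF Pm]) simp
    also have "(\<lambda>k. (real k / real m) ^ N) -` {-1<..1} \<inter> space P = space P" using sub by auto
    finally show ?thesis by (simp add: P.prob_space)
  qed
  moreover have "\<bar>f t / L - (LINT x|\<nu>. unit_clamp x powr t)\<bar> \<le> (t * real N)\<^sup>2 / (real N ^ 3 - t * real N)"
    if t: "t > 0" "t * real N = real j" "2 * j \<le> N ^ 3" for t j
  proof -
    have j: "j > 0" using t N by (metis mult_pos_pos of_nat_0_less_iff less_le_trans zero_less_one)
    have tj: "real j * h = t" using t(2) N by (simp add: h_def field_simps)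
    have meas: "(\<lambda>x. unit_clamp x powr t) \<in> borel_measurable borel"
      by (rule borel_measurable_continuous_onI) (simp add: continuous_at_imp_continuous_on continuous_unit_clamp_powr t)
    have "(LINT x|\<nu>. unit_clamp x powr t) = (LINT k|P. unit_clamp ((real k / real m) ^ N) powr t)"
      unfolding \<nu>_def by (rule integral_distr[OF Pm meas])
    also have "\<dots> = (\<Sum>k\<le>m. ?w k * unit_clamp ((real k / real m) ^ N) powr t)"
      unfolding P_def using w by (simp add: lebesgue_integral_point_measure_finite)
    also have "\<dots> = (\<Sum>k\<le>m. ?w k * (real k / real m) ^ j)"
    proof (intro sum.cong refl arg_cong2[where f = "(*)"])
      fix k assume "k \<in> {..m}"
      then have x: "0 \<le> real k / real m" "real k / real m \<le> 1" using m by auto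
      have "unit_clamp ((real k / real m) ^ N) = (real k / real m) ^ N"
        using x by (simp add: unit_clamp_def power_le_one)
      also have "((real k / real m) ^ N) powr t = (real k / real m) ^ j"
      proof (cases "real k / real m = 0")
        case True
        then show ?thesis unfolding True using j N t by (simp add: zero_power)
      next
        case False
        then have x0: "0 < real k / real m" using x by simp
        have "((real k / real m) ^ N) powr t = (real k / real m) powr (real N * t)"
          using x0 by (simp only: powr_realpow[symmetric] powr_powr)
        also have "\<dots> = (real k / real m) powr (real j)" using t(2) by (simp only: mult.commute)
        also have "\<dots> = (real k / real m) ^ j" using x0 by (rule powr_realpow)
        finally show ?thesis .
      qed
      finally show "unit_clamp ((real k / real m) ^ N) powr t = (real k / real m) ^ j" .
    qed
    also have "\<dots> = (\<Sum>k\<le>m. hausdorff_weight c m k * (real k / real m) ^ j) / L"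
      by (simp add: sum_divide_distrib)
    finally have I: "(LINT x|\<nu>. unit_clamp x powr t) =
        (\<Sum>k\<le>m. hausdorff_weight c m k * (real k / real m) ^ j) / L" .
    have cj: "c j = f t" using t by (simp add: c_def tj F_def)
    have "\<bar>f t / L - (LINT x|\<nu>. unit_clamp x powr t)\<bar>
       = \<bar>c j - (\<Sum>k\<le>m. hausdorff_weight c m k * (real k / real m) ^ j)\<bar> / L"
      unfolding I cj using L(2) by (simp add: diff_divide_distrib[symmetric])
    also have "\<dots> \<le> (c 0 * ((real j)\<^sup>2 / (real m - real j))) / L"
      using L(2) t(3) m by (intro divide_right_mono hausdorff_moment_approx[OF c_pos]) (auto simp: m_def)
    also have "\<dots> = (t * real N)\<^sup>2 / (real N ^ 3 - t * real N)"
      using L(2) by (simp add: c0 t(2) m_def)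
    finally show ?thesis .
  qed
  ultimately show ?thesis by (rule that)
qed

lemma one_over_Suc_tendsto: "(\<lambda>n. 1 / real (Suc n)) \<longlonglongrightarrow> 0"
  using LIMSEQ_inverse_real_of_nat by (simp add: inverse_eq_divide)

lemma rational_sequence_above:
  "\<exists>q. (\<forall>n. q n \<in> \<rat>) \<and> (\<forall>n. t < q n) \<and> (\<forall>n. q n < t + 1 / real (Suc n)) \<and> q \<longlonglongrightarrow> (t::real)"
proof -
  have "\<exists>q\<in>\<rat>. t < q \<and> q < t + 1 / real (Suc n)" for n
    using Rats_dense_in_real[of t "t + 1 / real (Suc n)"] by simp
  then obtain q where q: "\<And>n. q n \<in> \<rat>" "\<And>n. t < q n" "\<And>n. q n < t + 1 / real (Suc n)" by metis
  have "q \<longlonglongrightarrow> t"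
  proof (rule tendsto_sandwich[OF always_eventually always_eventually tendsto_const])
    show "(\<lambda>n. t + 1 / real (Suc n)) \<longlonglongrightarrow> t"
      using tendsto_add[OF tendsto_const[of t] one_over_Suc_tendsto] by simp
  qed (use q(2,3) less_imp_le in blast)+
  with q show ?thesis by blast
qed

lemma sample_error_tendsto:
  assumes "t > 0" shows "(\<lambda>n. (t * real (fact n))\<^sup>2 / (real (fact n) ^ 3 - t * real (fact n))) \<longlonglongrightarrow> 0"
proof -
  have "((\<lambda>x::real. (t * x)\<^sup>2 / (x ^ 3 - t * x)) \<longlongrightarrow> 0) at_top"
    using assms by real_asymp
  moreover have "filterlim (\<lambda>n. real (fact n)) at_top sequentially"
  proof (rule filterlim_at_top_mono[OF filterlim_real_sequentially always_eventually])
    show "\<forall>n. real n \<le> real (fact n)" using fact_ge_self by (metis of_nat_le_iff)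
  qed
  ultimately show ?thesis by (rule filterlim_compose)
qed

text \<open>
  Take \<open>N = n!\<close>, so that every positive rational is eventually a grid point, pass to a weak limit, and extend
  from rational to real exponents by continuity.
\<close>

lemma bernstein_on_unit_interval:
  fixes f :: "real \<Rightarrow> real"
  assumes diff: "\<And>h m t. h > 0 \<Longrightarrow> t > 0 \<Longrightarrow> 0 \<le> (backward_diff h ^^ m) f t"
    and cont: "continuous_on {0<..} f"
    and L: "(f \<longlongrightarrow> L) (at_right 0)" "L > 0"
  obtains M where "real_distribution M" "\<And>t. t > 0 \<Longrightarrow> (LINT x|M. unit_clamp x powr t) = f t / L"
proof -
  have "\<forall>N. \<exists>\<nu>. N \<ge> 1 \<longrightarrow> real_distribution \<nu> \<and> measure \<nu> {-1<..1} = 1 \<and> (\<forall>t j. t > 0 \<longrightarrow> t * real N = real j \<longrightarrow> 2 * j \<le> N ^ 3 \<longrightarrow>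
       \<bar>f t / L - (LINT x|\<nu>. unit_clamp x powr t)\<bar> \<le> (t * real N)\<^sup>2 / (real N ^ 3 - t * real N))"
  proof
    fix N
    show "\<exists>\<nu>. N \<ge> 1 \<longrightarrow> real_distribution \<nu> \<and> measure \<nu> {-1<..1} = 1 \<and> (\<forall>t j. t > 0 \<longrightarrow> t * real N = real j \<longrightarrow> 2 * j \<le> N ^ 3 \<longrightarrow>
       \<bar>f t / L - (LINT x|\<nu>. unit_clamp x powr t)\<bar> \<le> (t * real N)\<^sup>2 / (real N ^ 3 - t * real N))"
    proof (cases "N \<ge> 1")
      case True
      show ?thesis
        by (rule completely_monotone_sample_moments[OF diff cont L True]) blast+
    qed simp
  qed
  then obtain V where V: "\<And>N. N \<ge> 1 \<Longrightarrow> real_distribution (V N)" "\<And>N. N \<ge> 1 \<Longrightarrow> measure (V N) {-1<..1} = 1"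
    "\<And>N t j. N \<ge> 1 \<Longrightarrow> t > 0 \<Longrightarrow> t * real N = real j \<Longrightarrow> 2 * j \<le> N ^ 3 \<Longrightarrow>
       \<bar>f t / L - (LINT x|V N. unit_clamp x powr t)\<bar> \<le> (t * real N)\<^sup>2 / (real N ^ 3 - t * real N)"
    by metis
  define \<nu> where "\<nu> n = V (fact n)" for n
  have fact1: "(fact n :: nat) \<ge> 1" for n by (rule fact_ge_1)
  have nu: "real_distribution (\<nu> n)" for n unfolding \<nu>_def by (rule V(1)[OF fact1])
  have "tight \<nu>" unfolding tight_def
  proof (intro conjI allI impI)
    fix e :: real assume "e > 0"
    then show "\<exists>a b. a < b \<and> (\<forall>n. 1 - e < measure (\<nu> n) {a<..b})"
      using V(2)[OF fact1] by (intro exI[of _ "-1"] exI[of _ 1]) (simp add: \<nu>_def)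
  qed (rule nu)
  from tight_imp_convergent_subsubsequence[OF this, of id] obtain r M
    where r: "strict_mono r" and M: "real_distribution M" "weak_conv_m (\<nu> \<circ> r) M"
    by (auto simp: strict_mono_id comp_def)
  have lim: "(\<lambda>n. LINT x|\<nu> (r n). unit_clamp x powr t) \<longlonglongrightarrow> (LINT x|M. unit_clamp x powr t)" if "t > 0" for t
  proof -
    have "(\<lambda>n. integral\<^sup>L ((\<nu> \<circ> r) n) (\<lambda>x. unit_clamp x powr t)) \<longlonglongrightarrow> integral\<^sup>L M (\<lambda>x. unit_clamp x powr t)"
      by (rule weak_conv_imp_integral_bdd_continuous_conv[where B = 1, OF _ M continuous_unit_clamp_powr[OF that]])
         (use nu unit_clamp_powr_bounds that in \<open>auto simp: comp_def\<close>)
    then show ?thesis by simp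
  qed
  have rat: "(LINT x|M. unit_clamp x powr t) = f t / L" if t: "t > 0" "t \<in> \<rat>" for t
  proof -
    have "\<exists>p q :: nat. q > 0 \<and> t = real p / real q"
      using Rats_abs_nat_div_natE[OF t(2)] t(1) by (metis abs_of_pos gr0I)
    then obtain p q :: nat where pq: "q > 0" "t = real p / real q" by blast
    have err: "(\<lambda>n. (t * real (fact (r n)))\<^sup>2 / (real (fact (r n)) ^ 3 - t * real (fact (r n)))) \<longlonglongrightarrow> 0"
      using LIMSEQ_subseq_LIMSEQ[OF sample_error_tendsto[OF t(1)] r] by (simp add: comp_def)
    have ev: "eventually (\<lambda>n. n \<ge> max q (2 * p + 2)) sequentially" by (rule eventually_ge_at_top)
    have "(\<lambda>n. f t / L - (LINT x|\<nu> (r n). unit_clamp x powr t)) \<longlonglongrightarrow> 0"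
    proof (rule Lim_null_comparison[OF _ err])
      show "\<forall>\<^sub>F n in sequentially. norm (f t / L - (LINT x|\<nu> (r n). unit_clamp x powr t))
         \<le> (t * real (fact (r n)))\<^sup>2 / (real (fact (r n)) ^ 3 - t * real (fact (r n)))"
        using ev
      proof eventually_elim
        case (elim n)
        have rn: "r n \<ge> n" using r by (rule seq_suble)
        let ?N = "fact (r n) :: nat"
        have "q dvd ?N" using rn elim pq(1) by (intro dvd_fact) auto
        then obtain d where d: "?N = q * d" by (rule dvdE)
        have 1: "t * real ?N = real (p * d)" using pq d by simp
        have "2 * p \<le> ?N" using rn elim fact_ge_self[of "r n"] by linarith
        then have "2 * (p * d) \<le> ?N * d" by simp
        also have "\<dots> \<le> ?N * (q * d)" using pq(1) by simp
        also have "\<dots> = ?N ^ 2" by (simp only: d power2_eq_square)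
        also have "\<dots> \<le> ?N ^ 3" by (intro power_increasing) auto
        finally have 2: "2 * (p * d) \<le> ?N ^ 3" .
        show ?case unfolding \<nu>_def real_norm_def by (rule V(3)[OF fact1 t(1) 1 2])
      qed
    qed
    then have "(\<lambda>n. f t / L - (f t / L - (LINT x|\<nu> (r n). unit_clamp x powr t))) \<longlonglongrightarrow> f t / L - 0"
      by (intro tendsto_intros)
    then have "(\<lambda>n. LINT x|\<nu> (r n). unit_clamp x powr t) \<longlonglongrightarrow> f t / L" by simp
    with lim[OF t(1)] show ?thesis by (rule LIMSEQ_unique)
  qed
  have "(LINT x|M. unit_clamp x powr t) = f t / L" if t: "t > 0" for t
  proof -
    interpret M: real_distribution M by (rule M(1))
    obtain q where q: "\<And>n. q n \<in> \<rat>" "\<And>n. t < q n" "\<And>n. q n < t + 1 / real (Suc n)"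
      and qt: "q \<longlonglongrightarrow> t"
      using rational_sequence_above[of t] by blast
    have q0: "q n > 0" for n using q(2)[of n] t by simp
    have "isCont f t" using cont t by (simp add: continuous_on_eq_continuous_at)
    then have 1: "(\<lambda>n. f (q n) / L) \<longlonglongrightarrow> f t / L"
      using L(2) qt by (intro tendsto_divide isCont_tendsto_compose[of t f]) auto
    have "(\<lambda>n. LINT x|M. unit_clamp x powr q n) \<longlonglongrightarrow> (LINT x|M. unit_clamp x powr t)"
    proof (rule integral_dominated_convergence[where w = "\<lambda>_. 1"])
      have meas: "(\<lambda>x. unit_clamp x powr t) \<in> borel_measurable borel" if "t > 0" for t
        by (rule borel_measurable_continuous_onI)
           (simp add: continuous_at_imp_continuous_on continuous_unit_clamp_powr that)
      show "(\<lambda>x. unit_clamp x powr t) \<in> borel_measurable M" using meas[OF t] by simp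
      show "(\<lambda>x. unit_clamp x powr q n) \<in> borel_measurable M" for n using meas[OF q0] by simp
      show "AE x in M. (\<lambda>n. unit_clamp x powr q n) \<longlonglongrightarrow> unit_clamp x powr t"
        using t unit_clamp_bounds by (intro AE_I2 tendsto_powr'[OF tendsto_const qt]) auto
      show "AE x in M. norm (unit_clamp x powr q n) \<le> 1" for n
        using unit_clamp_powr_bounds q0[of n] by (intro AE_I2) (simp add: less_imp_le)
    qed simp
    moreover have "(LINT x|M. unit_clamp x powr q n) = f (q n) / L" for n
      by (rule rat[OF q0 q(1)])
    ultimately have "(\<lambda>n. f (q n) / L) \<longlonglongrightarrow> (LINT x|M. unit_clamp x powr t)" by simp
    then show ?thesis using 1 by (rule LIMSEQ_unique)
  qed
  with M(1) show ?thesis by (rule that)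
qed

text \<open>
  Substituting \<open>x = e\<^sup>-\<^sup>s\<close> in the moment representation.
\<close>

theorem bernstein_finite:
  fixes f :: "real \<Rightarrow> real"
  assumes diff: "\<And>h m t. h > 0 \<Longrightarrow> t > 0 \<Longrightarrow> 0 \<le> (backward_diff h ^^ m) f t"
    and cont: "continuous_on {0<..} f"
    and L: "(f \<longlongrightarrow> L) (at_right 0)"
  obtains \<mu> where "finite_measure_halfline \<mu>" "\<And>t. t > 0 \<Longrightarrow> f t = (LINT s|\<mu>. exp (- t * s))"
    "measure \<mu> {0..} = L"
proof -
  have f0: "0 \<le> f t" if "t > 0" for t using diff[of 1 t 0] that by simp
  have fL: "f t \<le> L" if t: "t > 0" for t
  proof (rule tendsto_lowerbound[OF L])
    have "f t \<le> f x" if "0 < x" "x < t" for x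
      using diff[of "t - x" x 1] that by (simp add: backward_diff_def)
    then show "\<forall>\<^sub>F x in at_right 0. f t \<le> f x"
      unfolding eventually_at_right_field using t by (auto intro!: exI[of _ t])
  qed simp
  have "0 \<le> L" using f0[of 1] fL[of 1] by simp
  show ?thesis
  proof (cases "L = 0")
    case True
    let ?\<mu> = "null_measure (restrict_space borel {0..}) :: real measure"
    show ?thesis
    proof (rule that[of ?\<mu>])
      show "finite_measure_halfline ?\<mu>"
        by (auto simp: finite_measure_halfline_def space_restrict_space intro!: finite_measureI)
      show "f t = (LINT s|?\<mu>. exp (- t * s))" if "t > 0" for t
        using f0[OF that] fL[OF that] True by simp
      show "measure ?\<mu> {0..} = L" using True by (simp add: measure_def)
    qed
  next
    case False
    with \<open>0 \<le> L\<close> have L0: "L > 0" by simp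
    obtain M where M: "real_distribution M" "\<And>t. t > 0 \<Longrightarrow> (LINT x|M. unit_clamp x powr t) = f t / L"
      using bernstein_on_unit_interval[OF diff cont L L0] by blast
    interpret M: real_distribution M by (rule M(1))
    have meas: "(\<lambda>x. unit_clamp x powr t) \<in> borel_measurable M" if "t > 0" for t
    proof -
      have "(\<lambda>x. unit_clamp x powr t) \<in> borel_measurable borel"
        by (rule borel_measurable_continuous_onI)
           (simp add: continuous_at_imp_continuous_on continuous_unit_clamp_powr that)
      then show ?thesis by simp
    qed
    \<comment> \<open>letting \<open>t\<close> tend to 0 shows that all mass sits on \<open>x > 0\<close>, that is, at finite \<open>s = - ln x\<close>\<close>
    have "(\<lambda>n. LINT x|M. unit_clamp x powr (1 / real (Suc n))) \<longlonglongrightarrow> (LINT x|M. indicator {0<..} x)"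
    proof (rule integral_dominated_convergence[where w = "\<lambda>_. 1"])
      show "AE x in M. (\<lambda>n. unit_clamp x powr (1 / real (Suc n))) \<longlonglongrightarrow> indicator {0<..} x"
      proof (rule AE_I2)
        fix x :: real
        show "(\<lambda>n. unit_clamp x powr (1 / real (Suc n))) \<longlonglongrightarrow> indicator {0<..} x"
        proof (cases "x > 0")
          case True
          then have "unit_clamp x > 0" by (simp add: unit_clamp_def)
          then have "(\<lambda>n. unit_clamp x powr (1 / real (Suc n))) \<longlonglongrightarrow> unit_clamp x powr 0"
            by (intro tendsto_powr[OF tendsto_const one_over_Suc_tendsto]) auto
          then show ?thesis using True \<open>unit_clamp x > 0\<close> by simp
        qed (simp add: unit_clamp_def)
      qed
      show "AE x in M. norm (unit_clamp x powr (1 / real (Suc n))) \<le> 1" for n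
        using unit_clamp_powr_bounds by (intro AE_I2) simp
    qed (use meas in auto)
    moreover have "(\<lambda>n. LINT x|M. unit_clamp x powr (1 / real (Suc n))) \<longlonglongrightarrow> L / L"
    proof -
      have "filterlim (\<lambda>n. 1 / real (Suc n)) (at_right 0) sequentially"
        using one_over_Suc_tendsto by (simp add: filterlim_at)
      from filterlim_compose[OF L this] have "(\<lambda>n. f (1 / real (Suc n)) / L) \<longlonglongrightarrow> L / L"
        using L0 by (intro tendsto_divide) auto
      then show ?thesis by (simp add: M(2))
    qed
    ultimately have "(LINT x|M. indicator {0<..} x) = L / L" by (rule LIMSEQ_unique)
    then have "measure M {0<..} = 1" using L0 by simp
    then have pos: "AE x in M. x \<in> {0<..}" by (rule M.AE_prob_1)
    define S where "S x = (if x > 0 then - ln (unit_clamp x) else 0)" for x :: real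
    have S0: "S x \<ge> 0" for x
      using unit_clamp_bounds(2)[of x] by (auto simp: S_def unit_clamp_def)
    have Sb: "S \<in> borel_measurable borel" unfolding S_def[abs_def] unit_clamp_def[abs_def] by measurable
    define D where "D = density M (\<lambda>_. ennreal L)"
    have Sm: "S \<in> measurable D (restrict_space borel {0..})"
      using Sb S0 by (intro measurable_restrict_space2) (auto simp: D_def)
    define \<mu> where "\<mu> = distr D (restrict_space borel {0..}) S"
    have mass: "emeasure \<mu> {0..} = ennreal L"
    proof -
      have "emeasure \<mu> {0..} = emeasure D (S -` {0..} \<inter> space D)"
        unfolding \<mu>_def by (rule emeasure_distr[OF Sm]) (auto simp: sets_restrict_space_iff)
      also have "S -` {0..} \<inter> space D = space M" using S0 by (auto simp: D_def)
      also have "emeasure D (space M) = ennreal L"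
        unfolding D_def using M.emeasure_space_1 by (subst emeasure_density_const) auto
      finally show ?thesis .
    qed
    show ?thesis
    proof (rule that[of \<mu>])
      show "finite_measure_halfline \<mu>"
        unfolding finite_measure_halfline_def using mass
        by (auto simp: \<mu>_def space_restrict_space intro!: finite_measureI)
      show "measure \<mu> {0..} = L" using mass L0 by (simp add: measure_def)
      fix t :: real assume t: "t > 0"
      have "(LINT s|\<mu>. exp (- t * s)) = (LINT x|D. exp (- t * S x))"
        unfolding \<mu>_def by (rule integral_distr[OF Sm]) (auto intro: measurable_restrict_space1)
      also have "\<dots> = (LINT x|M. L * exp (- t * S x))"
        unfolding D_def using Sb L0 by (subst integral_density) auto
      also have "\<dots> = L * (LINT x|M. exp (- t * S x))" by simp
      also have "(LINT x|M. exp (- t * S x)) = (LINT x|M. unit_clamp x powr t)"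
      proof (rule integral_cong_AE)
        show "AE x in M. exp (- t * S x) = unit_clamp x powr t"
          using pos by eventually_elim (auto simp: S_def powr_def unit_clamp_def)
      qed (use Sb meas[OF t] in auto)
      also have "L * \<dots> = f t" using M(2)[OF t] L0 by simp
      finally show "f t = (LINT s|\<mu>. exp (- t * s))" ..
    qed
  qed
qed

section \<open>The Levy-Khintchine representation of a Bernstein function\<close>

lemma smooth_pos_iterated_deriv:
  assumes "smooth_pos f" "t > 0"
  shows "((deriv ^^ n) f has_real_derivative (deriv ^^ Suc n) f t) (at t)"
  using assms unfolding smooth_pos_def by (simp add: DERIV_deriv_iff_real_differentiable)

lemma tendsto_mono_at_right_0:
  fixes f :: "real \<Rightarrow> real"
  assumes "\<And>s t. 0 < s \<Longrightarrow> s \<le> t \<Longrightarrow> f s \<le> f t" "\<And>t. 0 < t \<Longrightarrow> K \<le> f t"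
  shows "\<exists>l. (f \<longlongrightarrow> l) (at_right 0)"
proof -
  have "(f \<longlongrightarrow> Inf (f ` ({0<..} \<inter> UNIV))) (at 0 within ({0<..} \<inter> UNIV))"
    by (rule Lim_right_bound) (use assms in auto)
  then show ?thesis by auto
qed

lemma at_zero_plus_eqI: "(f \<longlongrightarrow> l) (at_right 0) \<Longrightarrow> at_zero_plus f = l"
  unfolding at_zero_plus_def by (rule tendsto_Lim) simp

theorem BCM_laplace_transform:
  assumes "g \<in> BCM"
  obtains \<mu> where "finite_measure_halfline \<mu>" "\<And>t. t > 0 \<Longrightarrow> g t = (LINT s|\<mu>. exp (- t * s))"
    "measure \<mu> {0..} = at_zero_plus g"
proof -
  let ?G = "\<lambda>n. (deriv ^^ n) g"
  have cm: "smooth_pos g" "\<And>n t. t > 0 \<Longrightarrow> 0 \<le> (-1) ^ n * ?G n t"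
    and bd: "bounded (g ` {0<..})"
    using assms by (auto simp: BCM_def completely_monotone_def)
  have der: "(?G n has_real_derivative ?G (Suc n) t) (at t)" if "t > 0" for n t
    by (rule smooth_pos_iterated_deriv[OF cm(1) that])
  have diff: "0 \<le> (backward_diff h ^^ m) g t" if "h > 0" "t > 0" for h m t
    using alternating_derivs_backward_diff[of h ?G t m, OF that(1) der cm(2) that(2)] by simp
  have cont: "continuous_on {0<..} g"
    using der[of _ 0] by (auto intro!: continuous_at_imp_continuous_on DERIV_isCont)
  obtain K where K: "\<And>t. t > 0 \<Longrightarrow> \<bar>g t\<bar> \<le> K"
    using bd unfolding bounded_iff by auto
  have "\<exists>l. ((\<lambda>t. - g t) \<longlongrightarrow> l) (at_right 0)"
  proof (rule tendsto_mono_at_right_0[where K = "- K"])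
    fix s t :: real assume "0 < s" "s \<le> t"
    then show "- g s \<le> - g t" using diff[of "t - s" s 1] by (cases "s = t") (auto simp: backward_diff_def)
  qed (use K abs_le_D1 in fastforce)
  then obtain l where "((\<lambda>t. - g t) \<longlongrightarrow> l) (at_right 0)" ..
  then have L: "(g \<longlongrightarrow> - l) (at_right 0)" using tendsto_minus by fastforce
  obtain \<mu> where "finite_measure_halfline \<mu>" "\<And>t. t > 0 \<Longrightarrow> g t = (LINT s|\<mu>. exp (- t * s))"
    "measure \<mu> {0..} = - l"
    using bernstein_finite[OF diff cont L] by blast
  then show ?thesis using that at_zero_plus_eqI[OF L] by auto
qed

text \<open>
  The kernel \<open>1 - e\<^sup>-\<^sup>s\<^sup>z\<close> of the Levy-Khintchine formula, normalised to have the value 1 at \<open>z = 1\<close>. The continuous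
  extension to \<open>s = 0\<close> is \<open>z\<close>, which is how the linear part of a Bernstein function becomes a mass at 0.
\<close>

definition levy_kernel :: "real \<Rightarrow> real \<Rightarrow> real" where
  "levy_kernel s z = (if s = 0 then z else (1 - exp (- (s * z))) / (1 - exp (- s)))"

lemma levy_kernel_measurable [measurable]: "(\<lambda>s. levy_kernel s z) \<in> borel_measurable borel"
  unfolding levy_kernel_def by measurable

lemma levy_kernel_increment: "levy_kernel s (z + h) - levy_kernel s z = exp (- (s * z)) * levy_kernel s h"
proof -
  have e: "exp (- (s * (z + h))) = exp (- (s * z)) * exp (- (s * h))"
    by (simp add: exp_add[symmetric] algebra_simps)
  show ?thesis
  proof (cases "s = 0")
    case False
    then show ?thesis
      by (simp add: levy_kernel_def e diff_divide_distrib[symmetric] right_diff_distrib)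
  qed (simp add: levy_kernel_def)
qed

lemma levy_kernel_one: "levy_kernel s 1 = 1"
  by (simp add: levy_kernel_def)

lemma levy_kernel_zero: "levy_kernel s 0 = 0"
  by (simp add: levy_kernel_def)

lemma levy_kernel_nonneg: "0 \<le> s \<Longrightarrow> 0 \<le> z \<Longrightarrow> 0 \<le> levy_kernel s z"
  by (simp add: levy_kernel_def)

lemma levy_kernel_mono: "0 \<le> s \<Longrightarrow> z \<le> w \<Longrightarrow> levy_kernel s z \<le> levy_kernel s w"
  by (auto simp: levy_kernel_def divide_right_mono mult_left_mono)

lemma levy_kernel_of_nat: "0 \<le> s \<Longrightarrow> levy_kernel s (real n) \<le> real n"
proof (induction n)
  case 0
  then show ?case by (simp add: levy_kernel_def)
next
  case (Suc n)
  have "exp (- (s * real n)) \<le> 1" using Suc.prems by simp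
  moreover have "levy_kernel s (real n) \<le> real n" using Suc by simp
  ultimately have "levy_kernel s (real n + 1) \<le> real n + 1"
    using levy_kernel_increment[of s "real n" 1] unfolding levy_kernel_one by linarith
  then show ?case by (simp add: add.commute)
qed

lemma levy_kernel_bound:
  assumes "0 \<le> s" "0 \<le> z" "z \<le> real n" shows "\<bar>levy_kernel s z\<bar> \<le> real n"
  using levy_kernel_nonneg[OF assms(1,2)] levy_kernel_mono[OF assms(1,3)] levy_kernel_of_nat[OF assms(1), of n]
  by simp

lemma isCont_levy_kernel: "isCont (levy_kernel s) z"
proof (cases "s = 0")
  case False
  then show ?thesis unfolding levy_kernel_def by (simp add: isCont_def) (intro tendsto_intros; simp)
qed (simp add: levy_kernel_def[abs_def])

text \<open>
  The derivative of \<open>levy_kernel s\<close> at 0; the derivative at \<open>r\<close> is \<open>e\<^sup>-\<^sup>s\<^sup>r\<close> times this value.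
\<close>

definition levy_density :: "real \<Rightarrow> real" where
  "levy_density s = (if s = 0 then 1 else s / (1 - exp (- s)))"

lemma levy_kernel_deriv_0: "((\<lambda>h. levy_kernel s h / h) \<longlongrightarrow> levy_density s) (at 0)"
proof (cases "s = 0")
  case True
  then show ?thesis
    by (intro tendsto_eventually) (auto simp: levy_kernel_def levy_density_def eventually_at_filter)
next
  case False
  have "((\<lambda>z. levy_kernel s z) has_real_derivative (- (exp (- (s * 0)) * (- s))) / (1 - exp (- s))) (at 0)"
    using False unfolding levy_kernel_def by (auto intro!: derivative_eq_intros)
  then show ?thesis using False
    by (simp add: has_field_derivative_iff levy_density_def) (simp add: levy_kernel_def)
qed

lemma BF_derivs:
  assumes "psi \<in> BF"
  shows "\<And>n t. t > 0 \<Longrightarrow> ((deriv ^^ n) psi has_real_derivative (deriv ^^ Suc n) psi t) (at t)"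
    "\<And>n t. t > 0 \<Longrightarrow> 0 \<le> (-1) ^ n * (deriv ^^ Suc n) psi t"
    "\<And>t. t > 0 \<Longrightarrow> 0 \<le> psi t"
proof -
  have p: "smooth_pos psi" "completely_monotone (deriv psi)" "\<And>t. t > 0 \<Longrightarrow> 0 \<le> psi t"
    using assms by (auto simp: BF_def)
  show "((deriv ^^ n) psi has_real_derivative (deriv ^^ Suc n) psi t) (at t)" if "t > 0" for n t
    by (rule smooth_pos_iterated_deriv[OF p(1) that])
  show "0 \<le> (-1) ^ n * (deriv ^^ Suc n) psi t" if "t > 0" for n t
    using p(2) that unfolding completely_monotone_def
    by (simp add: funpow_Suc_right del: funpow.simps)
  show "0 \<le> psi t" if "t > 0" for t using p(3) that .
qed

lemma BF_deriv:
  assumes "psi \<in> BF" "t > 0"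
  shows "(psi has_real_derivative deriv psi t) (at t)" "0 \<le> deriv psi t"
  using BF_derivs(1)[OF assms, of 0] BF_derivs(2)[OF assms, of 0] by auto

lemma BF_continuous_on_deriv: "psi \<in> BF \<Longrightarrow> continuous_on {0<..} (deriv psi)"
  using BF_derivs(1)[of psi _ "Suc 0"] by (auto intro!: continuous_at_imp_continuous_on DERIV_isCont)

lemma BF_mono: "psi \<in> BF \<Longrightarrow> 0 < s \<Longrightarrow> s \<le> t \<Longrightarrow> psi s \<le> psi t"
  by (rule DERIV_nonneg_imp_nondecreasing[of s t psi]) (auto intro!: BF_deriv exI conjI)

lemma BF_increment_antimono:
  assumes psi: "psi \<in> BF" and h: "h \<ge> 0" and z: "0 < z" "z \<le> w"
  shows "psi (w + h) - psi w \<le> psi (z + h) - psi z"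
proof (rule DERIV_nonpos_imp_nonincreasing[OF z(2), of "\<lambda>z. psi (z + h) - psi z"])
  fix x assume "z \<le> x" "x \<le> w"
  then have x: "x > 0" using z by simp
  have "((\<lambda>z. psi (z + h)) has_real_derivative deriv psi (x + h)) (at x)"
    using BF_deriv(1)[OF psi, of "x + h"] x h by (simp add: DERIV_shift)
  then have "((\<lambda>z. psi (z + h) - psi z) has_real_derivative deriv psi (x + h) - deriv psi x) (at x)"
    using BF_deriv(1)[OF psi x] by (intro DERIV_diff)
  moreover have "deriv psi (x + h) \<le> deriv psi x"
  proof -
    have "(-1) ^ 0 * (deriv ^^ Suc 0) psi (x + h) \<le> (-1) ^ 0 * (deriv ^^ Suc 0) psi x"
      by (rule alternating_derivs_antimono[where G = "\<lambda>n. (deriv ^^ Suc n) psi"])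
         (rule BF_derivs(1)[OF psi], assumption, rule BF_derivs(2)[OF psi], assumption, use x h in simp_all)
    then show ?thesis by simp
  qed
  ultimately show "\<exists>y. ((\<lambda>z. psi (z + h) - psi z) has_real_derivative y) (at x) \<and> y \<le> 0"
    by (intro exI conjI) auto
qed

text \<open>
  The unit increment of a Bernstein function is completely monotone: it is positive since \<open>\<psi>\<close> increases, and its
  derivatives alternate because those of \<open>\<psi>'\<close> are monotone with alternating signs.
\<close>

lemma BF_unit_increment_backward_diff:
  assumes psi: "psi \<in> BF" and "h > 0" "t > 0"
  shows "0 \<le> (backward_diff h ^^ m) (\<lambda>t. psi (t + 1) - psi t) t"
proof -
  define G where "G n t = (deriv ^^ n) psi (t + 1) - (deriv ^^ n) psi t" for n t
  have "0 \<le> (backward_diff h ^^ m) (G 0) t"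
  proof (rule alternating_derivs_backward_diff[OF assms(2) _ _ assms(3)])
    fix n and t :: real assume t: "t > 0"
    have "((\<lambda>z. (deriv ^^ n) psi (z + 1)) has_real_derivative (deriv ^^ Suc n) psi (t + 1)) (at t)"
      using BF_derivs(1)[OF psi, of "t + 1" n] t by (simp only: DERIV_shift)
    then show "(G n has_real_derivative G (Suc n) t) (at t)"
      unfolding G_def using BF_derivs(1)[OF psi t, of n] by (intro DERIV_diff)
    show "0 \<le> (-1) ^ n * G n t"
    proof (cases n)
      case 0
      then show ?thesis using BF_mono[OF psi t, of "t + 1"] by (simp add: G_def)
    next
      case (Suc k)
      have "(-1) ^ k * (deriv ^^ Suc k) psi (t + 1) \<le> (-1) ^ k * (deriv ^^ Suc k) psi t"
        by (rule alternating_derivs_antimono[where G = "\<lambda>n. (deriv ^^ Suc n) psi"])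
           (rule BF_derivs(1)[OF psi], assumption, rule BF_derivs(2)[OF psi], assumption, use t in simp_all)
      then show ?thesis using Suc by (simp add: G_def right_diff_distrib)
    qed
  qed
  moreover have "G 0 = (\<lambda>t. psi (t + 1) - psi t)" by (simp add: G_def fun_eq_iff)
  ultimately show ?thesis by simp
qed

text \<open>
  Applied to the increments of concave functions.
\<close>

lemma antimono_tendsto_at_top:
  fixes p :: "real \<Rightarrow> real"
  assumes anti: "\<And>z w. 0 < z \<Longrightarrow> z \<le> w \<Longrightarrow> p w \<le> p z" and nn: "\<And>z. 0 < z \<Longrightarrow> 0 \<le> p z"
  shows "\<exists>l. (p \<longlongrightarrow> l) at_top"
proof -
  let ?l = "Inf (p ` {0<..})"
  have bb: "bdd_below (p ` {0<..})" using nn by (auto intro!: bdd_belowI[of _ 0])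
  have "(p \<longlongrightarrow> ?l) at_top"
  proof (rule order_tendstoI)
    fix y assume "y < ?l"
    moreover have "?l \<le> p z" if "z > 0" for z using bb that by (auto intro: cInf_lower)
    ultimately show "\<forall>\<^sub>F x in at_top. y < p x"
      by (intro eventually_mono[OF eventually_gt_at_top[of 0]]) (auto intro: less_le_trans)
  next
    fix y assume "?l < y"
    then obtain z where "z > 0" "p z < y" using cInf_lessD[of "p ` {0<..}" y] by auto
    then show "\<forall>\<^sub>F x in at_top. p x < y"
      by (intro eventually_mono[OF eventually_ge_at_top[of z]]) (auto intro: le_less_trans[OF anti])
  qed
  then show ?thesis ..
qed

text \<open>
  Let \<open>\<rho>\<close> represent the unit increment of \<open>\<psi>\<close> and let \<open>\<Phi>\<close> be the right-hand integral. Since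
  \<open>levy_kernel s (z+1) - levy_kernel s z = e\<^sup>-\<^sup>s\<^sup>z\<close>, the difference \<open>\<psi> - \<Phi>\<close> has period 1. Both functions are
  concave, so their increments converge at infinity; a periodic function whose increments converge has constant
  increments, hence every positive rational is a period, and by continuity \<open>\<psi> - \<Phi>\<close> is constant.
\<close>

lemma BF_representation:
  assumes psi: "psi \<in> BF"
  obtains \<rho> where "finite_measure_halfline \<rho>" "0 \<le> at_zero_plus psi"
    "\<And>z. z > 0 \<Longrightarrow> psi z = at_zero_plus psi + (LINT s|\<rho>. levy_kernel s z)"
proof -
  let ?d = "\<lambda>t. psi (t + 1) - psi t"
  have "\<exists>a. (psi \<longlongrightarrow> a) (at_right 0)"
    by (rule tendsto_mono_at_right_0[where K = 0]) (auto intro: BF_mono[OF psi] BF_derivs(3)[OF psi])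
  then obtain a where a: "(psi \<longlongrightarrow> a) (at_right 0)" ..
  have az: "at_zero_plus psi = a" by (rule at_zero_plus_eqI[OF a])
  have a0: "0 \<le> a"
    by (rule tendsto_lowerbound[OF a])
       (auto simp: eventually_at_right_field intro!: exI[of _ 1] BF_derivs(3)[OF psi])
  have cont: "isCont psi t" if "t > 0" for t
    using BF_deriv(1)[OF psi that] by (rule DERIV_isCont)
  have "continuous_on {0<..} (\<lambda>t. psi (t + 1))"
    by (rule continuous_on_compose2[of "{0<..}" psi])
       (auto intro!: continuous_at_imp_continuous_on cont continuous_intros)
  then have dc: "continuous_on {0<..} ?d"
    by (intro continuous_on_diff) (auto intro: continuous_at_imp_continuous_on cont)
  have "((\<lambda>t. psi (t + 1)) \<longlongrightarrow> psi (0 + 1)) (at_right 0)"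
    by (rule isCont_tendsto_compose[OF cont]) (simp, intro tendsto_intros)
  then have dl: "(?d \<longlongrightarrow> psi 1 - a) (at_right 0)" using a by (intro tendsto_diff) simp_all
  obtain \<rho> where \<rho>: "finite_measure_halfline \<rho>" "\<And>t. t > 0 \<Longrightarrow> ?d t = (LINT s|\<rho>. exp (- t * s))"
    using bernstein_finite[OF BF_unit_increment_backward_diff[OF psi] dc dl] by blast
  have int: "integrable \<rho> (\<lambda>s. levy_kernel s z)" if z: "0 \<le> z" for z
  proof -
    obtain n where "z \<le> real n" using real_arch_simple by blast
    then show ?thesis
      using levy_kernel_bound z by (intro halfline_integrable_bounded[OF \<rho>(1), of _ "real n"]) auto
  qed
  define \<Phi> where "\<Phi> z = (LINT s|\<rho>. levy_kernel s z)" for z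
  have inc: "\<Phi> (z + h) - \<Phi> z = (LINT s|\<rho>. exp (- (s * z)) * levy_kernel s h)" if "0 \<le> z" "0 \<le> h" for z h
    unfolding \<Phi>_def using int that
    by (subst Bochner_Integration.integral_diff[symmetric]) (auto simp: levy_kernel_increment)
  have inc_int: "integrable \<rho> (\<lambda>s. exp (- (s * z)) * levy_kernel s h)" if "0 \<le> z" "0 \<le> h" for z h
    unfolding levy_kernel_increment[symmetric] using int that by auto
  define \<delta> where "\<delta> z = psi z - \<Phi> z" for z
  have per1: "\<delta> (z + 1) = \<delta> z" if "z > 0" for z
    using inc[of z 1] \<rho>(2)[OF that] that by (simp add: \<delta>_def levy_kernel_one mult.commute)
  have pern: "\<delta> (z + real n) = \<delta> z" if "z > 0" for z n
  proof (induction n)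
    case (Suc n)
    then show ?case using per1[of "z + real n"] that by (simp add: ac_simps)
  qed simp
  \<comment> \<open>both increments decrease to a limit, so a periodic difference of increments must be constant\<close>
  have inc_const: "\<delta> (z + h) - \<delta> z = \<delta> (w + h) - \<delta> w" if h: "h > 0" and z: "z > 0" and w: "w > 0" for z w h
  proof -
    have "\<exists>l. ((\<lambda>z. psi (z + h) - psi z) \<longlongrightarrow> l) at_top"
      using h by (intro antimono_tendsto_at_top) (auto intro: BF_increment_antimono[OF psi] BF_mono[OF psi])
    then obtain l where l: "((\<lambda>z. psi (z + h) - psi z) \<longlongrightarrow> l) at_top" ..
    have "\<exists>l. ((\<lambda>z. \<Phi> (z + h) - \<Phi> z) \<longlongrightarrow> l) at_top"
    proof (rule antimono_tendsto_at_top)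
      fix x y :: real assume xy: "0 < x" "x \<le> y"
      have "(LINT s|\<rho>. exp (- (s * y)) * levy_kernel s h) \<le> (LINT s|\<rho>. exp (- (s * x)) * levy_kernel s h)"
        using xy h inc_int[of _ h]
        by (intro integral_mono mult_right_mono) (auto simp: halflineD(2)[OF \<rho>(1)] levy_kernel_nonneg mult_left_mono)
      then show "\<Phi> (y + h) - \<Phi> y \<le> \<Phi> (x + h) - \<Phi> x" using xy h by (simp add: inc)
    next
      fix x :: real assume x: "0 < x"
      have "0 \<le> (LINT s|\<rho>. exp (- (s * x)) * levy_kernel s h)"
        using h by (intro Bochner_Integration.integral_nonneg) (auto simp: halflineD(2)[OF \<rho>(1)] levy_kernel_nonneg)
      then show "0 \<le> \<Phi> (x + h) - \<Phi> x" using x h by (simp add: inc)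
    qed
    then obtain l' where l': "((\<lambda>z. \<Phi> (z + h) - \<Phi> z) \<longlongrightarrow> l') at_top" ..
    have "((\<lambda>z. (psi (z + h) - psi z) - (\<Phi> (z + h) - \<Phi> z)) \<longlongrightarrow> l - l') at_top"
      by (intro tendsto_diff l l')
    then have lim: "((\<lambda>z. \<delta> (z + h) - \<delta> z) \<longlongrightarrow> l - l') at_top" by (simp add: \<delta>_def algebra_simps)
    have "\<delta> (z + h) - \<delta> z = l - l'" if z: "z > 0" for z
    proof -
      have "filterlim (\<lambda>n. z + real n) at_top sequentially"
        by (intro filterlim_tendsto_add_at_top[OF tendsto_const] filterlim_real_sequentially)
      from filterlim_compose[OF lim this] have "(\<lambda>n. \<delta> (z + real n + h) - \<delta> (z + real n)) \<longlonglongrightarrow> l - l'" .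
      moreover have "\<delta> (z + real n + h) - \<delta> (z + real n) = \<delta> (z + h) - \<delta> z" for n
        using pern[of z n] pern[of "z + h" n] z h by (simp add: add.assoc add.commute[of h])
      ultimately show ?thesis by (simp add: LIMSEQ_const_iff)
    qed
    then show ?thesis using z w by simp
  qed
  have per_rat: "\<delta> (z + q) = \<delta> z" if z: "z > 0" and q: "q > 0" "q \<in> \<rat>" for z q
  proof -
    have "\<exists>m n :: nat. n > 0 \<and> q = real m / real n"
      using Rats_abs_nat_div_natE[OF q(2)] q(1) by (metis abs_of_pos gr0I)
    then obtain m n :: nat where mn: "n > 0" "q = real m / real n" by blast
    have mult: "\<delta> (z + real k * q) - \<delta> z = real k * (\<delta> (z + q) - \<delta> z)" for k
    proof (induction k)
      case (Suc k)
      have "0 < z + real k * q" using z q by (simp add: add_pos_nonneg)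
      from inc_const[OF q(1) this z] Suc show ?case by (simp add: algebra_simps)
    qed simp
    have "real n * (\<delta> (z + q) - \<delta> z) = 0"
      using mult[of n] pern[OF z, of m] mn by simp
    then show ?thesis using mn by simp
  qed
  have const: "\<delta> w = \<delta> z" if z: "0 < z" and w: "z < w" for z w
  proof -
    obtain q where q: "\<And>n. q n \<in> \<rat>" "\<And>n. w - z < q n" "\<And>n. q n < w - z + 1 / real (Suc n)"
      and "q \<longlonglongrightarrow> w - z"
      using rational_sequence_above[of "w - z"] by blast
    from tendsto_add[OF tendsto_const[of z] \<open>q \<longlonglongrightarrow> w - z\<close>] have qw: "(\<lambda>n. z + q n) \<longlonglongrightarrow> w" by simp
    obtain N where N: "w + 1 \<le> real N" using real_arch_simple by blast
    have "(\<lambda>n. psi (z + q n)) \<longlonglongrightarrow> psi w"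
      using z w by (intro isCont_tendsto_compose[OF cont qw]) auto
    moreover have "(\<lambda>n. \<Phi> (z + q n)) \<longlonglongrightarrow> \<Phi> w"
      unfolding \<Phi>_def
    proof (rule halfline_integral_limit[OF \<rho>(1), where B = "real N"])
      show "(\<lambda>n. levy_kernel s (z + q n)) \<longlonglongrightarrow> levy_kernel s w" for s
        by (rule isCont_tendsto_compose[OF isCont_levy_kernel qw])
      fix n and s :: real assume s: "0 \<le> s"
      have "1 / real (Suc n) \<le> 1" by simp
      then have "z + q n \<le> real N" using q(3)[of n] N by linarith
      moreover have "0 \<le> z + q n" using q(2)[of n] z w by linarith
      ultimately show "\<bar>levy_kernel s (z + q n)\<bar> \<le> real N" using s by (intro levy_kernel_bound)
    qed auto
    ultimately have "(\<lambda>n. \<delta> (z + q n)) \<longlonglongrightarrow> \<delta> w" unfolding \<delta>_def by (rule tendsto_diff)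
    moreover have "\<delta> (z + q n) = \<delta> z" for n
      using q(1,2)[of n] w by (intro per_rat[OF z]) auto
    ultimately show ?thesis by (simp add: LIMSEQ_const_iff)
  qed
  have \<delta>a: "\<delta> z = a" if z: "z > 0" for z
  proof -
    let ?h = "\<lambda>n. 1 / real (Suc n)"
    have "filterlim ?h (at_right 0) sequentially"
      using one_over_Suc_tendsto by (simp add: filterlim_at)
    from filterlim_compose[OF a this] have "(\<lambda>n. psi (?h n)) \<longlonglongrightarrow> a" .
    moreover have "(\<lambda>n. \<Phi> (?h n)) \<longlonglongrightarrow> (LINT s|\<rho>. 0)"
      unfolding \<Phi>_def
    proof (rule halfline_integral_limit[OF \<rho>(1), where B = "real 1"])
      show "(\<lambda>n. levy_kernel s (?h n)) \<longlonglongrightarrow> 0" for s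
        using isCont_tendsto_compose[OF isCont_levy_kernel one_over_Suc_tendsto, of s]
        unfolding levy_kernel_zero .
      show "\<bar>levy_kernel s (?h n)\<bar> \<le> real 1" if "0 \<le> s" for s n
        using that by (intro levy_kernel_bound) auto
    qed auto
    ultimately have "(\<lambda>n. \<delta> (?h n)) \<longlonglongrightarrow> a - (LINT s|\<rho>. 0)" unfolding \<delta>_def by (rule tendsto_diff)
    moreover have "\<delta> (?h n) = \<delta> z" for n
      using const[of "?h n" z] const[of z "?h n"] z by (cases "?h n" z rule: linorder_cases) auto
    ultimately show ?thesis by (simp add: LIMSEQ_const_iff)
  qed
  show ?thesis
  proof (rule that[OF \<rho>(1)])
    show "0 \<le> at_zero_plus psi" using a0 az by simp
    show "psi z = at_zero_plus psi + (LINT s|\<rho>. levy_kernel s z)" if "z > 0" for z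
      using \<delta>a[OF that] by (simp add: \<delta>_def \<Phi>_def az)
  qed
qed

lemma levy_density_nonneg: "0 \<le> s \<Longrightarrow> 0 \<le> levy_density s"
  by (simp add: levy_density_def)

lemma levy_density_measurable [measurable]: "levy_density \<in> borel_measurable borel"
  unfolding levy_density_def[abs_def] by measurable

text \<open>
  Fatou's lemma applied to the difference quotients of the representation.
\<close>

lemma BF_deriv_ge:
  assumes psi: "psi \<in> BF" and \<rho>: "finite_measure_halfline \<rho>"
    and rep: "\<And>z. z > 0 \<Longrightarrow> psi z = a + (LINT s|\<rho>. levy_kernel s z)" and r: "r > 0"
  shows "(\<integral>\<^sup>+s. ennreal (exp (- (s * r)) * levy_density s) \<partial>\<rho>) \<le> ennreal (deriv psi r)"
proof -
  let ?h = "\<lambda>n. 1 / real (Suc n)"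
  let ?u = "\<lambda>n s. exp (- (s * r)) * (levy_kernel s (?h n) / ?h n)"
  have int: "integrable \<rho> (\<lambda>s. levy_kernel s z)" if z: "0 \<le> z" for z
  proof -
    obtain n where "z \<le> real n" using real_arch_simple by blast
    then show ?thesis
      using levy_kernel_bound z by (intro halfline_integrable_bounded[OF \<rho>, of _ "real n"]) auto
  qed
  have h0: "filterlim ?h (at 0) sequentially"
    using one_over_Suc_tendsto by (simp add: filterlim_at)
  have um: "(\<lambda>s. ennreal (?u n s)) \<in> borel_measurable \<rho>" for n
    by (rule halfline_measurable[OF \<rho>]) measurable
  have "(\<integral>\<^sup>+s. ennreal (exp (- (s * r)) * levy_density s) \<partial>\<rho>) = (\<integral>\<^sup>+s. liminf (\<lambda>n. ennreal (?u n s)) \<partial>\<rho>)"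
  proof (rule nn_integral_cong)
    fix s
    have "(\<lambda>n. ?u n s) \<longlonglongrightarrow> exp (- (s * r)) * levy_density s"
      by (intro tendsto_mult tendsto_const filterlim_compose[OF levy_kernel_deriv_0 h0])
    then have "(\<lambda>n. ennreal (?u n s)) \<longlonglongrightarrow> ennreal (exp (- (s * r)) * levy_density s)"
      by (rule tendsto_ennrealI)
    then show "ennreal (exp (- (s * r)) * levy_density s) = liminf (\<lambda>n. ennreal (?u n s))"
      by (rule lim_imp_Liminf[OF sequentially_bot, symmetric])
  qed
  also have "\<dots> \<le> liminf (\<lambda>n. \<integral>\<^sup>+s. ennreal (?u n s) \<partial>\<rho>)"
    by (rule nn_integral_liminf) (rule um)
  also have "\<dots> = liminf (\<lambda>n. ennreal ((psi (r + ?h n) - psi r) / ?h n))"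
  proof -
    have "(\<integral>\<^sup>+s. ennreal (?u n s) \<partial>\<rho>) = ennreal ((psi (r + ?h n) - psi r) / ?h n)" for n
    proof -
      have u: "?u n = (\<lambda>s. (levy_kernel s (r + ?h n) - levy_kernel s r) / ?h n)"
        unfolding levy_kernel_increment times_divide_eq_right ..
      have iu: "integrable \<rho> (?u n)" unfolding u using int r by auto
      have "(\<integral>\<^sup>+s. ennreal (?u n s) \<partial>\<rho>) = ennreal (LINT s|\<rho>. ?u n s)"
        by (rule nn_integral_eq_integral[OF iu])
           (auto simp: halflineD(2)[OF \<rho>] levy_kernel_nonneg intro!: AE_I2)
      also have "(LINT s|\<rho>. ?u n s) = (psi (r + ?h n) - psi r) / ?h n"
      proof -
        have pos: "0 < r + ?h n" using r by (simp add: add_pos_nonneg)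
        show ?thesis unfolding u using int[of r] int[of "r + ?h n"] pos r rep[OF r] rep[OF pos] by simp
      qed
      finally show ?thesis .
    qed
    then show ?thesis by simp
  qed
  also have "\<dots> = ennreal (deriv psi r)"
  proof (rule lim_imp_Liminf[OF sequentially_bot tendsto_ennrealI])
    show "(\<lambda>n. (psi (r + ?h n) - psi r) / ?h n) \<longlonglongrightarrow> deriv psi r"
      using filterlim_compose[OF BF_deriv(1)[OF psi r, unfolded DERIV_def] h0] .
  qed
  finally show ?thesis .
qed

section \<open>Mixtures of measures and truncated exponential laws\<close>

abbreviation halfline :: "real measure" where "halfline \<equiv> restrict_space borel {0..}"

lemma finite_measure_halfline_distr:
  assumes "finite_measure N" "\<phi> \<in> measurable N halfline"
  shows "finite_measure_halfline (distr N halfline \<phi>)"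
  using finite_measure.finite_measure_distr[OF assms]
  by (simp add: finite_measure_halfline_def space_restrict_space)

lemma vec_integral_point_mass:
  fixes f :: "real \<Rightarrow> 'a::banach"
  assumes f: "continuous_on {0<..} f" and B: "\<And>s. 0 \<le> s \<Longrightarrow> norm (f s) \<le> B" and s: "0 \<le> s"
  shows "finite_measure_halfline (return halfline s)" "vec_integral (return halfline s) f = f s"
proof -
  have sp: "s \<in> space halfline" using s by (simp add: space_restrict_space)
  have "prob_space (return halfline s)" by (rule prob_space_return[OF sp])
  then show hl: "finite_measure_halfline (return halfline s)"
    by (simp add: finite_measure_halfline_def prob_space_def space_restrict_space)
  have m: "measure (return halfline s) (grid_cell n k) = indicator (grid_cell n k) s" for n k
    using grid_cell_sets[OF hl, of n k] by (simp add: measure_return)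
  show "vec_integral (return halfline s) f = f s"
    using vec_integral_continuous_limit[OF hl f B] grid_step_tendsto[OF f s]
    unfolding m grid_step_def[symmetric] by (rule LIMSEQ_unique)
qed

text \<open>
  Vector-valued Fubini theorem for mixtures: a Riemann sum of a mixture is the mixture of the Riemann sums, being
  a finite combination of masses of cells, and dominated convergence does the rest.
\<close>

lemma vec_integral_mixture:
  fixes f :: "real \<Rightarrow> 'a::banach"
  assumes N: "finite_measure N" and P: "finite_measure_halfline P"
    and K: "\<And>w. w \<in> space N \<Longrightarrow> finite_measure_halfline (K w)"
    and C: "\<And>w. w \<in> space N \<Longrightarrow> measure (K w) {0..} \<le> C"
    and meas: "\<And>B. B \<in> sets halfline \<Longrightarrow> (\<lambda>w. emeasure (K w) B) \<in> borel_measurable N"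
    and mix: "\<And>B. B \<in> sets halfline \<Longrightarrow> emeasure P B = (\<integral>\<^sup>+w. emeasure (K w) B \<partial>N)"
    and f: "continuous_on {0<..} f" and B: "\<And>s. 0 \<le> s \<Longrightarrow> norm (f s) \<le> B"
    and sm: "strongly_measurable N (\<lambda>w. vec_integral (K w) f)"
  shows "vec_integral P f = vec_integral N (\<lambda>w. vec_integral (K w) f)"
proof -
  interpret N: finite_measure N by (rule N)
  let ?g = "\<lambda>n w. grid_sum (K w) n f"
  have cell: "grid_cell n k \<in> sets halfline" for n k
    using grid_cell_nonneg by (simp add: sets_restrict_space_iff)
  have Kle: "measure (K w) S \<le> C" if "w \<in> space N" for w S
  proof -
    interpret finite_measure "K w" by (rule halflineD(1)[OF K[OF that]])
    show ?thesis using bounded_measure[of S] C[OF that] by (simp add: halflineD(2)[OF K[OF that]])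
  qed
  have int: "integrable N (\<lambda>w. measure (K w) (grid_cell n k))" for n k
  proof (rule N.integrable_const_bound[of _ C])
    have "(\<lambda>w. enn2real (emeasure (K w) (grid_cell n k))) \<in> borel_measurable N"
      using meas[OF cell] by measurable
    then show "(\<lambda>w. measure (K w) (grid_cell n k)) \<in> borel_measurable N" by (simp add: measure_def)
  qed (use Kle in auto)
  have eq: "measure P (grid_cell n k) = (LINT w|N. measure (K w) (grid_cell n k))" for n k
  proof -
    have "emeasure P (grid_cell n k) = (\<integral>\<^sup>+w. ennreal (measure (K w) (grid_cell n k)) \<partial>N)"
      unfolding mix[OF cell]
      by (intro nn_integral_cong finite_measure.emeasure_eq_measure halflineD(1) K)
    also have "\<dots> = ennreal (LINT w|N. measure (K w) (grid_cell n k))"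
      by (rule nn_integral_eq_integral[OF int]) simp
    finally show ?thesis by (simp add: measure_def)
  qed
  have g: "vec_integrable N (?g n)" "vec_integral N (?g n) =
      grid_sum P n f" for n
  proof -
    show "vec_integrable N (?g n)"
      by (rule vec_integrable_sum[OF N]) (rule vec_integral_scaleR_const(1)[OF N int])
    have "vec_integral N (?g n) = (\<Sum>k\<le>(Suc n)\<^sup>2.
        vec_integral N (\<lambda>w. measure (K w) (grid_cell n k) *\<^sub>R f (real k / real (Suc n))))"
      by (rule vec_integral_sum[OF N finite_atMost]) (rule vec_integral_scaleR_const(1)[OF N int])
    then show "vec_integral N (?g n) =
      grid_sum P n f"
      by (simp only: vec_integral_scaleR_const(2)[OF N int] eq)
  qed
  have "(\<lambda>n. vec_integral N (?g n)) \<longlonglongrightarrow> vec_integral N (\<lambda>w. vec_integral (K w) f)"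
  proof (rule vec_integral_dominated_convergence[OF N _ sm, where B = "C * B"])
    show "strongly_measurable N (?g n)" for n using g(1) by (simp add: vec_integrable_def)
    show "(\<lambda>n. ?g n w) \<longlonglongrightarrow> vec_integral (K w) f" if "w \<in> space N" for w
      by (rule vec_integral_continuous_limit[OF K[OF that] f B])
    fix n w assume w: "w \<in> space N"
    interpret Kw: finite_measure "K w" by (rule halflineD(1)[OF K[OF w]])
    have "0 \<le> B" using B[of 0] norm_ge_zero order_trans by blast
    have "norm (?g n w) \<le> (\<Sum>k\<le>(Suc n)\<^sup>2. measure (K w) (grid_cell n k) * B)"
      by (intro order_trans[OF norm_sum] sum_mono) (auto intro!: mult_left_mono B)
    also have "\<dots> = measure (K w) (\<Union>k\<le>(Suc n)\<^sup>2. grid_cell n k) * B"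
    proof -
      have "disjoint_family_on (grid_cell n) {..(Suc n)\<^sup>2}"
        unfolding disjoint_family_on_def
      proof (intro ballI impI, rule ccontr)
        fix i j assume "i \<noteq> j" "grid_cell n i \<inter> grid_cell n j \<noteq> {}"
        then obtain s where s: "s \<in> grid_cell n i" "s \<in> grid_cell n j" by blast
        have "0 \<le> s" using s(1) grid_cell_nonneg[of n i] by auto
        with s \<open>i \<noteq> j\<close> show False by (simp add: grid_cell_iff)
      qed
      then show ?thesis
        using grid_cell_sets[OF K[OF w]]
        by (subst Kw.finite_measure_finite_Union) (auto simp: sum_distrib_right)
    qed
    also have "\<dots> \<le> C * B" using Kle[OF w] \<open>0 \<le> B\<close> by (rule mult_right_mono)
    finally show "norm (?g n w) \<le> C * B" .
  qed
  moreover have "(\<lambda>n. vec_integral N (?g n)) \<longlonglongrightarrow> vec_integral P f"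
    unfolding g(2) by (rule vec_integral_continuous_limit[OF P f B])
  ultimately show ?thesis by (rule LIMSEQ_unique[rotated])
qed

text \<open>
  An image measure is a mixture of point masses.
\<close>

lemma vec_integral_distr:
  fixes f :: "real \<Rightarrow> 'a::banach"
  assumes N: "finite_measure N" and \<phi>: "\<phi> \<in> measurable N halfline"
    and f: "continuous_on {0<..} f" and B: "\<And>s. 0 \<le> s \<Longrightarrow> norm (f s) \<le> B"
    and sm: "strongly_measurable N (\<lambda>w. f (\<phi> w))"
  shows "vec_integral (distr N halfline \<phi>) f = vec_integral N (\<lambda>w. f (\<phi> w))"
proof -
  have pos: "0 \<le> \<phi> w" if "w \<in> space N" for w
    using measurable_space[OF \<phi> that] by (simp add: space_restrict_space)
  have eq: "vec_integral (return halfline (\<phi> w)) f = f (\<phi> w)" if "w \<in> space N" for w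
    by (rule vec_integral_point_mass(2)[OF f B pos[OF that]])
  have "vec_integral (distr N halfline \<phi>) f = vec_integral N (\<lambda>w. vec_integral (return halfline (\<phi> w)) f)"
  proof (rule vec_integral_mixture[OF N finite_measure_halfline_distr[OF N \<phi>] _ _ _ _ f B])
    show "finite_measure_halfline (return halfline (\<phi> w))" if "w \<in> space N" for w
      by (rule vec_integral_point_mass(1)[OF f B pos[OF that]])
    show "measure (return halfline (\<phi> w)) {0..} \<le> 1" if "w \<in> space N" for w
      by (simp add: measure_return sets_restrict_space_iff indicator_def)
    fix S assume S: "S \<in> sets halfline"
    show "(\<lambda>w. emeasure (return halfline (\<phi> w)) S) \<in> borel_measurable N"
      using S \<phi> by simp
    show "emeasure (distr N halfline \<phi>) S = (\<integral>\<^sup>+w. emeasure (return halfline (\<phi> w)) S \<partial>N)"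
    proof -
      have "emeasure (distr N halfline \<phi>) S = (\<integral>\<^sup>+w. indicator (\<phi> -` S \<inter> space N) w \<partial>N)"
        using S \<phi> by (subst nn_integral_indicator) (auto simp: emeasure_distr intro: measurable_sets)
      also have "\<dots> = (\<integral>\<^sup>+w. emeasure (return halfline (\<phi> w)) S \<partial>N)"
        using S by (intro nn_integral_cong) (simp add: indicator_def)
      finally show ?thesis .
    qed
  next
    show "strongly_measurable N (\<lambda>w. vec_integral (return halfline (\<phi> w)) f)"
      using sm eq by (subst strongly_measurable_cong) auto
  qed
  also have "\<dots> = vec_integral N (\<lambda>w. f (\<phi> w))" using eq by (rule vec_integral_cong)
  finally show ?thesis .
qed

lemma vec_integral_distr_pair:
  fixes f :: "real \<Rightarrow> 'a::banach"
  assumes N: "finite_measure N" and U: "prob_space U"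
    and \<phi>: "(\<lambda>(w, v). \<phi> w v) \<in> measurable (N \<Otimes>\<^sub>M U) halfline"
    and f: "continuous_on {0<..} f" and B: "\<And>s. 0 \<le> s \<Longrightarrow> norm (f s) \<le> B"
    and sm: "strongly_measurable N (\<lambda>w. vec_integral (distr U halfline (\<phi> w)) f)"
  shows "finite_measure_halfline (distr (N \<Otimes>\<^sub>M U) halfline (\<lambda>(w, v). \<phi> w v))" (is ?fin)
    and "vec_integral (distr (N \<Otimes>\<^sub>M U) halfline (\<lambda>(w, v). \<phi> w v)) f
       = vec_integral N (\<lambda>w. vec_integral (distr U halfline (\<phi> w)) f)" (is ?eq)
proof -
  interpret N: finite_measure N by (rule N)
  interpret U: prob_space U by (rule U)
  interpret pair_sigma_finite N U ..
  have "finite_measure (N \<Otimes>\<^sub>M U)"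
    by (rule finite_measureI)
       (simp add: space_pair_measure U.emeasure_pair_measure_Times U.emeasure_space_1 N.emeasure_eq_measure)
  then show ?fin by (rule finite_measure_halfline_distr[OF _ \<phi>])
  have \<phi>w: "\<phi> w \<in> measurable U halfline" if "w \<in> space N" for w
    using measurable_Pair2[OF \<phi> that] by simp
  show ?eq
  proof (rule vec_integral_mixture[OF N \<open>?fin\<close> _ _ _ _ f B sm])
    show "finite_measure_halfline (distr U halfline (\<phi> w))" if "w \<in> space N" for w
      by (rule finite_measure_halfline_distr[OF U.finite_measure_axioms \<phi>w[OF that]])
    show "measure (distr U halfline (\<phi> w)) {0..} \<le> 1" if "w \<in> space N" for w
      by (rule prob_space.prob_le_1[OF U.prob_space_distr[OF \<phi>w[OF that]]])
    fix S assume S: "S \<in> sets halfline"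
    let ?A = "(\<lambda>(w, v). \<phi> w v) -` S \<inter> space (N \<Otimes>\<^sub>M U)"
    have A: "?A \<in> sets (N \<Otimes>\<^sub>M U)" using \<phi> S by (rule measurable_sets)
    have sec: "emeasure (distr U halfline (\<phi> w)) S = emeasure U (Pair w -` ?A)" if "w \<in> space N" for w
      using that S \<phi>w[OF that]
      by (simp add: emeasure_distr) (rule arg_cong[where f = "emeasure U"], auto simp: space_pair_measure)
    have "(\<lambda>w. emeasure U (Pair w -` ?A)) \<in> borel_measurable N"
      by (rule U.measurable_emeasure_Pair[OF A])
    then show "(\<lambda>w. emeasure (distr U halfline (\<phi> w)) S) \<in> borel_measurable N"
      using sec by (subst measurable_cong) auto
    have "emeasure (distr (N \<Otimes>\<^sub>M U) halfline (\<lambda>(w, v). \<phi> w v)) S = emeasure (N \<Otimes>\<^sub>M U) ?A"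
      by (rule emeasure_distr[OF \<phi> S])
    also have "\<dots> = (\<integral>\<^sup>+w. emeasure U (Pair w -` ?A) \<partial>N)"
      by (rule U.emeasure_pair_measure_alt[OF A])
    finally show "emeasure (distr (N \<Otimes>\<^sub>M U) halfline (\<lambda>(w, v). \<phi> w v)) S
       = (\<integral>\<^sup>+w. emeasure (distr U halfline (\<phi> w)) S \<partial>N)"
      by (simp add: sec cong: nn_integral_cong)
  qed
qed

definition weighted_sum_measure :: "real \<Rightarrow> 's measure \<Rightarrow> 's measure \<Rightarrow> 's measure" where
  "weighted_sum_measure c \<mu> \<nu> = measure_of (space \<mu>) (sets \<mu>) (\<lambda>A. ennreal c * emeasure \<mu> A + emeasure \<nu> A)"

lemma emeasure_weighted_sum_measure:
  assumes "sets \<nu> = sets \<mu>" "A \<in> sets \<mu>"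
  shows "emeasure (weighted_sum_measure c \<mu> \<nu>) A = ennreal c * emeasure \<mu> A + emeasure \<nu> A"
  unfolding weighted_sum_measure_def
proof (rule emeasure_measure_of_sigma[OF sets.sigma_algebra_axioms _ _ assms(2)])
  show "positive (sets \<mu>) (\<lambda>A. ennreal c * emeasure \<mu> A + emeasure \<nu> A)" by (simp add: positive_def)
  show "countably_additive (sets \<mu>) (\<lambda>A. ennreal c * emeasure \<mu> A + emeasure \<nu> A)"
  proof (rule countably_additiveI)
    fix A :: "nat \<Rightarrow> 'a set"
    assume A: "range A \<subseteq> sets \<mu>" "disjoint_family A"
    have "(\<Sum>i. ennreal c * emeasure \<mu> (A i) + emeasure \<nu> (A i))
        = (\<Sum>i. ennreal c * emeasure \<mu> (A i)) + (\<Sum>i. emeasure \<nu> (A i))"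
      by (rule suminf_add[symmetric]) auto
    also have "\<dots> = ennreal c * emeasure \<mu> (\<Union>i. A i) + emeasure \<nu> (\<Union>i. A i)"
      using A assms(1) by (simp add: suminf_emeasure)
    finally show "(\<Sum>i. ennreal c * emeasure \<mu> (A i) + emeasure \<nu> (A i))
        = ennreal c * emeasure \<mu> (\<Union>i. A i) + emeasure \<nu> (\<Union>i. A i)" .
  qed
qed

lemma finite_measure_halfline_weighted_sum:
  assumes c: "0 \<le> c" and \<mu>: "finite_measure_halfline \<mu>" and \<nu>: "finite_measure_halfline \<nu>"
  shows "finite_measure_halfline (weighted_sum_measure c \<mu> \<nu>)"
    and "A \<in> sets \<mu> \<Longrightarrow> measure (weighted_sum_measure c \<mu> \<nu>) A = c * measure \<mu> A + measure \<nu> A"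
proof -
  interpret \<mu>: finite_measure \<mu> by (rule halflineD(1)[OF \<mu>])
  interpret \<nu>: finite_measure \<nu> by (rule halflineD(1)[OF \<nu>])
  have eq: "sets \<nu> = sets \<mu>" using \<mu> \<nu> by (simp add: halflineD)
  have sp: "space (weighted_sum_measure c \<mu> \<nu>) = space \<mu>" "sets (weighted_sum_measure c \<mu> \<nu>) = sets \<mu>"
    by (simp_all add: weighted_sum_measure_def sets.sigma_sets_eq sets.space_closed)
  have fin: "finite_measure (weighted_sum_measure c \<mu> \<nu>)"
    by (rule finite_measureI)
       (simp add: sp emeasure_weighted_sum_measure[OF eq] \<mu>.emeasure_eq_measure \<nu>.emeasure_eq_measure
          ennreal_mult_eq_top_iff)
  then show "finite_measure_halfline (weighted_sum_measure c \<mu> \<nu>)"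
    using \<mu> by (simp add: finite_measure_halfline_def sp)
  show "measure (weighted_sum_measure c \<mu> \<nu>) A = c * measure \<mu> A + measure \<nu> A" if "A \<in> sets \<mu>"
    using emeasure_weighted_sum_measure[OF eq that, of c] c
    by (simp add: \<mu>.emeasure_eq_measure \<nu>.emeasure_eq_measure finite_measure.emeasure_eq_measure[OF fin]
        flip: ennreal_plus ennreal_mult)
qed

lemma vec_integral_weighted_sum:
  fixes f :: "real \<Rightarrow> 'a::banach"
  assumes c: "0 \<le> c" and \<mu>: "finite_measure_halfline \<mu>" and \<nu>: "finite_measure_halfline \<nu>"
    and f: "continuous_on {0<..} f" and B: "\<And>s. 0 \<le> s \<Longrightarrow> norm (f s) \<le> B"
  shows "vec_integral (weighted_sum_measure c \<mu> \<nu>) f = c *\<^sub>R vec_integral \<mu> f + vec_integral \<nu> f"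
proof -
  note s = finite_measure_halfline_weighted_sum[OF c \<mu> \<nu>]
  have "(\<lambda>n. c *\<^sub>R grid_sum \<mu> n f
        + grid_sum \<nu> n f)
      \<longlonglongrightarrow> c *\<^sub>R vec_integral \<mu> f + vec_integral \<nu> f"
    by (intro tendsto_add tendsto_scaleR tendsto_const
        vec_integral_continuous_limit[OF \<mu> f B] vec_integral_continuous_limit[OF \<nu> f B])
  then have "(\<lambda>n. grid_sum (weighted_sum_measure c \<mu> \<nu>) n f)
      \<longlonglongrightarrow> c *\<^sub>R vec_integral \<mu> f + vec_integral \<nu> f"
    unfolding s(2)[OF grid_cell_sets[OF \<mu>]] scaleR_add_left sum.distrib scaleR_sum_right scaleR_scaleR .
  with vec_integral_continuous_limit[OF s(1) f B] show ?thesis by (rule LIMSEQ_unique)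
qed

lemma laplace_as_vec_integral:
  assumes "finite_measure_halfline \<mu>" "t > 0"
  shows "vec_integral \<mu> (\<lambda>s. exp (- t * s)) = (LINT s|\<mu>. exp (- t * s))"
    "continuous_on {0<..} (\<lambda>s. exp (- t * s))" "\<And>s. 0 \<le> s \<Longrightarrow> norm (exp (- t * s)) \<le> (1::real)"
proof -
  show b: "\<And>s. 0 \<le> s \<Longrightarrow> norm (exp (- t * s)) \<le> (1::real)" using assms(2) by simp
  show "continuous_on {0<..} (\<lambda>s. exp (- t * s))" by (intro continuous_intros)
  have "integrable \<mu> (\<lambda>s. exp (- t * s))"
    using b by (intro halfline_integrable_bounded[OF assms(1), where B = 1]) auto
  then show "vec_integral \<mu> (\<lambda>s. exp (- t * s)) = (LINT s|\<mu>. exp (- t * s))"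
    by (rule vec_integral_real(2)[OF halflineD(1)[OF assms(1)]])
qed

lemma laplace_weighted_sum:
  assumes "0 \<le> c" "finite_measure_halfline \<mu>" "finite_measure_halfline \<nu>" "t > 0"
  shows "(LINT s|weighted_sum_measure c \<mu> \<nu>. exp (- t * s)) = c * (LINT s|\<mu>. exp (- t * s)) + (LINT s|\<nu>. exp (- t * s))"
  using vec_integral_weighted_sum[OF assms(1-3) laplace_as_vec_integral(2,3)[OF assms(2,4)]]
  by (simp only: laplace_as_vec_integral(1)[OF assms(2,4)] laplace_as_vec_integral(1)[OF assms(3,4)]
      laplace_as_vec_integral(1)[OF finite_measure_halfline_weighted_sum(1)[OF assms(1-3)] assms(4)]
      real_scaleR_def)

definition unit_uniform :: "real measure" where
  "unit_uniform = restrict_space lborel {0..<1}"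

lemma unit_uniform: "prob_space unit_uniform" "space unit_uniform = {0..<1}"
  "sets unit_uniform = sets (restrict_space borel {0..<1})"
proof -
  show sp: "space unit_uniform = {0..<1}" by (simp add: unit_uniform_def space_restrict_space)
  show "sets unit_uniform = sets (restrict_space borel {0..<1})"
    by (simp add: unit_uniform_def sets_restrict_space)
  have "emeasure unit_uniform {0..<1} = 1" by (simp add: unit_uniform_def emeasure_restrict_space)
  then show "prob_space unit_uniform" by (intro prob_spaceI) (simp add: sp)
qed

text \<open>
  The quantile function of the exponential law conditioned to \<open>[0,h]\<close>, where \<open>p = e\<^sup>-\<^sup>h\<close>. The value \<open>p = 0\<close> gives the
  full exponential law and \<open>p = 1\<close> the unit mass at 0.
\<close>

definition trunc_exp_map :: "real \<Rightarrow> real \<Rightarrow> real" where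
  "trunc_exp_map p v = - ln (1 - v * (1 - p))"

definition trunc_exp :: "real \<Rightarrow> real measure" where
  "trunc_exp p = distr unit_uniform halfline (trunc_exp_map p)"

lemma trunc_exp_map_pos:
  assumes "0 \<le> p" "p \<le> 1" "0 \<le> v" "v < 1"
  shows "0 < 1 - v * (1 - p)" "1 - v * (1 - p) \<le> 1" "p \<le> 1 - v * (1 - p)" "0 \<le> trunc_exp_map p v"
proof -
  have "v * (1 - p) \<le> v * 1" using assms by (intro mult_left_mono) auto
  then show 1: "0 < 1 - v * (1 - p)" using assms by simp
  show 2: "1 - v * (1 - p) \<le> 1" using assms by simp
  have "v * (1 - p) \<le> 1 * (1 - p)" using assms by (intro mult_right_mono) auto
  then show "p \<le> 1 - v * (1 - p)" by simp
  show "0 \<le> trunc_exp_map p v" using 1 2 by (simp add: trunc_exp_map_def)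
qed

lemma trunc_exp_map_measurable:
  assumes "0 \<le> p" "p \<le> 1" shows "trunc_exp_map p \<in> measurable unit_uniform halfline"
proof (rule measurable_restrict_space2)
  show "trunc_exp_map p \<in> space unit_uniform \<rightarrow> {0..}"
    using trunc_exp_map_pos(4)[OF assms] by (auto simp: unit_uniform(2))
  have "trunc_exp_map p \<in> borel_measurable borel" unfolding trunc_exp_map_def[abs_def] by measurable
  then show "trunc_exp_map p \<in> borel_measurable unit_uniform"
    by (simp add: unit_uniform_def measurable_restrict_space1)
qed

lemma finite_measure_halfline_trunc_exp:
  assumes "0 \<le> p" "p \<le> 1"
  shows "finite_measure_halfline (trunc_exp p)" "prob_space (trunc_exp p)"
proof -
  interpret prob_space unit_uniform by (rule unit_uniform(1))
  show "finite_measure_halfline (trunc_exp p)" unfolding trunc_exp_def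
    by (rule finite_measure_halfline_distr[OF finite_measure_axioms trunc_exp_map_measurable[OF assms]])
  show "prob_space (trunc_exp p)" unfolding trunc_exp_def
    by (rule prob_space_distr[OF trunc_exp_map_measurable[OF assms]])
qed

lemma trunc_exp_1_laplace: "(LINT s|trunc_exp 1. exp (- t * s)) = 1"
proof -
  interpret U: prob_space unit_uniform by (rule unit_uniform(1))
  have "(LINT s|trunc_exp 1. exp (- t * s)) = (LINT v|unit_uniform. exp (- t * trunc_exp_map 1 v))"
    unfolding trunc_exp_def
    by (intro integral_distr trunc_exp_map_measurable) (auto intro: measurable_restrict_space1)
  then show ?thesis by (simp add: trunc_exp_map_def U.prob_space)
qed

lemma trunc_exp_laplace:
  assumes p: "0 \<le> p" "p < 1" and t: "t > 0"
  shows "(LINT s|trunc_exp p. exp (- t * s)) = (1 - p powr (t + 1)) / ((1 - p) * (t + 1))"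
proof -
  let ?F = "\<lambda>v. - ((1 - v * (1 - p)) powr (t + 1)) / ((1 - p) * (t + 1))"
  have powr_eq: "exp (- t * trunc_exp_map p v) = (1 - v * (1 - p)) powr t" if "v \<in> space unit_uniform" for v
  proof -
    have "0 < 1 - v * (1 - p)"
      using that p by (intro trunc_exp_map_pos(1)) (auto simp: unit_uniform(2))
    then show ?thesis by (simp only: powr_def trunc_exp_map_def minus_mult_minus) simp
  qed
  have "(LINT s|trunc_exp p. exp (- t * s)) = (LINT v|unit_uniform. exp (- t * trunc_exp_map p v))"
    unfolding trunc_exp_def using p
    by (intro integral_distr trunc_exp_map_measurable) (auto intro: measurable_restrict_space1)
  also have "\<dots> = (LINT v|unit_uniform. (1 - v * (1 - p)) powr t)"
    by (intro Bochner_Integration.integral_cong refl) (simp only: powr_eq)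
  also have "\<dots> = (LINT v:{0..<1}|lborel. (1 - v * (1 - p)) powr t)"
    unfolding unit_uniform_def by (simp add: integral_restrict_space set_lebesgue_integral_def)
  also have "\<dots> = (LINT v:{0..1}|lborel. (1 - v * (1 - p)) powr t)"
  proof (rule set_integral_cong_set)
    show "AE v in lborel. (v \<in> {0..1::real}) = (v \<in> {0..<1})"
      using AE_lborel_singleton[of 1] by eventually_elim auto
  qed (simp_all add: set_borel_measurable_def)
  also have "\<dots> = ?F 1 - ?F 0"
  proof -
    have nn: "0 \<le> 1 - v * (1 - p)" if "v \<in> {0..1}" for v
      using that p mult_mono[of v 1 "1 - p" 1] by auto
    have contF: "continuous_on {0..1} ?F"
      using nn p t by (intro continuous_intros continuous_on_powr') auto
    have contf: "continuous_on {0..1} (\<lambda>v. (1 - v * (1 - p)) powr t)"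
      using nn t by (intro continuous_intros continuous_on_powr') auto
    have "((\<lambda>v. (1 - v * (1 - p)) powr t) has_integral (?F 1 - ?F 0)) {0..1}"
    proof (rule fundamental_theorem_of_calculus_interior[OF _ contF])
      fix v :: real assume v: "v \<in> {0<..<1}"
      have pos: "0 < 1 - v * (1 - p)" by (rule trunc_exp_map_pos(1)) (use v p in auto)
      have "(?F has_real_derivative (1 - v * (1 - p)) powr t) (at v)"
      proof -
        have "((\<lambda>v. 1 - v * (1 - p)) has_real_derivative - (1 - p)) (at v)"
          by (auto intro!: derivative_eq_intros)
        from DERIV_powr[OF this pos DERIV_const[of "t + 1"]]
        have "((\<lambda>v. (1 - v * (1 - p)) powr (t + 1)) has_real_derivative
            (1 - v * (1 - p)) powr (t + 1) * ((t + 1) * (- (1 - p)) / (1 - v * (1 - p)))) (at v)"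
          by (simp add: mult.commute)
        moreover have "(1 - v * (1 - p)) powr (t + 1) = (1 - v * (1 - p)) powr t * (1 - v * (1 - p))"
          using pos by (simp add: powr_add)
        ultimately have "((\<lambda>v. (1 - v * (1 - p)) powr (t + 1)) has_real_derivative
            (p - 1) * ((t + 1) * (1 - v * (1 - p)) powr t)) (at v)"
          using pos by (simp add: mult_ac)
        moreover have "- ((p - 1) * ((t + 1) * (1 - v * (1 - p)) powr t)) / ((1 - p) * (t + 1))
            = (1 - v * (1 - p)) powr t"
        proof -
          have c: "(1 - p) * (t + 1) \<noteq> 0" using p t by simp
          have eq: "- ((p - 1) * ((t + 1) * y)) = (1 - p) * (t + 1) * y" for y
            by (simp add: algebra_simps)
          show ?thesis unfolding eq by (rule nonzero_mult_div_cancel_left[OF c])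
        qed
        ultimately show ?thesis
          using DERIV_cdivide[OF DERIV_minus, of "\<lambda>v. (1 - v * (1 - p)) powr (t + 1)"
            "(p - 1) * ((t + 1) * (1 - v * (1 - p)) powr t)" v UNIV "(1 - p) * (t + 1)"] by simp
      qed
      then show "(?F has_vector_derivative (1 - v * (1 - p)) powr t) (at v)"
        by (simp add: has_real_derivative_iff_has_vector_derivative)
    qed simp
    moreover have "set_integrable lborel {0..1} (\<lambda>v. (1 - v * (1 - p)) powr t)"
      by (rule borel_integrable_atLeastAtMost'[OF contf])
    ultimately show ?thesis
      by (simp only: set_borel_integral_eq_integral(2) integral_unique)
  qed
  also have "\<dots> = (1 - p powr (t + 1)) / ((1 - p) * (t + 1))"
    by (simp add: diff_divide_distrib)
  finally show ?thesis .
qed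

section \<open>Bounded semigroups, their resolvent and the functional calculus\<close>

text \<open>
  Operators are integrated along orbits, because semigroups are only strongly continuous.
\<close>

lemma vec_integral_blinfun:
  fixes B :: "'s \<Rightarrow> 'a::banach \<Rightarrow>\<^sub>L 'b::banach"
  assumes fin: "finite_measure N" and C: "0 \<le> C"
    and vi: "\<And>x. vec_integrable N (\<lambda>s. blinfun_apply (B s) x)"
    and bound: "\<And>x. (\<integral>\<^sup>+s. ennreal (norm (blinfun_apply (B s) x)) \<partial>N) \<le> ennreal (C * norm x)"
  shows "\<exists>F. \<forall>x. blinfun_apply F x = vec_integral N (\<lambda>s. blinfun_apply (B s) x)"
proof -
  have "bounded_linear (\<lambda>x. vec_integral N (\<lambda>s. blinfun_apply (B s) x))"
  proof (rule bounded_linear_intro)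
    show "vec_integral N (\<lambda>s. blinfun_apply (B s) (x + y)) =
       vec_integral N (\<lambda>s. blinfun_apply (B s) x) + vec_integral N (\<lambda>s. blinfun_apply (B s) y)" for x y
      by (simp add: blinfun.add_right vec_integral_add[OF fin vi vi])
    show "vec_integral N (\<lambda>s. blinfun_apply (B s) (r *\<^sub>R x)) = r *\<^sub>R vec_integral N (\<lambda>s. blinfun_apply (B s) x)" for r x
      by (simp add: blinfun.scaleR_right vec_integral_bounded_linear[OF fin vi bounded_linear_scaleR_right])
    show "norm (vec_integral N (\<lambda>s. blinfun_apply (B s) x)) \<le> norm x * C" for x
      using order_trans[OF norm_vec_integral_le[OF fin vi] bound[of x]] C
      by (simp add: ennreal_le_iff mult.commute)
  qed
  then have "\<forall>x. blinfun_apply (Blinfun (\<lambda>x. vec_integral N (\<lambda>s. blinfun_apply (B s) x))) x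
      = vec_integral N (\<lambda>s. blinfun_apply (B s) x)"
    by (simp add: bounded_linear_Blinfun_apply)
  then show ?thesis ..
qed

text \<open>
  The shape in which uniqueness enters the calculus, where each representation is a difference of two measures.
\<close>

lemma laplace_unique_signed:
  fixes f :: "real \<Rightarrow> 'a::banach"
  assumes hl: "finite_measure_halfline \<mu>" "finite_measure_halfline \<nu>"
      "finite_measure_halfline \<mu>'" "finite_measure_halfline \<nu>'"
    and eq: "\<And>t. t > 0 \<Longrightarrow> (LINT s|\<mu>. exp (- t * s)) - (LINT s|\<nu>. exp (- t * s))
        = (LINT s|\<mu>'. exp (- t * s)) - (LINT s|\<nu>'. exp (- t * s))"
    and f: "continuous_on {0<..} f" and B: "\<And>s. 0 \<le> s \<Longrightarrow> norm (f s) \<le> B"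
  shows "vec_integral \<mu> f - vec_integral \<nu> f = vec_integral \<mu>' f - vec_integral \<nu>' f"
proof -
  have "(\<Sum>i\<in>{0,1,2,3::nat}. ([1,-1,-1,1] ! i) *\<^sub>R vec_integral ([\<mu>,\<nu>,\<mu>',\<nu>'] ! i) f) = 0"
  proof (rule laplace_unique_vec_integral[OF _ _ _ f B])
    fix t :: real assume "t > 0"
    from eq[OF this] show "(\<Sum>i\<in>{0,1,2,3::nat}. ([1,-1,-1,1] ! i) *
       (LINT s|([\<mu>,\<nu>,\<mu>',\<nu>'] ! i). exp (- t * s))) = 0" by simp
  qed (use hl in auto)
  then show ?thesis by (simp add: algebra_simps)
qed

lemma hl_exp: "finite_measure_halfline (trunc_exp 0)"
  by (rule finite_measure_halfline_trunc_exp) auto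

lemma shift_measurable: "0 \<le> s \<Longrightarrow> (+) s \<in> measurable (trunc_exp 0) halfline"
  unfolding trunc_exp_def measurable_distr_eq1
  by (rule measurable_restrict_space2)
     (auto simp: space_restrict_space intro!: measurable_restrict_space1 add_nonneg_nonneg)

lemma shifted_exp:
  assumes s: "0 \<le> s"
  shows "finite_measure_halfline (distr (trunc_exp 0) halfline ((+) s))"
    and "t > 0 \<Longrightarrow> (LINT u|distr (trunc_exp 0) halfline ((+) s). exp (- t * u)) = exp (- t * s) / (t + 1)"
proof -
  have fin: "finite_measure (trunc_exp 0)" by (rule halflineD(1)[OF hl_exp])
  show "finite_measure_halfline (distr (trunc_exp 0) halfline ((+) s))"
    by (rule finite_measure_halfline_distr[OF fin shift_measurable[OF s]])
  assume t: "t > 0"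
  have "(LINT u|distr (trunc_exp 0) halfline ((+) s). exp (- t * u)) = (LINT u|trunc_exp 0. exp (- t * (s + u)))"
    by (rule integral_distr[OF shift_measurable[OF s]]) (auto intro: measurable_restrict_space1)
  also have "\<dots> = exp (- t * s) * (LINT u|trunc_exp 0. exp (- t * u))"
    by (simp add: exp_add[symmetric] algebra_simps flip: integral_mult_right_zero)
  finally show "(LINT u|distr (trunc_exp 0) halfline ((+) s). exp (- t * u)) = exp (- t * s) / (t + 1)"
    using trunc_exp_laplace[of 0 t] t by simp
qed

context
  fixes T :: "real \<Rightarrow> 'a::banach \<Rightarrow>\<^sub>L 'a"
  assumes sg: "bounded_C0_semigroup T"
begin

lemma sg_zero: "blinfun_apply (T 0) x = x"
  using sg by (simp add: bounded_C0_semigroup_def)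

lemma sg_add: "0 \<le> s \<Longrightarrow> 0 \<le> t \<Longrightarrow> blinfun_apply (T (s + t)) x = blinfun_apply (T s) (blinfun_apply (T t) x)"
  using sg by (simp add: bounded_C0_semigroup_def)

lemma norm_sg: "0 \<le> t \<Longrightarrow> norm (T t) \<le> semigroup_bound T"
  unfolding semigroup_bound_def
proof (rule cSUP_upper)
  have "bounded (T ` {0..})" using sg by (simp add: bounded_C0_semigroup_def)
  then show "bdd_above ((\<lambda>t. norm (T t)) ` {0..})"
    unfolding bounded_iff by (force intro: bdd_aboveI2)
qed simp

lemma semigroup_bound_nonneg: "0 \<le> semigroup_bound T"
  using norm_sg[of 0] norm_ge_zero order_trans by blast

lemma norm_sg_apply: "0 \<le> t \<Longrightarrow> norm (blinfun_apply (T t) x) \<le> semigroup_bound T * norm x"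
  using norm_blinfun[of "T t" x] mult_right_mono[OF norm_sg, of t "norm x"] by simp

lemma semigroup_bound_ge_1: "(x :: 'a) \<noteq> 0 \<Longrightarrow> 1 \<le> semigroup_bound T"
  using norm_sg_apply[of 0 x] by (simp add: sg_zero)

lemma sg_near_zero:
  fixes x :: 'a
  assumes "e > 0" obtains d where "d > 0" "\<And>h. 0 \<le> h \<Longrightarrow> h < d \<Longrightarrow> norm (blinfun_apply (T h) x - x) < e"
proof -
  have "((\<lambda>t. blinfun_apply (T t) x) \<longlongrightarrow> x) (at_right 0)" using sg by (simp add: bounded_C0_semigroup_def)
  then have "\<forall>\<^sub>F h in at_right 0. dist (blinfun_apply (T h) x) x < e" using assms by (rule tendstoD)
  then obtain d where d: "d > 0" "\<And>h. 0 < h \<Longrightarrow> h < d \<Longrightarrow> dist (blinfun_apply (T h) x) x < e"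
    unfolding eventually_at_right_field by auto
  have "norm (blinfun_apply (T h) x - x) < e" if "0 \<le> h" "h < d" for h
    using d(2)[of h] that assms by (cases "h = 0") (auto simp: dist_norm sg_zero)
  with d(1) show ?thesis by (rule that)
qed

lemma sg_continuous:
  fixes x :: 'a
  shows "continuous_on {0..} (\<lambda>t. blinfun_apply (T t) x)"
proof (rule continuous_onI)
  fix t e :: real assume t: "t \<in> {0..}" and e: "0 < e"
  let ?M = "semigroup_bound T"
  have M: "0 < ?M + 1" using semigroup_bound_nonneg by simp
  obtain d where d: "d > 0" "\<And>h. 0 \<le> h \<Longrightarrow> h < d \<Longrightarrow> norm (blinfun_apply (T h) x - x) < e / (?M + 1)"
    using sg_near_zero[of "e / (?M + 1)" x] e M by auto
  have le: "norm (blinfun_apply (T (u + h)) x - blinfun_apply (T u) x) \<le> e" if "0 \<le> u" "0 \<le> h" "h < d" for u h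
  proof -
    have "norm (blinfun_apply (T (u + h)) x - blinfun_apply (T u) x)
       = norm (blinfun_apply (T u) (blinfun_apply (T h) x - x))"
      using that by (simp add: sg_add blinfun.diff_right)
    also have "\<dots> \<le> ?M * norm (blinfun_apply (T h) x - x)" by (rule norm_sg_apply) fact
    also have "\<dots> \<le> (?M + 1) * (e / (?M + 1))"
      using d(2)[OF that(2,3)] semigroup_bound_nonneg by (intro mult_mono) auto
    also have "\<dots> = e" using M by simp
    finally show ?thesis .
  qed
  show "\<exists>d>0. \<forall>s\<in>{0..}. dist s t < d \<longrightarrow> dist (blinfun_apply (T s) x) (blinfun_apply (T t) x) \<le> e"
  proof (intro exI[of _ d] conjI ballI impI d(1))
    fix s assume s: "s \<in> {0..}" "dist s t < d"
    show "dist (blinfun_apply (T s) x) (blinfun_apply (T t) x) \<le> e"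
      using le[of t "s - t"] le[of s "t - s"] s t
      by (cases "t \<le> s") (auto simp: dist_norm norm_minus_commute)
  qed
qed

lemma sg_continuous_pos: "continuous_on {0<..} (\<lambda>t. blinfun_apply (T t) x)"
  by (rule continuous_on_subset[OF sg_continuous]) auto

definition sg_integral :: "real measure \<Rightarrow> 'a \<Rightarrow>\<^sub>L 'a" where
  "sg_integral \<mu> = (SOME F. \<forall>x. blinfun_apply F x = vec_integral \<mu> (\<lambda>s. blinfun_apply (T s) x))"

lemma sg_integrable:
  assumes "finite_measure_halfline \<mu>" shows "vec_integrable \<mu> (\<lambda>s. blinfun_apply (T s) x)"
  by (rule vec_integrable_bounded[OF halflineD(1)[OF assms] strongly_measurable_continuous[OF assms sg_continuous_pos]])
     (use norm_sg_apply in \<open>auto simp: halflineD(2)[OF assms]\<close>)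

lemma sg_integral_apply:
  assumes \<mu>: "finite_measure_halfline \<mu>"
  shows "blinfun_apply (sg_integral \<mu>) x = vec_integral \<mu> (\<lambda>s. blinfun_apply (T s) x)"
proof -
  interpret finite_measure \<mu> by (rule halflineD(1)[OF \<mu>])
  have "\<exists>F. \<forall>x. blinfun_apply F x = vec_integral \<mu> (\<lambda>s. blinfun_apply (T s) x)"
  proof (rule vec_integral_blinfun[OF halflineD(1)[OF \<mu>] _ sg_integrable[OF \<mu>]])
    show "0 \<le> semigroup_bound T * measure \<mu> {0..}" using semigroup_bound_nonneg by simp
    fix x
    have "(\<integral>\<^sup>+s. ennreal (norm (blinfun_apply (T s) x)) \<partial>\<mu>) \<le> (\<integral>\<^sup>+s. ennreal (semigroup_bound T * norm x) \<partial>\<mu>)"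
      by (intro nn_integral_mono ennreal_leI norm_sg_apply) (simp add: halflineD(2)[OF \<mu>])
    also have "\<dots> = ennreal (semigroup_bound T * measure \<mu> {0..} * norm x)"
      using semigroup_bound_nonneg
      by (simp add: halflineD(2)[OF \<mu>] emeasure_eq_measure ennreal_mult'[symmetric] mult_ac)
    finally show "(\<integral>\<^sup>+s. ennreal (norm (blinfun_apply (T s) x)) \<partial>\<mu>)
        \<le> ennreal (semigroup_bound T * measure \<mu> {0..} * norm x)" .
  qed
  from someI_ex[OF this] show ?thesis unfolding sg_integral_def by blast
qed

text \<open>
  Two representations of the same function have the same Laplace transform, so uniqueness makes the description
  in the definition of the calculus unambiguous.
\<close>

lemma calc_eq:
  assumes rep: "laplace_representation f \<mu> \<nu>"
  shows "calc T f = sg_integral \<mu> - sg_integral \<nu>"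
  unfolding calc_def
proof (rule the_equality)
  note hl = rep[unfolded laplace_representation_def]
  show "\<exists>\<mu>' \<nu>'. laplace_representation f \<mu>' \<nu>' \<and> (\<forall>x. blinfun_apply (sg_integral \<mu> - sg_integral \<nu>) x =
      vec_integral \<mu>' (\<lambda>s. blinfun_apply (T s) x) - vec_integral \<nu>' (\<lambda>s. blinfun_apply (T s) x))"
    using rep hl by (intro exI[of _ \<mu>] exI[of _ \<nu>]) (simp add: blinfun.diff_left sg_integral_apply)
  fix F assume "\<exists>\<mu>' \<nu>'. laplace_representation f \<mu>' \<nu>' \<and> (\<forall>x. blinfun_apply F x =
      vec_integral \<mu>' (\<lambda>s. blinfun_apply (T s) x) - vec_integral \<nu>' (\<lambda>s. blinfun_apply (T s) x))"
  then obtain \<mu>' \<nu>' where rep': "laplace_representation f \<mu>' \<nu>'"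
    and F: "\<And>x. blinfun_apply F x =
      vec_integral \<mu>' (\<lambda>s. blinfun_apply (T s) x) - vec_integral \<nu>' (\<lambda>s. blinfun_apply (T s) x)" by blast
  note hl' = rep'[unfolded laplace_representation_def]
  show "F = sg_integral \<mu> - sg_integral \<nu>"
  proof (rule blinfun_eqI)
    fix x
    have "vec_integral \<mu>' (\<lambda>s. blinfun_apply (T s) x) - vec_integral \<nu>' (\<lambda>s. blinfun_apply (T s) x)
        = vec_integral \<mu> (\<lambda>s. blinfun_apply (T s) x) - vec_integral \<nu> (\<lambda>s. blinfun_apply (T s) x)"
      by (rule laplace_unique_signed[OF _ _ _ _ _ sg_continuous_pos norm_sg_apply]) (use hl hl' in auto)
    then show "blinfun_apply F x = blinfun_apply (sg_integral \<mu> - sg_integral \<nu>) x"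
      using hl by (simp add: F blinfun.diff_left sg_integral_apply)
  qed
qed

text \<open>
  The Laplace transform of the semigroup at 1, that is \<open>(1 + A)\<^sup>-\<^sup>1\<close>.
\<close>

abbreviation resolvent :: "'a \<Rightarrow>\<^sub>L 'a" where "resolvent \<equiv> sg_integral (trunc_exp 0)"

lemma shifted_exp_integral:
  assumes s: "0 \<le> s"
  shows "blinfun_apply (sg_integral (distr (trunc_exp 0) halfline ((+) s))) x = blinfun_apply (T s) (blinfun_apply resolvent x)"
proof -
  have fin: "finite_measure (trunc_exp 0)" by (rule halflineD(1)[OF hl_exp])
  note hl = shifted_exp(1)[OF s]
  have eq: "blinfun_apply (T (s + u)) x = blinfun_apply (T s) (blinfun_apply (T u) x)" if "u \<in> space (trunc_exp 0)" for u
    using that s by (simp add: sg_add halflineD(2)[OF hl_exp])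
  have bl: "bounded_linear (blinfun_apply (T s))" by (rule blinfun.bounded_linear_right)
  have "strongly_measurable (trunc_exp 0) (\<lambda>u. blinfun_apply (T (s + u)) x)"
    using strongly_measurable_bounded_linear[OF strongly_measurable_continuous[OF hl_exp sg_continuous_pos] bl, of x] eq
    by (subst strongly_measurable_cong) auto
  then have "vec_integral (distr (trunc_exp 0) halfline ((+) s)) (\<lambda>u. blinfun_apply (T u) x)
     = vec_integral (trunc_exp 0) (\<lambda>u. blinfun_apply (T (s + u)) x)"
    by (intro vec_integral_distr[OF fin shift_measurable[OF s] sg_continuous_pos norm_sg_apply])
  also have "\<dots> = vec_integral (trunc_exp 0) (\<lambda>u. blinfun_apply (T s) (blinfun_apply (T u) x))"
    using eq by (rule vec_integral_cong)
  also have "\<dots> = blinfun_apply (T s) (vec_integral (trunc_exp 0) (\<lambda>u. blinfun_apply (T u) x))"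
    by (rule vec_integral_bounded_linear[OF fin sg_integrable[OF hl_exp] bl])
  finally show ?thesis
    by (simp add: sg_integral_apply[OF hl] sg_integral_apply[OF hl_exp])
qed

text \<open>
  The exponential law is memoryless: conditioned to exceed \<open>s\<close>, it is the law shifted by \<open>s\<close>.
\<close>

lemma resolvent_memoryless:
  assumes s: "s > 0"
  shows "blinfun_apply resolvent x = (1 - exp (- s)) *\<^sub>R blinfun_apply (sg_integral (trunc_exp (exp (- s)))) x
     + exp (- s) *\<^sub>R blinfun_apply (T s) (blinfun_apply resolvent x)"
proof -
  let ?p = "exp (- s)" and ?Q = "distr (trunc_exp 0) halfline ((+) s)" and ?f = "\<lambda>u. blinfun_apply (T u) x"
  have p: "0 \<le> ?p" "?p \<le> 1" "?p < 1" using s by auto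
  note hp = finite_measure_halfline_trunc_exp(1)[OF p(1,2)]
  note Q = shifted_exp[OF less_imp_le[OF s]]
  have "(\<Sum>i\<in>{0,1,2::nat}. ([1, - (1 - ?p), - ?p] ! i) *\<^sub>R vec_integral ([trunc_exp 0, trunc_exp ?p, ?Q] ! i) ?f) = 0"
  proof (rule laplace_unique_vec_integral[OF _ _ _ sg_continuous_pos norm_sg_apply])
    fix t :: real assume t: "t > 0"
    have pw: "?p powr (t + 1) = exp (- s) * exp (- t * s)"
      by (simp add: powr_def exp_add[symmetric] algebra_simps)
    have "(1 - ?p) * ((1 - exp (- s) * exp (- t * s)) / ((1 - ?p) * (t + 1))) = (1 - exp (- s) * exp (- t * s)) / (t + 1)"
      using p(3) by simp
    then have "(LINT u|trunc_exp 0. exp (- t * u)) - (1 - ?p) * (LINT u|trunc_exp ?p. exp (- t * u))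
        - ?p * (LINT u|?Q. exp (- t * u)) = 0"
      unfolding trunc_exp_laplace[OF p(1,3) t] Q(2)[OF t] pw
      using trunc_exp_laplace[of 0 t] t by (simp add: diff_divide_distrib)
    then show "(\<Sum>i\<in>{0,1,2::nat}. ([1, - (1 - ?p), - ?p] ! i) *
        (LINT u|([trunc_exp 0, trunc_exp ?p, ?Q] ! i). exp (- t * u))) = 0" by (simp add: algebra_simps)
  qed (use hl_exp hp Q(1) in auto)
  moreover have "vec_integral ?Q ?f = blinfun_apply (T s) (blinfun_apply resolvent x)"
    using shifted_exp_integral[OF less_imp_le[OF s], of x] by (simp only: sg_integral_apply[OF Q(1)])
  ultimately show ?thesis
    by (simp add: sg_integral_apply[OF hl_exp, symmetric] sg_integral_apply[OF hp, symmetric] algebra_simps)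
qed

lemma sg_integral_trunc_exp_1: "blinfun_apply (sg_integral (trunc_exp 1)) x = x"
proof -
  interpret U: prob_space unit_uniform by (rule unit_uniform(1))
  have hl: "finite_measure_halfline (trunc_exp 1)" by (rule finite_measure_halfline_trunc_exp) auto
  have "vec_integral (trunc_exp 1) (\<lambda>u. blinfun_apply (T u) x)
     = vec_integral unit_uniform (\<lambda>v. blinfun_apply (T (trunc_exp_map 1 v)) x)"
    unfolding trunc_exp_def
    by (rule vec_integral_distr[OF U.finite_measure_axioms trunc_exp_map_measurable sg_continuous_pos norm_sg_apply])
       (auto simp: trunc_exp_map_def strongly_measurable_const)
  also have "\<dots> = vec_integral unit_uniform (\<lambda>v. (1::real) *\<^sub>R x)"
    by (simp add: trunc_exp_map_def sg_zero)
  also have "\<dots> = x"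
    by (subst vec_integral_scaleR_const(2)[OF U.finite_measure_axioms]) (auto simp: U.prob_space)
  finally show ?thesis by (simp add: sg_integral_apply[OF hl])
qed

lemma sg_integral_trunc_exp_tendsto:
  "((\<lambda>h. blinfun_apply (sg_integral (trunc_exp (exp (- h)))) x) \<longlongrightarrow> x) (at_right 0)"
proof (rule tendstoI)
  fix e :: real assume e: "e > 0"
  obtain d where d: "d > 0" "\<And>h. 0 \<le> h \<Longrightarrow> h < d \<Longrightarrow> norm (blinfun_apply (T h) x - x) < e / 2"
    using sg_near_zero[of "e / 2" x] e by auto
  have "dist (blinfun_apply (sg_integral (trunc_exp (exp (- h)))) x) x < e" if h: "0 < h" "h < d" for h
  proof -
    let ?p = "exp (- h)" and ?f = "\<lambda>u. blinfun_apply (T u) x"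
    have p: "0 \<le> ?p" "?p \<le> 1" using h by auto
    note hp = finite_measure_halfline_trunc_exp[OF p]
    interpret P: prob_space "trunc_exp ?p" by (rule hp(2))
    interpret U: prob_space unit_uniform by (rule unit_uniform(1))
    have c: "vec_integrable (trunc_exp ?p) (\<lambda>u. (1::real) *\<^sub>R x)" "vec_integral (trunc_exp ?p) (\<lambda>u. (1::real) *\<^sub>R x) = x"
      using vec_integral_scaleR_const[OF P.finite_measure_axioms, of "\<lambda>u. 1" x] by (auto simp: P.prob_space)
    have fi: "vec_integrable (trunc_exp ?p) ?f" by (rule sg_integrable[OF hp(1)])
    have sm: "strongly_measurable (trunc_exp ?p) (\<lambda>u. ?f u - x)"
      using fi c(1) by (auto simp: vec_integrable_def intro: strongly_measurable_diff)
    have fx: "vec_integrable (trunc_exp ?p) (\<lambda>u. ?f u - x)"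
    proof (rule vec_integrable_bounded[OF P.finite_measure_axioms sm])
      fix u assume "u \<in> space (trunc_exp ?p)"
      then have "0 \<le> u" by (simp add: halflineD(2)[OF hp(1)])
      then show "norm (?f u - x) \<le> semigroup_bound T * norm x + norm x"
        using norm_triangle_ineq4[of "?f u" x] norm_sg_apply[of u x] by linarith
    qed
    have "blinfun_apply (sg_integral (trunc_exp ?p)) x - x = vec_integral (trunc_exp ?p) (\<lambda>u. ?f u - x)"
      using vec_integral_diff[OF P.finite_measure_axioms fi c(1)] c(2) by (simp add: sg_integral_apply[OF hp(1)])
    then have "ennreal (norm (blinfun_apply (sg_integral (trunc_exp ?p)) x - x))
       \<le> (\<integral>\<^sup>+u. ennreal (norm (?f u - x)) \<partial>trunc_exp ?p)"
      using norm_vec_integral_le[OF P.finite_measure_axioms fx] by simp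
    also have "\<dots> = (\<integral>\<^sup>+v. ennreal (norm (?f (trunc_exp_map ?p v) - x)) \<partial>unit_uniform)"
      using borel_measurable_norm_strongly_measurable[OF sm] unfolding trunc_exp_def
      by (intro nn_integral_distr trunc_exp_map_measurable[OF p]) auto
    also have "\<dots> \<le> (\<integral>\<^sup>+v. ennreal (e / 2) \<partial>unit_uniform)"
    proof (intro nn_integral_mono ennreal_leI)
      fix v assume "v \<in> space unit_uniform"
      then have v: "0 \<le> v" "v < 1" by (auto simp: unit_uniform(2))
      note tp = trunc_exp_map_pos[OF p v]
      have "ln ?p \<le> ln (1 - v * (1 - ?p))" using tp(1,3) by (subst ln_le_cancel_iff) auto
      then have "trunc_exp_map ?p v \<le> h" by (simp add: trunc_exp_map_def)
      then show "norm (?f (trunc_exp_map ?p v) - x) \<le> e / 2"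
        using tp(4) h by (intro less_imp_le[OF d(2)]) auto
    qed
    also have "\<dots> = ennreal (e / 2)" by (simp add: U.emeasure_space_1)
    finally have "norm (blinfun_apply (sg_integral (trunc_exp ?p)) x - x) \<le> e / 2"
      using e by (simp add: ennreal_le_iff)
    then show ?thesis using e by (simp add: dist_norm)
  qed
  then show "\<forall>\<^sub>F h in at_right 0. dist (blinfun_apply (sg_integral (trunc_exp (exp (- h)))) x) x < e"
    unfolding eventually_at_right_field using d(1) by auto
qed

lemma generatorI:
  assumes "((\<lambda>t. (blinfun_apply (T t) x - x) /\<^sub>R t) \<longlongrightarrow> y) (at_right 0)"
  shows "generator T x = Some y"
  using assms tendsto_Lim[OF _ assms] by (auto simp: generator_def)

lemma generatorD:
  assumes "generator T x = Some y"
  shows "((\<lambda>t. (blinfun_apply (T t) x - x) /\<^sub>R t) \<longlongrightarrow> y) (at_right 0)"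
  using assms tendsto_Lim[of "at_right 0" "\<lambda>t. (blinfun_apply (T t) x - x) /\<^sub>R t"]
  by (auto simp: generator_def split: if_splits)

text \<open>
  The memoryless decomposition gives \<open>T(h)R - R = (e\<^sup>h - 1)(R - V\<^sub>h)\<close>, where \<open>V\<^sub>h\<close> averages the semigroup over a law
  concentrated on \<open>[0,h]\<close> and therefore tends strongly to the identity.
\<close>

lemma generator_resolvent: "generator T (blinfun_apply resolvent x) = Some (blinfun_apply resolvent x - x)"
proof (rule generatorI)
  let ?R = "blinfun_apply resolvent x" and ?V = "\<lambda>h. blinfun_apply (sg_integral (trunc_exp (exp (- h)))) x"
  have eq: "(blinfun_apply (T h) ?R - ?R) /\<^sub>R h = ((exp h - 1) / h) *\<^sub>R (?R - ?V h)" if h: "h > 0" for h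
  proof -
    have "exp h *\<^sub>R ?R = exp h *\<^sub>R ((1 - exp (- h)) *\<^sub>R ?V h + exp (- h) *\<^sub>R blinfun_apply (T h) ?R)"
      using resolvent_memoryless[OF h, of x] by simp
    also have "\<dots> = (exp h - 1) *\<^sub>R ?V h + blinfun_apply (T h) ?R"
      by (simp add: scaleR_add_right algebra_simps exp_minus)
    finally have "blinfun_apply (T h) ?R - ?R = (exp h - 1) *\<^sub>R (?R - ?V h)"
      by (simp add: algebra_simps)
    then show ?thesis by (simp add: divide_inverse_commute)
  qed
  have "((\<lambda>h::real. (exp h - 1) / h) \<longlongrightarrow> 1) (at_right 0)"
    using DERIV_exp[of "0::real"] unfolding has_field_derivative_iff
    by (auto intro: filterlim_at_split[THEN iffD1, THEN conjunct2] simp: filterlim_at_split)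
  then have "((\<lambda>h. ((exp h - 1) / h) *\<^sub>R (?R - ?V h)) \<longlongrightarrow> 1 *\<^sub>R (?R - x)) (at_right 0)"
    by (intro tendsto_intros sg_integral_trunc_exp_tendsto)
  moreover have "\<forall>\<^sub>F h in at_right 0. ((exp h - 1) / h) *\<^sub>R (?R - ?V h) = (blinfun_apply (T h) ?R - ?R) /\<^sub>R h"
    unfolding eventually_at_right_field using eq by (intro exI[of _ 1]) auto
  ultimately show "((\<lambda>h. (blinfun_apply (T h) ?R - ?R) /\<^sub>R h) \<longlongrightarrow> ?R - x) (at_right 0)"
    by (auto intro: Lim_transform_eventually)
qed

lemma resolvent_commute:
  assumes r: "0 \<le> r"
  shows "blinfun_apply resolvent (blinfun_apply (T r) x) = blinfun_apply (T r) (blinfun_apply resolvent x)"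
proof -
  have fin: "finite_measure (trunc_exp 0)" by (rule halflineD(1)[OF hl_exp])
  have bl: "bounded_linear (blinfun_apply (T r))" by (rule blinfun.bounded_linear_right)
  have "vec_integral (trunc_exp 0) (\<lambda>u. blinfun_apply (T u) (blinfun_apply (T r) x))
    = vec_integral (trunc_exp 0) (\<lambda>u. blinfun_apply (T r) (blinfun_apply (T u) x))"
    by (rule vec_integral_cong) (use r in \<open>simp add: halflineD(2)[OF hl_exp] sg_add[symmetric] add.commute\<close>)
  then show ?thesis
    by (simp add: sg_integral_apply[OF hl_exp] vec_integral_bounded_linear[OF fin sg_integrable[OF hl_exp] bl])
qed

lemma resolvent_generator:
  assumes "generator T y = Some w"
  shows "blinfun_apply resolvent w = blinfun_apply resolvent y - y"
proof -
  have "((\<lambda>h. blinfun_apply resolvent ((blinfun_apply (T h) y - y) /\<^sub>R h)) \<longlongrightarrow> blinfun_apply resolvent w) (at_right 0)"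
    by (rule bounded_linear.tendsto[OF blinfun.bounded_linear_right generatorD[OF assms]])
  moreover have "\<forall>\<^sub>F h in at_right 0. blinfun_apply resolvent ((blinfun_apply (T h) y - y) /\<^sub>R h)
      = (blinfun_apply (T h) (blinfun_apply resolvent y) - blinfun_apply resolvent y) /\<^sub>R h"
    unfolding eventually_at_right_field
    by (intro exI[of _ 1]) (auto simp: blinfun.scaleR_right blinfun.diff_right resolvent_commute)
  ultimately have "((\<lambda>h. (blinfun_apply (T h) (blinfun_apply resolvent y) - blinfun_apply resolvent y) /\<^sub>R h)
      \<longlongrightarrow> blinfun_apply resolvent w) (at_right 0)"
    by (rule Lim_transform_eventually)
  from tendsto_unique[OF _ this generatorD[OF generator_resolvent]] show ?thesis by simp
qed

lemma generator_commute:
  assumes "generator T y = Some w" "0 \<le> r"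
  shows "generator T (blinfun_apply (T r) y) = Some (blinfun_apply (T r) w)"
proof (rule generatorI)
  have "((\<lambda>h. blinfun_apply (T r) ((blinfun_apply (T h) y - y) /\<^sub>R h)) \<longlongrightarrow> blinfun_apply (T r) w) (at_right 0)"
    by (rule bounded_linear.tendsto[OF blinfun.bounded_linear_right generatorD[OF assms(1)]])
  moreover have "\<forall>\<^sub>F h in at_right 0. blinfun_apply (T r) ((blinfun_apply (T h) y - y) /\<^sub>R h)
      = (blinfun_apply (T h) (blinfun_apply (T r) y) - blinfun_apply (T r) y) /\<^sub>R h"
    unfolding eventually_at_right_field using assms(2)
    by (intro exI[of _ 1]) (auto simp: blinfun.scaleR_right blinfun.diff_right sg_add[symmetric] add.commute)
  ultimately show "((\<lambda>h. (blinfun_apply (T h) (blinfun_apply (T r) y) - blinfun_apply (T r) y) /\<^sub>R h)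
      \<longlongrightarrow> blinfun_apply (T r) w) (at_right 0)"
    by (rule Lim_transform_eventually)
qed

text \<open>
  Split \<open>[0,s]\<close> into \<open>n\<close> steps of length \<open>h\<close>; each step contributes \<open>h T(kh) w\<close> up to \<open>o(h)\<close>. Bounding the orbit of
  \<open>w\<close> rather than \<open>w\<close> keeps the constant free of the semigroup bound.
\<close>

lemma generator_lipschitz:
  assumes gen: "generator T y = Some w" and s: "s > 0"
    and K: "\<And>r. 0 \<le> r \<Longrightarrow> norm (blinfun_apply (T r) w) \<le> K"
  shows "norm (blinfun_apply (T s) y - y) \<le> s * K"
proof -
  let ?h = "\<lambda>n. s / real (Suc n)" and ?M = "semigroup_bound T"
  let ?e = "\<lambda>h. (blinfun_apply (T h) y - y) /\<^sub>R h - w"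
  have "filterlim ?h (at_right 0) sequentially"
  proof -
    have "(\<lambda>n. s * (1 / real (Suc n))) \<longlonglongrightarrow> s * 0"
      using LIMSEQ_inverse_real_of_nat by (intro tendsto_mult tendsto_const) (simp add: inverse_eq_divide)
    then show ?thesis using s by (simp add: filterlim_at)
  qed
  from filterlim_compose[OF generatorD[OF gen] this]
  have "(\<lambda>n. (blinfun_apply (T (?h n)) y - y) /\<^sub>R ?h n - w) \<longlonglongrightarrow> w - w" by (intro tendsto_diff tendsto_const)
  then have "(\<lambda>n. s * K + s * (?M * norm (?e (?h n)))) \<longlonglongrightarrow> s * K + s * (?M * norm (w - w))"
    by (rule tendsto_add[OF tendsto_const tendsto_mult[OF tendsto_const tendsto_mult[OF tendsto_const tendsto_norm]]])
  moreover have "norm (blinfun_apply (T s) y - y) \<le> s * K + s * (?M * norm (?e (?h n)))" for n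
  proof -
    let ?g = "?h n"
    have h: "?g > 0" using s by simp
    have hs: "real (Suc n) * ?g = s" using s by simp
    have "blinfun_apply (T s) y - y = blinfun_apply (T (real (Suc n) * ?g)) y - blinfun_apply (T (real 0 * ?g)) y"
      by (simp only: hs) (simp add: sg_zero)
    also have "\<dots> = (\<Sum>k<Suc n. blinfun_apply (T (real (Suc k) * ?g)) y - blinfun_apply (T (real k * ?g)) y)"
      by (rule sum_lessThan_telescope[symmetric])
    also have "\<dots> = (\<Sum>k<Suc n. ?g *\<^sub>R (blinfun_apply (T (real k * ?g)) w + blinfun_apply (T (real k * ?g)) (?e ?g)))"
    proof (rule sum.cong[OF refl])
      fix k
      have "real (Suc k) * ?g = real k * ?g + ?g" 
      proof -
        have "real (Suc k) * g = real k * g + g" for g by (simp add: algebra_simps)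
        then show ?thesis .
      qed
      moreover have "0 \<le> real k * ?g" using h by (intro mult_nonneg_nonneg) auto
      ultimately have "blinfun_apply (T (real (Suc k) * ?g)) y = blinfun_apply (T (real k * ?g)) (blinfun_apply (T ?g) y)"
        using h sg_add[of "real k * ?g" ?g y] by (simp del: of_nat_Suc)
      moreover have "blinfun_apply (T ?g) y - y = ?g *\<^sub>R (w + ?e ?g)"
        using s by (simp add: scaleR_right_diff_distrib)
      ultimately show "blinfun_apply (T (real (Suc k) * ?g)) y - blinfun_apply (T (real k * ?g)) y
         = ?g *\<^sub>R (blinfun_apply (T (real k * ?g)) w + blinfun_apply (T (real k * ?g)) (?e ?g))"
        by (simp only: blinfun.diff_right[symmetric] blinfun.add_right[symmetric] blinfun.scaleR_right[symmetric])
    qed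
    finally have "norm (blinfun_apply (T s) y - y) \<le> (\<Sum>k<Suc n. ?g * (K + ?M * norm (?e ?g)))"
    proof (simp only:, intro order_trans[OF norm_sum] sum_mono)
      fix k
      have k0: "0 \<le> real k * ?g" using h by (intro mult_nonneg_nonneg) auto
      have "norm (blinfun_apply (T (real k * ?g)) w + blinfun_apply (T (real k * ?g)) (?e ?g)) \<le> K + ?M * norm (?e ?g)"
        by (rule norm_triangle_mono[OF K[OF k0] norm_sg_apply[OF k0]])
      then show "norm (?g *\<^sub>R (blinfun_apply (T (real k * ?g)) w + blinfun_apply (T (real k * ?g)) (?e ?g)))
         \<le> ?g * (K + ?M * norm (?e ?g))"
        using h by (simp only: norm_scaleR abs_of_pos mult_left_mono less_imp_le)
    qed
    also have "\<dots> = (real (Suc n) * ?g) * (K + ?M * norm (?e ?g))"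
      by (simp only: sum_constant card_lessThan mult.assoc)
    also have "\<dots> = s * K + s * (?M * norm (?e ?g))" unfolding hs by (rule distrib_left)
    finally show ?thesis .
  qed
  ultimately have "norm (blinfun_apply (T s) y - y) \<le> s * K + s * (?M * norm (w - w))"
    by (intro LIMSEQ_le_const) auto
  then show ?thesis by simp
qed

end

section \<open>Laplace averages of the Levy density\<close>

text \<open>
  Equals \<open>levy_density s / (\<tau> + s)\<close> and is infinite at \<open>\<tau> = s = 0\<close>. The integral form makes the exchange of the order
  of integration immediate.
\<close>

definition exp_kernel :: "real \<Rightarrow> real \<Rightarrow> ennreal" where
  "exp_kernel \<tau> s = (\<integral>\<^sup>+ r\<in>{0<..}. ennreal (exp (- (\<tau> * r)) * (exp (- (s * r)) * levy_density s)) \<partial>lborel)"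

lemma nn_integral_exp_halfline:
  assumes "0 < l" shows "(\<integral>\<^sup>+ r\<in>{0<..}. ennreal (exp (- (l * r))) \<partial>lborel) = ennreal (1 / l)"
proof -
  interpret prob_space "density lborel (exponential_density l)"
    by (rule prob_space_exponential_density[OF assms])
  have "1 = emeasure (density lborel (exponential_density l)) UNIV"
    using emeasure_space_1 by simp
  also have "\<dots> = (\<integral>\<^sup>+ r. ennreal (exponential_density l r) \<partial>lborel)"
    by (subst emeasure_density) auto
  also have "\<dots> = (\<integral>\<^sup>+ r. ennreal l * (ennreal (exp (- (l * r))) * indicator {0<..} r) \<partial>lborel)"
  proof (rule nn_integral_cong_AE)
    show "AE r in lborel. ennreal (exponential_density l r) = ennreal l * (ennreal (exp (- (l * r))) * indicator {0<..} r)"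
      using AE_lborel_singleton[of 0]
      by eventually_elim (use assms in \<open>auto simp: exponential_density_def ennreal_mult mult.commute indicator_def\<close>)
  qed
  also have "\<dots> = ennreal l * (\<integral>\<^sup>+ r\<in>{0<..}. ennreal (exp (- (l * r))) \<partial>lborel)"
    by (rule nn_integral_cmult) measurable
  finally have "ennreal (1 / l) * 1 = ennreal (1 / l) * (ennreal l * (\<integral>\<^sup>+ r\<in>{0<..}. ennreal (exp (- (l * r))) \<partial>lborel))"
    by simp
  also have "\<dots> = (\<integral>\<^sup>+ r\<in>{0<..}. ennreal (exp (- (l * r))) \<partial>lborel)"
    using assms by (simp add: mult.assoc[symmetric] ennreal_mult[symmetric])
  finally show ?thesis by simp
qed

lemma exp_kernel_eq:
  assumes "0 \<le> \<tau>" "0 \<le> s" "0 < \<tau> + s"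
  shows "exp_kernel \<tau> s = ennreal (levy_density s / (\<tau> + s))"
proof -
  have "exp_kernel \<tau> s = (\<integral>\<^sup>+ r. ennreal (levy_density s) * (ennreal (exp (- ((\<tau> + s) * r))) * indicator {0<..} r) \<partial>lborel)"
    unfolding exp_kernel_def
    by (intro nn_integral_cong)
       (auto simp: indicator_def ennreal_mult[symmetric] levy_density_nonneg[OF assms(2)] exp_add[symmetric] algebra_simps)
  also have "\<dots> = ennreal (levy_density s) * ennreal (1 / (\<tau> + s))"
    using nn_integral_exp_halfline[OF assms(3)] by (subst nn_integral_cmult) auto
  also have "\<dots> = ennreal (levy_density s / (\<tau> + s))"
    using levy_density_nonneg[OF assms(2)] assms(3) by (simp add: ennreal_mult[symmetric])
  finally show ?thesis .
qed

lemma exp_kernel_0_0: "exp_kernel 0 0 = \<infinity>"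
proof -
  have "exp_kernel 0 0 = (\<integral>\<^sup>+ r. indicator {0<..} r \<partial>(lborel :: real measure))"
    unfolding exp_kernel_def by (intro nn_integral_cong) (simp add: levy_density_def)
  also have "\<dots> = emeasure lborel {0::real<..}" by simp
  also have "\<dots> = \<infinity>"
  proof (rule ccontr)
    assume "emeasure lborel {0::real<..} \<noteq> \<infinity>"
    then obtain c where c: "0 \<le> c" "emeasure lborel {0::real<..} = ennreal c"
      by (cases "emeasure lborel {0::real<..}") auto
    have "ennreal (c + 1) = emeasure lborel {0<..<c + 1}" using c(1) by simp
    also have "\<dots> \<le> emeasure lborel {0::real<..}" by (rule emeasure_mono) auto
    finally show False using c by (simp add: ennreal_le_iff)
  qed
  finally show ?thesis .
qed

lemma levy_density_le: "0 \<le> s \<Longrightarrow> levy_density s \<le> 1 + s"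
proof (cases "s = 0")
  case False
  assume "0 \<le> s"
  then have s: "s > 0" using False by simp
  have "(1 + s) * exp (- s) \<le> exp s * exp (- s)"
    by (rule mult_right_mono[OF exp_ge_add_one_self]) simp
  then have "s \<le> (1 + s) * (1 - exp (- s))" by (simp add: exp_minus_inverse algebra_simps exp_add[symmetric])
  then show ?thesis using s by (simp add: levy_density_def divide_le_eq)
qed (simp add: levy_density_def)

lemma exp_kernel_le:
  assumes "0 < \<tau>" "0 \<le> s" shows "exp_kernel \<tau> s \<le> ennreal (max 1 (1 / \<tau>))"
proof -
  have "levy_density s \<le> max 1 (1 / \<tau>) * (\<tau> + s)"
  proof -
    have "1 \<le> max 1 (1 / \<tau>) * \<tau>"
      using mult_right_mono[of "1 / \<tau>" "max 1 (1 / \<tau>)" \<tau>] assms by simp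
    moreover have "s \<le> max 1 (1 / \<tau>) * s"
      using mult_right_mono[of 1 "max 1 (1 / \<tau>)" s] assms by simp
    ultimately show ?thesis using levy_density_le[OF assms(2)] by (simp only: distrib_left)
  qed
  then show ?thesis using assms by (subst exp_kernel_eq) (auto intro!: ennreal_leI simp: divide_le_eq)
qed

text \<open>
  Product measurability is simpler for measures on the Borel sets of the whole line.
\<close>

lemma halfline_borel_extension:
  assumes "finite_measure_halfline \<mu>"
  shows "finite_measure (distr \<mu> borel (\<lambda>x. x))"
    "f \<in> borel_measurable borel \<Longrightarrow> (\<integral>\<^sup>+x. f x \<partial>\<mu>) = (\<integral>\<^sup>+x. f x \<partial>distr \<mu> borel (\<lambda>x. x))"
proof -
  have m: "(\<lambda>x. x) \<in> measurable \<mu> borel" by (rule halfline_measurable[OF assms]) simp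
  show "finite_measure (distr \<mu> borel (\<lambda>x. x))"
    by (rule finite_measure.finite_measure_distr[OF halflineD(1)[OF assms] m])
  show "f \<in> borel_measurable borel \<Longrightarrow> (\<integral>\<^sup>+x. f x \<partial>\<mu>) = (\<integral>\<^sup>+x. f x \<partial>distr \<mu> borel (\<lambda>x. x))"
    by (rule nn_integral_distr[OF m, symmetric]) simp
qed

lemma exp_kernel_measurable [measurable]: "(\<lambda>p. exp_kernel (fst p) (snd p)) \<in> borel_measurable (borel \<Otimes>\<^sub>M borel)"
  unfolding exp_kernel_def by measurable

lemma exp_kernel_integral_measurable:
  assumes "finite_measure_halfline \<rho>"
  shows "(\<lambda>\<tau>. \<integral>\<^sup>+s. exp_kernel \<tau> s \<partial>\<rho>) \<in> borel_measurable borel"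
proof -
  interpret finite_measure "distr \<rho> borel (\<lambda>x. x)" by (rule halfline_borel_extension(1)[OF assms])
  have m: "(\<lambda>s. exp_kernel \<tau> s) \<in> borel_measurable borel" for \<tau>
    using measurable_Pair2[OF exp_kernel_measurable, of \<tau>] by simp
  have "(\<lambda>\<tau>. \<integral>\<^sup>+s. exp_kernel \<tau> s \<partial>distr \<rho> borel (\<lambda>x. x)) \<in> borel_measurable borel"
    using exp_kernel_measurable by (intro borel_measurable_nn_integral) (simp add: case_prod_unfold cong: measurable_cong_sets)
  then show ?thesis by (simp add: halfline_borel_extension(2)[OF assms m])
qed

lemma exp_kernel_integral_le:
  assumes psi: "psi \<in> BF" and \<rho>: "finite_measure_halfline \<rho>"
    and rep: "\<And>z. z > 0 \<Longrightarrow> psi z = a + (LINT s|\<rho>. levy_kernel s z)"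
  shows "(\<integral>\<^sup>+s. exp_kernel \<tau> s \<partial>\<rho>) \<le> (\<integral>\<^sup>+ r\<in>{0<..}. ennreal (exp (- (\<tau> * r)) * deriv psi r) \<partial>lborel)"
proof -
  let ?\<rho> = "distr \<rho> borel (\<lambda>x. x)"
  interpret \<rho>: finite_measure ?\<rho> by (rule halfline_borel_extension(1)[OF \<rho>])
  interpret pair_sigma_finite ?\<rho> lborel ..
  let ?k = "\<lambda>s r. ennreal (exp (- (\<tau> * r)) * (exp (- (s * r)) * levy_density s)) * indicator {0<..} r"
  have m: "(\<lambda>s. exp_kernel \<tau> s) \<in> borel_measurable borel"
    using measurable_Pair2[OF exp_kernel_measurable, of \<tau>] by simp
  have km: "(\<lambda>(s, r). ?k s r) \<in> borel_measurable (?\<rho> \<Otimes>\<^sub>M lborel)" by measurable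
  have "(\<integral>\<^sup>+s. exp_kernel \<tau> s \<partial>\<rho>) = (\<integral>\<^sup>+s. (\<integral>\<^sup>+r. ?k s r \<partial>lborel) \<partial>?\<rho>)"
    unfolding halfline_borel_extension(2)[OF \<rho> m] by (simp only: exp_kernel_def[abs_def])
  also have "\<dots> = (\<integral>\<^sup>+r. (\<integral>\<^sup>+s. ?k s r \<partial>?\<rho>) \<partial>lborel)"
    by (rule Fubini'[OF km, symmetric])
  also have "\<dots> \<le> (\<integral>\<^sup>+r. ennreal (exp (- (\<tau> * r)) * deriv psi r) * indicator {0<..} r \<partial>lborel)"
  proof (rule nn_integral_mono)
    fix r :: real
    show "(\<integral>\<^sup>+s. ?k s r \<partial>?\<rho>) \<le> ennreal (exp (- (\<tau> * r)) * deriv psi r) * indicator {0<..} r"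
    proof (cases "r > 0")
      case True
      have "(\<integral>\<^sup>+s. ?k s r \<partial>?\<rho>) = (\<integral>\<^sup>+s. ?k s r \<partial>\<rho>)"
        by (rule halfline_borel_extension(2)[OF \<rho>, symmetric]) measurable
      also have "\<dots> = (\<integral>\<^sup>+s. ennreal (exp (- (\<tau> * r))) * ennreal (exp (- (s * r)) * levy_density s) \<partial>\<rho>)"
        using True by (intro nn_integral_cong) (simp add: halflineD(2)[OF \<rho>] ennreal_mult levy_density_nonneg)
      also have "\<dots> = ennreal (exp (- (\<tau> * r))) * (\<integral>\<^sup>+s. ennreal (exp (- (s * r)) * levy_density s) \<partial>\<rho>)"
        by (rule nn_integral_cmult, rule halfline_measurable[OF \<rho>]) measurable
      also have "\<dots> \<le> ennreal (exp (- (\<tau> * r))) * ennreal (deriv psi r)"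
        by (rule mult_left_mono[OF BF_deriv_ge[OF psi \<rho> rep True]]) simp_all
      finally show ?thesis using True BF_deriv(2)[OF psi True] by (simp add: ennreal_mult)
    qed simp
  qed
  finally show ?thesis .
qed

text \<open>
  Tonelli's theorem: \<open>\<integral> e\<^sup>-\<^sup>t\<^sup>r \<mu>(dt) = g(r)\<close>.
\<close>

lemma exp_kernel_double_integral_le:
  assumes psi: "psi \<in> BF" and \<rho>: "finite_measure_halfline \<rho>"
    and rep: "\<And>z. z > 0 \<Longrightarrow> psi z = a + (LINT s|\<rho>. levy_kernel s z)"
    and \<mu>: "finite_measure_halfline \<mu>" and g: "\<And>t. t > 0 \<Longrightarrow> g t = (LINT s|\<mu>. exp (- t * s))"
  shows "(\<integral>\<^sup>+t. (\<integral>\<^sup>+s. exp_kernel t s \<partial>\<rho>) \<partial>\<mu>) \<le> J_functional g psi"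
proof -
  let ?\<mu> = "distr \<mu> borel (\<lambda>x. x)"
  interpret \<mu>: finite_measure ?\<mu> by (rule halfline_borel_extension(1)[OF \<mu>])
  interpret pair_sigma_finite ?\<mu> lborel ..
  define d where "d r = deriv psi r * indicator {0<..} r" for r
  have dm: "d \<in> borel_measurable borel"
  proof -
    have "(\<lambda>r. indicator {0<..} r *\<^sub>R deriv psi r) \<in> borel_measurable borel"
      using borel_measurable_continuous_on_indicator[OF _ BF_continuous_on_deriv[OF psi]] by simp
    then show ?thesis by (simp add: d_def[abs_def] mult.commute)
  qed
  have d0: "0 \<le> d r" for r using BF_deriv(2)[OF psi] by (simp add: d_def indicator_def)
  let ?k = "\<lambda>t r. ennreal (exp (- (t * r)) * d r)"
  have km: "(\<lambda>(t, r). ?k t r) \<in> borel_measurable (?\<mu> \<Otimes>\<^sub>M lborel)" using dm by measurable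
  have "(\<integral>\<^sup>+t. (\<integral>\<^sup>+s. exp_kernel t s \<partial>\<rho>) \<partial>\<mu>) \<le> (\<integral>\<^sup>+t. (\<integral>\<^sup>+r. ?k t r \<partial>lborel) \<partial>\<mu>)"
  proof (rule nn_integral_mono)
    fix t
    have "(\<integral>\<^sup>+s. exp_kernel t s \<partial>\<rho>) \<le> (\<integral>\<^sup>+ r\<in>{0<..}. ennreal (exp (- (t * r)) * deriv psi r) \<partial>lborel)"
      by (rule exp_kernel_integral_le[OF psi \<rho> rep])
    also have "\<dots> = (\<integral>\<^sup>+r. ?k t r \<partial>lborel)"
      by (intro nn_integral_cong) (simp add: d_def indicator_def)
    finally show "(\<integral>\<^sup>+s. exp_kernel t s \<partial>\<rho>) \<le> (\<integral>\<^sup>+r. ?k t r \<partial>lborel)" .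
  qed
  also have "\<dots> = (\<integral>\<^sup>+t. (\<integral>\<^sup>+r. ?k t r \<partial>lborel) \<partial>?\<mu>)"
    by (rule halfline_borel_extension(2)[OF \<mu>]) (use dm in measurable)
  also have "\<dots> = (\<integral>\<^sup>+r. (\<integral>\<^sup>+t. ?k t r \<partial>?\<mu>) \<partial>lborel)"
    by (rule Fubini'[OF km, symmetric])
  also have "\<dots> = (\<integral>\<^sup>+r. ennreal (g r * deriv psi r) * indicator {0<..} r \<partial>lborel)"
  proof (rule nn_integral_cong)
    fix r :: real
    show "(\<integral>\<^sup>+t. ?k t r \<partial>?\<mu>) = ennreal (g r * deriv psi r) * indicator {0<..} r"
    proof (cases "r > 0")
      case True
      have "(\<integral>\<^sup>+t. ?k t r \<partial>?\<mu>) = (\<integral>\<^sup>+t. ?k t r \<partial>\<mu>)"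
        by (rule halfline_borel_extension(2)[OF \<mu>, symmetric]) measurable
      also have "\<dots> = (\<integral>\<^sup>+t. ennreal (exp (- r * t)) * ennreal (d r) \<partial>\<mu>)"
        using d0 by (intro nn_integral_cong) (simp add: ennreal_mult mult.commute)
      also have "\<dots> = (\<integral>\<^sup>+t. ennreal (exp (- r * t)) \<partial>\<mu>) * ennreal (d r)"
        by (rule nn_integral_multc, rule halfline_measurable[OF \<mu>]) measurable
      also have "(\<integral>\<^sup>+t. ennreal (exp (- r * t)) \<partial>\<mu>) = ennreal (LINT t|\<mu>. exp (- r * t))"
        using True by (intro nn_integral_eq_integral halfline_integrable_bounded[OF \<mu>, where B = 1])
          (auto simp: mult_nonneg_nonneg)
      also have "(LINT t|\<mu>. exp (- r * t)) = g r" by (rule g[OF True, symmetric])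
      finally show ?thesis
        using True d0[of r] g[OF True] by (simp add: ennreal_mult' d_def mult.commute)
    qed (simp add: d_def)
  qed
  also have "\<dots> = J_functional g psi" by (simp add: J_functional_def)
  finally show ?thesis .
qed

text \<open>
  The saturating bound \<open>min(2M, s c\<^sub>0 + s c\<^sub>1/t)\<close> is compared with \<open>x/(1+x)\<close> for \<open>x = s/t\<close> and for \<open>x = c\<^sub>0 s\<close>: the latter is
  at least \<open>1/2\<close> when \<open>x \<ge> 1\<close> and at least \<open>x/2\<close> otherwise.
\<close>

lemma increment_bound_split:
  fixes n M c0 c1 s t :: real
  assumes M: "1 \<le> M" and c0: "0 \<le> c0" and c1: "0 < c1" and s: "0 < s" and t: "0 < t"
    and n1: "n \<le> 2 * M" and n2: "n \<le> s * (c0 + c1 / t)"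
  shows "n \<le> 2 * max (2 * M) c1 * (s / (t + s)) + 4 * M * (c0 * s / (1 + c0 * s))"
proof -
  let ?m = "max (2 * M) c1"
  have A0: "0 \<le> 2 * ?m * (s / (t + s))" using M s t by (intro mult_nonneg_nonneg) auto
  have B0: "0 \<le> 4 * M * (c0 * s / (1 + c0 * s))" using M c0 s by (intro mult_nonneg_nonneg divide_nonneg_nonneg) auto
  show ?thesis
  proof (cases "s \<ge> t")
    case True
    then have "1 / 2 \<le> s / (t + s)" using s t by (simp add: le_divide_eq)
    then have "2 * ?m * (1 / 2) \<le> 2 * ?m * (s / (t + s))" using M by (intro mult_left_mono) auto
    then show ?thesis using B0 n1 by linarith
  next
    case False
    have "s / (2 * t) \<le> s / (t + s)" using s t False by (intro divide_left_mono) auto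
    then have "2 * ?m * (s / (2 * t)) \<le> 2 * ?m * (s / (t + s))" using M by (intro mult_left_mono) auto
    moreover have "c1 * (s / t) \<le> ?m * (s / t)" using s t by (intro mult_right_mono) auto
    ultimately have 1: "c1 * (s / t) \<le> 2 * ?m * (s / (t + s))" by simp
    show ?thesis
    proof (cases "c0 * s \<ge> 1")
      case True
      then have "1 / 2 \<le> c0 * s / (1 + c0 * s)" by (simp add: le_divide_eq)
      then have "4 * M * (1 / 2) \<le> 4 * M * (c0 * s / (1 + c0 * s))" using M by (intro mult_left_mono) auto
      then show ?thesis using A0 n1 by linarith
    next
      case False
      have cs: "0 \<le> c0 * s" using c0 s by simp
      have "c0 * s / 2 \<le> c0 * s / (1 + c0 * s)" using cs False by (intro divide_left_mono) auto
      then have "4 * M * (c0 * s / 2) \<le> 4 * M * (c0 * s / (1 + c0 * s))" using M by (intro mult_left_mono) auto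
      moreover have "1 * (c0 * s) \<le> 4 * M * (c0 * s / 2)" using cs M mult_right_mono[of 1 "2 * M" "c0 * s"] by simp
      ultimately show ?thesis using 1 n2 by (simp add: algebra_simps)
    qed
  qed
qed

section \<open>The regularised operator as an average over the Levy measure\<close>

lemma halfline_pair_measurable:
  assumes "finite_measure_halfline \<rho>" "f \<in> borel_measurable (borel \<Otimes>\<^sub>M borel)"
    and "sets N = sets (restrict_space borel S)"
    and "\<And>p. p \<in> space (\<rho> \<Otimes>\<^sub>M N) \<Longrightarrow> 0 \<le> f p"
  shows "f \<in> measurable (\<rho> \<Otimes>\<^sub>M N) halfline"
proof (rule measurable_restrict_space2)
  show "f \<in> space (\<rho> \<Otimes>\<^sub>M N) \<rightarrow> {0..}" using assms(4) by auto
  have "(\<lambda>x. x) \<in> measurable \<rho> borel" by (rule halfline_measurable[OF assms(1)]) simp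
  then have 1: "fst \<in> measurable (\<rho> \<Otimes>\<^sub>M N) borel" by (rule measurable_compose[OF measurable_fst])
  have "(\<lambda>x. x) \<in> measurable N borel"
    by (simp add: measurable_cong_sets[OF assms(3) refl] measurable_restrict_space1)
  then have 2: "snd \<in> measurable (\<rho> \<Otimes>\<^sub>M N) borel" by (rule measurable_compose[OF measurable_snd])
  have "(\<lambda>p. f (fst p, snd p)) \<in> borel_measurable (\<rho> \<Otimes>\<^sub>M N)"
    by (rule measurable_compose[OF measurable_Pair[OF 1 2] assms(2)])
  then show "f \<in> borel_measurable (\<rho> \<Otimes>\<^sub>M N)" by simp
qed

text \<open>
  The function \<open>levy_kernel s z / (1 + z)\<close> is the difference of the Laplace transforms of two probability laws: the
  exponential law conditioned to \<open>[0,s]\<close> and the exponential law shifted by \<open>s\<close>. Averaging them over \<open>\<rho>\<close> yields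
  two finite measures, of which this is the positive one.
\<close>

definition levy_plus :: "real measure \<Rightarrow> real measure" where
  "levy_plus \<rho> = distr (\<rho> \<Otimes>\<^sub>M unit_uniform) halfline (\<lambda>(s, v). trunc_exp_map (exp (- s)) v)"

text \<open>
  The negative part of the signed measure described above.
\<close>

definition levy_minus :: "real measure \<Rightarrow> real measure" where
  "levy_minus \<rho> = distr (\<rho> \<Otimes>\<^sub>M trunc_exp 0) halfline (\<lambda>(s, u). s + u)"

context
  fixes \<rho> :: "real measure"
  assumes \<rho>: "finite_measure_halfline \<rho>"
begin

lemma levy_plus:
  fixes f :: "real \<Rightarrow> 'a::banach"
  assumes f: "continuous_on {0<..} f" and B: "\<And>s. 0 \<le> s \<Longrightarrow> norm (f s) \<le> B"
    and sm: "strongly_measurable \<rho> (\<lambda>s. vec_integral (trunc_exp (exp (- s))) f)"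
  shows "finite_measure_halfline (levy_plus \<rho>)"
    and "vec_integral (levy_plus \<rho>) f = vec_integral \<rho> (\<lambda>s. vec_integral (trunc_exp (exp (- s))) f)"
proof -
  have m: "(\<lambda>(s, v). trunc_exp_map (exp (- s)) v) \<in> measurable (\<rho> \<Otimes>\<^sub>M unit_uniform) halfline"
  proof (rule halfline_pair_measurable[OF \<rho> _ unit_uniform(3)])
    show "(\<lambda>(s, v). trunc_exp_map (exp (- s)) v) \<in> borel_measurable (borel \<Otimes>\<^sub>M borel)"
      unfolding trunc_exp_map_def by measurable
    show "0 \<le> (case p of (s, v) \<Rightarrow> trunc_exp_map (exp (- s)) v)" if "p \<in> space (\<rho> \<Otimes>\<^sub>M unit_uniform)" for p
      using that by (auto simp: space_pair_measure halflineD(2)[OF \<rho>] unit_uniform(2) intro: trunc_exp_map_pos(4))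
  qed
  from vec_integral_distr_pair[OF halflineD(1)[OF \<rho>] unit_uniform(1) m f B sm[unfolded trunc_exp_def]]
  show "finite_measure_halfline (levy_plus \<rho>)"
    and "vec_integral (levy_plus \<rho>) f = vec_integral \<rho> (\<lambda>s. vec_integral (trunc_exp (exp (- s))) f)"
    by (simp_all add: levy_plus_def trunc_exp_def)
qed

lemma levy_minus:
  fixes f :: "real \<Rightarrow> 'a::banach"
  assumes f: "continuous_on {0<..} f" and B: "\<And>s. 0 \<le> s \<Longrightarrow> norm (f s) \<le> B"
    and sm: "strongly_measurable \<rho> (\<lambda>s. vec_integral (distr (trunc_exp 0) halfline ((+) s)) f)"
  shows "finite_measure_halfline (levy_minus \<rho>)"
    and "vec_integral (levy_minus \<rho>) f = vec_integral \<rho> (\<lambda>s. vec_integral (distr (trunc_exp 0) halfline ((+) s)) f)"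
proof -
  have m: "(\<lambda>(s, u). s + u) \<in> measurable (\<rho> \<Otimes>\<^sub>M trunc_exp 0) halfline"
  proof (rule halfline_pair_measurable[OF \<rho>])
    show "sets (trunc_exp 0) = sets halfline" by (rule halflineD(3)[OF hl_exp])
    show "0 \<le> (case p of (s, u) \<Rightarrow> s + u)" if "p \<in> space (\<rho> \<Otimes>\<^sub>M trunc_exp 0)" for p
      using that by (auto simp: space_pair_measure halflineD(2)[OF \<rho>] halflineD(2)[OF hl_exp])
  qed measurable
  have pr: "prob_space (trunc_exp 0)" by (rule finite_measure_halfline_trunc_exp) auto
  from vec_integral_distr_pair[OF halflineD(1)[OF \<rho>] pr m f B sm]
  show "finite_measure_halfline (levy_minus \<rho>)"
    and "vec_integral (levy_minus \<rho>) f = vec_integral \<rho> (\<lambda>s. vec_integral (distr (trunc_exp 0) halfline ((+) s)) f)"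
    by (simp_all add: levy_minus_def)
qed

lemma levy_laplace:
  assumes t: "t > 0"
  shows "(LINT u|levy_plus \<rho>. exp (- t * u)) - (LINT u|levy_minus \<rho>. exp (- t * u))
    = (LINT s|\<rho>. levy_kernel s t) / (t + 1)"
    and "finite_measure_halfline (levy_plus \<rho>)" "finite_measure_halfline (levy_minus \<rho>)"
proof -
  let ?f = "\<lambda>u. exp (- t * u)"
  have p: "0 \<le> exp (- s)" "exp (- s) \<le> 1" if "0 \<le> s" for s :: real using that by auto
  have hp: "finite_measure_halfline (trunc_exp (exp (- s)))" if "0 \<le> s" for s
    by (rule finite_measure_halfline_trunc_exp(1)[OF p[OF that]])
  have Kp: "vec_integral (trunc_exp (exp (- s))) ?f = levy_kernel s (t + 1) / (t + 1)" if s: "0 \<le> s" for s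
  proof (cases "s = 0")
    case True
    then show ?thesis
      using laplace_as_vec_integral(1)[OF hp[OF s] t] trunc_exp_1_laplace[of t] t by (simp add: levy_kernel_def)
  next
    case False
    then have "exp (- s) < 1" using s by simp
    moreover have "exp (- s) powr (t + 1) = exp (- (s * (t + 1)))" by (simp add: powr_def algebra_simps)
    ultimately show ?thesis
      using laplace_as_vec_integral(1)[OF hp[OF s] t] trunc_exp_laplace[OF p(1)[OF s] _ t] False
      by (simp add: levy_kernel_def)
  qed
  have hq: "finite_measure_halfline (distr (trunc_exp 0) halfline ((+) s))" if "0 \<le> s" for s
    by (rule shifted_exp(1)[OF that])
  have Kq: "vec_integral (distr (trunc_exp 0) halfline ((+) s)) ?f = exp (- t * s) / (t + 1)" if s: "0 \<le> s" for s
    using laplace_as_vec_integral(1)[OF hq[OF s] t] shifted_exp(2)[OF s t] by simp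
  note ft = laplace_as_vec_integral(2,3)[OF \<rho> t]
  obtain n where n: "t + 1 \<le> real n" using real_arch_simple by blast
  have ip: "integrable \<rho> (\<lambda>s. levy_kernel s (t + 1) / (t + 1))"
  proof -
    have "integrable \<rho> (\<lambda>s. levy_kernel s (t + 1))"
      using levy_kernel_bound[of _ "t + 1" n] n t by (intro halfline_integrable_bounded[OF \<rho>, of _ "real n"]) auto
    then show ?thesis by simp
  qed
  have iq: "integrable \<rho> (\<lambda>s. exp (- t * s) / (t + 1))"
  proof -
    have "integrable \<rho> (\<lambda>s. exp (- t * s))"
      using t by (intro halfline_integrable_bounded[OF \<rho>, of _ 1]) auto
    then show ?thesis by simp
  qed
  have smp: "strongly_measurable \<rho> (\<lambda>s. vec_integral (trunc_exp (exp (- s))) ?f)"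
    using strongly_measurable_real[OF borel_measurable_integrable[OF ip]] Kp
    by (subst strongly_measurable_cong) (auto simp: halflineD(2)[OF \<rho>])
  have smq: "strongly_measurable \<rho> (\<lambda>s. vec_integral (distr (trunc_exp 0) halfline ((+) s)) ?f)"
    using strongly_measurable_real[OF borel_measurable_integrable[OF iq]] Kq
    by (subst strongly_measurable_cong) (auto simp: halflineD(2)[OF \<rho>])
  have P: "finite_measure_halfline (levy_plus \<rho>)"
    "vec_integral (levy_plus \<rho>) ?f = vec_integral \<rho> (\<lambda>s. vec_integral (trunc_exp (exp (- s))) ?f)"
    by (rule levy_plus(1)[OF ft smp], assumption, rule levy_plus(2)[OF ft smp], assumption)
  have Q: "finite_measure_halfline (levy_minus \<rho>)"
    "vec_integral (levy_minus \<rho>) ?f = vec_integral \<rho> (\<lambda>s. vec_integral (distr (trunc_exp 0) halfline ((+) s)) ?f)"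
    by (rule levy_minus(1)[OF ft smq], assumption, rule levy_minus(2)[OF ft smq], assumption)
  show "finite_measure_halfline (levy_plus \<rho>)" by (rule P(1))
  show "finite_measure_halfline (levy_minus \<rho>)" by (rule Q(1))
  have "(LINT u|levy_plus \<rho>. ?f u) = vec_integral \<rho> (\<lambda>s. levy_kernel s (t + 1) / (t + 1))"
    unfolding laplace_as_vec_integral(1)[OF P(1) t, symmetric] P(2)
    by (rule vec_integral_cong) (use Kp in \<open>simp add: halflineD(2)[OF \<rho>]\<close>)
  also have "\<dots> = (LINT s|\<rho>. levy_kernel s (t + 1) / (t + 1))"
    by (rule vec_integral_real(2)[OF halflineD(1)[OF \<rho>] ip])
  finally have 1: "(LINT u|levy_plus \<rho>. ?f u) = (LINT s|\<rho>. levy_kernel s (t + 1) / (t + 1))" .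
  have "(LINT u|levy_minus \<rho>. ?f u) = vec_integral \<rho> (\<lambda>s. exp (- t * s) / (t + 1))"
    unfolding laplace_as_vec_integral(1)[OF Q(1) t, symmetric] Q(2)
    by (rule vec_integral_cong) (use Kq in \<open>simp add: halflineD(2)[OF \<rho>]\<close>)
  also have "\<dots> = (LINT s|\<rho>. exp (- t * s) / (t + 1))"
    by (rule vec_integral_real(2)[OF halflineD(1)[OF \<rho>] iq])
  finally have 2: "(LINT u|levy_minus \<rho>. ?f u) = (LINT s|\<rho>. exp (- t * s) / (t + 1))" .
  have "(LINT u|levy_plus \<rho>. ?f u) - (LINT u|levy_minus \<rho>. ?f u)
      = (LINT s|\<rho>. levy_kernel s (t + 1) / (t + 1) - exp (- t * s) / (t + 1))"
    unfolding 1 2 by (rule Bochner_Integration.integral_diff[OF ip iq, symmetric])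
  also have "\<dots> = (LINT s|\<rho>. levy_kernel s t / (t + 1))"
  proof (rule Bochner_Integration.integral_cong[OF refl])
    fix s
    have "levy_kernel s (t + 1) = levy_kernel s t + exp (- t * s)"
      using levy_kernel_increment[of s t 1] by (simp add: levy_kernel_one mult.commute)
    then show "levy_kernel s (t + 1) / (t + 1) - exp (- t * s) / (t + 1) = levy_kernel s t / (t + 1)"
      by (simp add: add_divide_distrib)
  qed
  finally show "(LINT u|levy_plus \<rho>. ?f u) - (LINT u|levy_minus \<rho>. ?f u) = (LINT s|\<rho>. levy_kernel s t) / (t + 1)"
    by simp
qed

end

context
  fixes T :: "real \<Rightarrow> 'a::banach \<Rightarrow>\<^sub>L 'a"
  assumes sg: "bounded_C0_semigroup T"
begin

text \<open>
  The operator attached to \<open>(1 - e\<^sup>-\<^sup>s\<^sup>z) / ((1 - e\<^sup>-\<^sup>s)(1 + z))\<close> is \<open>R (1 - T(s)) / (1 - e\<^sup>-\<^sup>s)\<close>.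
\<close>

lemma sg_integral_trunc_exp_diff:
  assumes s: "s > 0"
  shows "blinfun_apply (sg_integral T (trunc_exp (exp (- s)))) y - blinfun_apply (T s) (blinfun_apply (resolvent T) y)
    = blinfun_apply (resolvent T) ((y - blinfun_apply (T s) y) /\<^sub>R (1 - exp (- s)))"
proof -
  let ?V = "blinfun_apply (sg_integral T (trunc_exp (exp (- s)))) y" and ?TR = "blinfun_apply (T s) (blinfun_apply (resolvent T) y)"
  have q: "1 - exp (- s) \<noteq> 0" using s by simp
  have "(1 - exp (- s)) *\<^sub>R (?V - ?TR) = blinfun_apply (resolvent T) y - ?TR"
    by (subst (2) resolvent_memoryless[OF sg s]) (simp add: algebra_simps)
  then have "?V - ?TR = (blinfun_apply (resolvent T) y - ?TR) /\<^sub>R (1 - exp (- s))"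
  proof -
    have "?V - ?TR = inverse (1 - exp (- s)) *\<^sub>R ((1 - exp (- s)) *\<^sub>R (?V - ?TR))" using q by simp
    also have "(1 - exp (- s)) *\<^sub>R (?V - ?TR) = blinfun_apply (resolvent T) y - ?TR" by fact
    finally show ?thesis .
  qed
  then show ?thesis
    using s by (simp add: blinfun.scaleR_right blinfun.diff_right resolvent_commute[OF sg])
qed

text \<open>
  The integrand at \<open>s = 0\<close> is the value of \<open>z/(1+z)\<close> at \<open>A\<close>, namely \<open>1 - R\<close>, which avoids the unbounded operator \<open>A\<close>.
\<close>

lemma bernstein_regularized_calc:
  assumes psi: "psi \<in> BF" and \<rho>: "finite_measure_halfline \<rho>" and a: "0 \<le> a"
    and rep: "\<And>z. z > 0 \<Longrightarrow> psi z = a + (LINT s|\<rho>. levy_kernel s z)"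
  defines "E \<equiv> \<lambda>y s. if s = 0 then y - blinfun_apply (resolvent T) y
      else blinfun_apply (resolvent T) ((y - blinfun_apply (T s) y) /\<^sub>R (1 - exp (- s)))"
  shows "vec_integrable \<rho> (E y)"
    "blinfun_apply (calc T (\<lambda>z. psi z / (1 + z))) y = a *\<^sub>R blinfun_apply (resolvent T) y + vec_integral \<rho> (E y)"
proof -
  let ?f = "\<lambda>u. blinfun_apply (T u) y"
  let ?Kp = "\<lambda>s. vec_integral (trunc_exp (exp (- s))) ?f"
  let ?Kq = "\<lambda>s. vec_integral (distr (trunc_exp 0) halfline ((+) s)) ?f"
  note f = sg_continuous_pos[OF sg, of y] norm_sg_apply[OF sg, of _ y]
  have fin: "finite_measure \<rho>" by (rule halflineD(1)[OF \<rho>])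
  have hp: "finite_measure_halfline (trunc_exp (exp (- s)))" if "0 \<le> s" for s
    by (rule finite_measure_halfline_trunc_exp(1)) (use that in auto)
  have hq: "finite_measure_halfline (distr (trunc_exp 0) halfline ((+) s))" if "0 \<le> s" for s
    by (rule shifted_exp(1)[OF that])
  have Kp: "?Kp s = blinfun_apply (sg_integral T (trunc_exp (exp (- s)))) y" if "0 \<le> s" for s
    by (rule sg_integral_apply[OF sg hp[OF that], symmetric])
  have Kq: "?Kq s = blinfun_apply (T s) (blinfun_apply (resolvent T) y)" if "0 \<le> s" for s
    using shifted_exp_integral[OF sg that] sg_integral_apply[OF sg hq[OF that]] by simp
  have KE: "?Kp s - ?Kq s = E y s" if "0 \<le> s" for s
  proof (cases "s = 0")
    case True
    then show ?thesis using Kp[of 0] Kq[of 0] sg_integral_trunc_exp_1[OF sg, of y]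
      by (simp add: E_def sg_zero[OF sg])
  next
    case False
    then have "s > 0" using that by simp
    then show ?thesis using Kp[OF that] Kq[OF that] sg_integral_trunc_exp_diff[of s y] False by (simp add: E_def)
  qed
  have TRc: "continuous_on {0<..} (\<lambda>s. blinfun_apply (T s) (blinfun_apply (resolvent T) y))" by (rule sg_continuous_pos[OF sg])
  have Ec: "continuous_on {0<..} (E y)"
  proof -
    have "continuous_on {0<..} (\<lambda>s. blinfun_apply (resolvent T) ((y - blinfun_apply (T s) y) /\<^sub>R (1 - exp (- s))))"
      by (intro bounded_linear.continuous_on[OF blinfun.bounded_linear_right] continuous_intros f(1)) auto
    then show ?thesis by (rule continuous_on_cong[THEN iffD1, OF refl, rotated]) (simp add: E_def)
  qed
  have smE: "strongly_measurable \<rho> (E y)" by (rule strongly_measurable_continuous[OF \<rho> Ec])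
  have smq: "strongly_measurable \<rho> ?Kq"
    using strongly_measurable_continuous[OF \<rho> TRc] Kq
    by (subst strongly_measurable_cong) (auto simp: halflineD(2)[OF \<rho>])
  have smp: "strongly_measurable \<rho> ?Kp"
  proof (subst strongly_measurable_cong)
    show "strongly_measurable \<rho> (\<lambda>s. E y s + ?Kq s)" by (rule strongly_measurable_add[OF smE smq])
    show "?Kp s = E y s + ?Kq s" if "s \<in> space \<rho>" for s
      using that by (simp add: halflineD(2)[OF \<rho>] KE[symmetric])
  qed
  have P: "vec_integral (levy_plus \<rho>) ?f = vec_integral \<rho> ?Kp" by (rule levy_plus(2)[OF \<rho> f smp])
  have Q: "vec_integral (levy_minus \<rho>) ?f = vec_integral \<rho> ?Kq" by (rule levy_minus(2)[OF \<rho> f smq])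
  let ?M = "semigroup_bound T * norm y"
  have bq: "norm (?Kq s) \<le> ?M" and bp: "norm (?Kp s) \<le> ?M" if "s \<in> space \<rho>" for s
  proof -
    have s: "0 \<le> s" using that by (simp add: halflineD(2)[OF \<rho>])
    have M0: "0 \<le> ?M" using semigroup_bound_nonneg[OF sg] by simp
    have *: "norm (vec_integral \<mu> ?f) \<le> ?M" if "finite_measure_halfline \<mu>" "prob_space \<mu>" for \<mu>
    proof -
      interpret prob_space \<mu> by fact
      have "ennreal (norm (vec_integral \<mu> ?f)) \<le> (\<integral>\<^sup>+u. ennreal (norm (?f u)) \<partial>\<mu>)"
        by (rule norm_vec_integral_le[OF halflineD(1)[OF that(1)] sg_integrable[OF sg that(1)]])
      also have "\<dots> \<le> (\<integral>\<^sup>+u. ennreal ?M \<partial>\<mu>)"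
        by (intro nn_integral_mono ennreal_leI f(2)) (simp add: halflineD(2)[OF that(1)])
      also have "\<dots> = ennreal ?M" by (simp add: emeasure_space_1)
      finally show ?thesis using M0 by (simp add: ennreal_le_iff)
    qed
    show "norm (?Kp s) \<le> ?M"
      by (rule *[OF hp[OF s]], rule finite_measure_halfline_trunc_exp(2)) (use s in auto)
    have "prob_space (trunc_exp 0)" by (rule finite_measure_halfline_trunc_exp) auto
    then show "norm (?Kq s) \<le> ?M"
      by (intro *[OF hq[OF s]] prob_space.prob_space_distr shift_measurable[OF s])
  qed
  have ip: "vec_integrable \<rho> ?Kp" by (rule vec_integrable_bounded[OF fin smp bp])
  have iq: "vec_integrable \<rho> ?Kq" by (rule vec_integrable_bounded[OF fin smq bq])
  show iE: "vec_integrable \<rho> (E y)"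
  proof (rule vec_integrable_bounded[OF fin smE])
    fix s assume s: "s \<in> space \<rho>"
    then show "norm (E y s) \<le> ?M + ?M"
      using norm_triangle_ineq4[of "?Kp s" "?Kq s"] bp[OF s] bq[OF s] KE[of s]
      by (simp add: halflineD(2)[OF \<rho>])
  qed
  note L = levy_laplace[OF \<rho>]
  have hlP: "finite_measure_halfline (levy_plus \<rho>)" and hlQ: "finite_measure_halfline (levy_minus \<rho>)"
    using L(2,3)[of 1] by auto
  \<comment> \<open>the constant \<open>a = \<psi>(0)\<close> contributes \<open>a / (1 + z)\<close>, the transform of \<open>a\<close> times the exponential law\<close>
  let ?\<mu> = "weighted_sum_measure a (trunc_exp 0) (levy_plus \<rho>)"
  have h\<mu>: "finite_measure_halfline ?\<mu>"
    by (rule finite_measure_halfline_weighted_sum(1)[OF a hl_exp hlP])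
  have "laplace_representation (\<lambda>z. psi z / (1 + z)) ?\<mu> (levy_minus \<rho>)"
    unfolding laplace_representation_def
  proof (intro conjI allI impI h\<mu> hlQ)
    fix t :: real assume t: "t > 0"
    have "(LINT s|?\<mu>. exp (- t * s)) - (LINT s|levy_minus \<rho>. exp (- t * s))
       = a * (1 / (t + 1)) + (LINT s|\<rho>. levy_kernel s t) / (t + 1)"
      unfolding laplace_weighted_sum[OF a hl_exp hlP t] L(1)[OF t, symmetric]
      using trunc_exp_laplace[of 0 t] t by simp
    then show "psi t / (1 + t) = (LINT s|?\<mu>. exp (- t * s)) - (LINT s|levy_minus \<rho>. exp (- t * s))"
      by (simp add: rep[OF t] add_divide_distrib add.commute)
  qed
  from calc_eq[OF sg this] have "blinfun_apply (calc T (\<lambda>z. psi z / (1 + z))) y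
     = vec_integral ?\<mu> ?f - vec_integral (levy_minus \<rho>) ?f"
    by (simp add: blinfun.diff_left sg_integral_apply[OF sg h\<mu>] sg_integral_apply[OF sg hlQ])
  also have "vec_integral ?\<mu> ?f = a *\<^sub>R blinfun_apply (resolvent T) y + vec_integral \<rho> ?Kp"
    unfolding P[symmetric] sg_integral_apply[OF sg hl_exp] by (rule vec_integral_weighted_sum[OF a hl_exp hlP f])
  also have "vec_integral (levy_minus \<rho>) ?f = vec_integral \<rho> ?Kq" by (rule Q)
  also have "a *\<^sub>R blinfun_apply (resolvent T) y + vec_integral \<rho> ?Kp - vec_integral \<rho> ?Kq
      = a *\<^sub>R blinfun_apply (resolvent T) y + vec_integral \<rho> (\<lambda>s. ?Kp s - ?Kq s)"
    using vec_integral_diff[OF fin ip iq] by simp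
  also have "vec_integral \<rho> (\<lambda>s. ?Kp s - ?Kq s) = vec_integral \<rho> (E y)"
    by (rule vec_integral_cong) (simp add: KE halflineD(2)[OF \<rho>])
  finally show "blinfun_apply (calc T (\<lambda>z. psi z / (1 + z))) y
     = a *\<^sub>R blinfun_apply (resolvent T) y + vec_integral \<rho> (E y)" .
qed

end

section \<open>Bernstein functions of a generator under the Yosida condition\<close>

lemma exp_kernel_section:
  assumes "finite_measure_halfline \<rho>" shows "exp_kernel \<tau> \<in> borel_measurable \<rho>"
proof (rule halfline_measurable[OF assms])
  show "exp_kernel \<tau> \<in> borel_measurable borel"
    using measurable_Pair2[OF exp_kernel_measurable, of \<tau>] by simp
qed

lemma exp_kernel_integral_finite:
  assumes "finite_measure_halfline \<rho>" "0 < \<tau>"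
  shows "(\<integral>\<^sup>+s. exp_kernel \<tau> s \<partial>\<rho>) < \<infinity>"
proof -
  interpret finite_measure \<rho> by (rule halflineD(1)[OF assms(1)])
  have "(\<integral>\<^sup>+s. exp_kernel \<tau> s \<partial>\<rho>) \<le> (\<integral>\<^sup>+s. ennreal (max 1 (1 / \<tau>)) \<partial>\<rho>)"
    using assms(2) by (intro nn_integral_mono exp_kernel_le) (auto simp: halflineD(2)[OF assms(1)])
  also have "\<dots> < \<infinity>" by (simp add: emeasure_eq_measure ennreal_mult_less_top)
  finally show ?thesis .
qed

context
  fixes T :: "real \<Rightarrow> 'a::banach \<Rightarrow>\<^sub>L 'a" and A :: "'a \<rightharpoonup> 'a" and c0 c1 :: real
  assumes sg: "bounded_C0_semigroup T" and gen: "generator T = neg_op A"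
    and c0: "0 \<le> c0" and c1: "0 < c1" and yosida: "yosida_condition T A c0 c1"
begin

text \<open>
  The bounded operator \<open>A e\<^sup>-\<^sup>t\<^sup>A\<close>, for \<open>t > 0\<close>.
\<close>

definition generator_sg :: "real \<Rightarrow> 'a \<Rightarrow>\<^sub>L 'a" where
  "generator_sg t = (SOME S. (\<forall>x. generator T (blinfun_apply (T t) x) = Some (- blinfun_apply S x)) \<and> norm S \<le> c0 + c1 / t)"

lemma generator_sg:
  assumes "t > 0"
  shows "generator T (blinfun_apply (T t) x) = Some (- blinfun_apply (generator_sg t) x)" "norm (generator_sg t) \<le> c0 + c1 / t"
proof -
  obtain S where S: "is_bounded_op (A \<circ>\<^sub>m of_blinfun (T t)) S" "norm S \<le> c0 + c1 / t"
    using yosida assms by (auto simp: yosida_condition_def)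
  have "generator T (blinfun_apply (T t) x) = Some (- blinfun_apply S x)" for x
  proof -
    have "(A \<circ>\<^sub>m of_blinfun (T t)) x = of_blinfun S x" using S(1) by (simp add: is_bounded_op_def)
    then have "A (blinfun_apply (T t) x) = Some (blinfun_apply S x)" by (simp add: map_comp_def of_blinfun_def)
    then show ?thesis by (simp add: gen neg_op_def)
  qed
  then have "\<exists>S. (\<forall>x. generator T (blinfun_apply (T t) x) = Some (- blinfun_apply S x)) \<and> norm S \<le> c0 + c1 / t"
    using S(2) by blast
  from someI_ex[OF this] show "generator T (blinfun_apply (T t) x) = Some (- blinfun_apply (generator_sg t) x)"
    "norm (generator_sg t) \<le> c0 + c1 / t" unfolding generator_sg_def by blast+
qed

lemma generator_sg_shift:
  assumes "t > 0" "r \<ge> 0" shows "blinfun_apply (generator_sg (t + r)) x = blinfun_apply (T r) (blinfun_apply (generator_sg t) x)"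
proof -
  have "generator T (blinfun_apply (T r) (blinfun_apply (T t) x)) = Some (blinfun_apply (T r) (- blinfun_apply (generator_sg t) x))"
    by (rule generator_commute[OF sg generator_sg(1)[OF assms(1)] assms(2)])
  moreover have "blinfun_apply (T r) (blinfun_apply (T t) x) = blinfun_apply (T (t + r)) x"
    using sg_add[OF sg, of r t x] assms by (simp add: add.commute)
  ultimately show ?thesis using generator_sg(1)[of "t + r" x] assms by (simp add: blinfun.minus_right)
qed

text \<open>
  \<open>A e\<^sup>-\<^sup>r\<^sup>A\<close> is bounded by \<open>c\<^sub>0 + c\<^sub>1/r\<close>, which decreases in \<open>r\<close>, so its value at the left end \<open>t\<close> is a Lipschitz
  constant of the orbit.
\<close>

lemma sg_increment_bound:
  assumes t: "t > 0" and s: "s > 0"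
  shows "norm (blinfun_apply (T t) x - blinfun_apply (T (t + s)) x) \<le> s * ((c0 + c1 / t) * norm x)"
proof -
  have "norm (blinfun_apply (T s) (blinfun_apply (T t) x) - blinfun_apply (T t) x) \<le> s * ((c0 + c1 / t) * norm x)"
  proof (rule generator_lipschitz[OF sg generator_sg(1)[OF t] s])
    fix r :: real assume r: "0 \<le> r"
    have "norm (blinfun_apply (T r) (- blinfun_apply (generator_sg t) x)) = norm (blinfun_apply (generator_sg (t + r)) x)"
      by (simp add: generator_sg_shift[OF t r] blinfun.minus_right)
    also have "\<dots> \<le> norm (generator_sg (t + r)) * norm x" by (rule norm_blinfun)
    also have "\<dots> \<le> (c0 + c1 / (t + r)) * norm x"
      using generator_sg(2)[of "t + r"] t r by (intro mult_right_mono) auto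
    also have "\<dots> \<le> (c0 + c1 / t) * norm x"
      using t r c1 by (intro mult_right_mono add_left_mono divide_left_mono) auto
    finally show "norm (blinfun_apply (T r) (- blinfun_apply (generator_sg t) x)) \<le> (c0 + c1 / t) * norm x" .
  qed
  then show ?thesis
    using sg_add[OF sg, of s t x] t s by (simp add: add.commute norm_minus_commute)
qed

text \<open>
  The value of \<open>levy_kernel s\<close> at \<open>A\<close>, composed with \<open>e\<^sup>-\<^sup>t\<^sup>A\<close>. At \<open>t = s = 0\<close> this would be \<open>A\<close> itself. The value 0
  stands in for it: the integral over \<open>s\<close> at \<open>t = 0\<close> is formed only if the measure does not charge 0.
\<close>

definition diff_quot :: "real \<Rightarrow> real \<Rightarrow> 'a \<Rightarrow>\<^sub>L 'a" where
  "diff_quot t s = (if s = 0 then if t > 0 then generator_sg t else 0 else (T t - T (t + s)) /\<^sub>R (1 - exp (- s)))"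

definition yosida_const :: real where "yosida_const = 2 * max (2 * semigroup_bound T) c1"

text \<open>
  The two summands lead to the second and the third term of the final bound.
\<close>

definition diff_quot_rate :: "real \<Rightarrow> real \<Rightarrow> ennreal" where
  "diff_quot_rate t s = ennreal yosida_const * exp_kernel t s
     + ennreal (4 * semigroup_bound T) * (if c0 = 0 then 0 else exp_kernel (1 / c0) s)"

lemma yosida_const_nonneg: "0 \<le> yosida_const"
  using semigroup_bound_nonneg[OF sg] by (simp add: yosida_const_def)

lemma norm_diff_quot:
  assumes t: "0 \<le> t" and s: "0 \<le> s"
  shows "ennreal (norm (blinfun_apply (diff_quot t s) x)) \<le> ennreal (norm x) * diff_quot_rate t s"
proof (cases "x = 0")
  case False
  let ?M = "semigroup_bound T"
  have M: "1 \<le> ?M" by (rule semigroup_bound_ge_1[OF sg False])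
  have L0: "0 \<le> levy_density s" by (rule levy_density_nonneg[OF s])
  have nx: "0 < norm x" using False by simp
  let ?c = "if c0 = 0 then 0 else levy_density s / (1 / c0 + s)"
  have crat: "ennreal ?c = (if c0 = 0 then 0 else exp_kernel (1 / c0) s)"
  proof (cases "c0 = 0")
    case False
    then have "0 \<le> 1 / c0" "0 < 1 / c0 + s" using c0 s by (auto intro: add_pos_nonneg)
    then show ?thesis using exp_kernel_eq[of "1 / c0" s] False s by simp
  qed simp
  have c_nn: "0 \<le> ?c" using L0 c0 s by (auto intro!: divide_nonneg_nonneg add_nonneg_nonneg)
  show ?thesis
  proof (cases "t + s > 0")
    case True
    have r: "diff_quot_rate t s = ennreal (yosida_const * (levy_density s / (t + s)) + 4 * ?M * ?c)"
    proof -
      have sum: "ennreal (p * q + u * v) = ennreal p * ennreal q + ennreal u * ennreal v"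
        if "0 \<le> p" "0 \<le> q" "0 \<le> u" "0 \<le> v" for p q u v :: real
        using that by (simp add: ennreal_mult)
      have "ennreal (yosida_const * (levy_density s / (t + s)) + 4 * ?M * ?c)
         = ennreal yosida_const * ennreal (levy_density s / (t + s)) + ennreal (4 * ?M) * ennreal ?c"
        by (rule sum[OF yosida_const_nonneg _ _ c_nn]) (use L0 True M in auto)
      then show ?thesis unfolding diff_quot_rate_def exp_kernel_eq[OF t s True] crat by simp
    qed
    have "norm (blinfun_apply (diff_quot t s) x) \<le> norm x * (yosida_const * (levy_density s / (t + s)) + 4 * ?M * ?c)"
    proof (cases "s = 0")
      case s0: True
      then have t0: "t > 0" using True by simp
      have "norm (blinfun_apply (diff_quot t s) x) \<le> norm (generator_sg t) * norm x"
        using s0 t0 by (simp add: diff_quot_def norm_blinfun)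
      also have "\<dots> \<le> (c0 + c1 / t) * norm x" by (rule mult_right_mono[OF generator_sg(2)[OF t0]]) simp
      also have "c0 + c1 / t \<le> yosida_const * (1 / t) + 4 * ?M * c0"
      proof -
        have "c1 \<le> yosida_const" using c1 by (simp add: yosida_const_def)
        then have "c1 * (1 / t) \<le> yosida_const * (1 / t)" using t0 by (intro mult_right_mono) auto
        moreover have "1 * c0 \<le> 4 * ?M * c0" using M c0 by (intro mult_right_mono) auto
        ultimately show ?thesis by simp
      qed
      also have "yosida_const * (1 / t) + 4 * ?M * c0 = yosida_const * (levy_density s / (t + s)) + 4 * ?M * ?c"
        using s0 by (simp add: levy_density_def)
      finally show ?thesis by (simp add: mult.commute mult_right_mono)
    next
      case False
      then have s0: "s > 0" using s by simp
      let ?q = "1 - exp (- s)"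
      have q: "0 < ?q" using s0 by simp
      let ?n = "norm (blinfun_apply (T t) x - blinfun_apply (T (t + s)) x)"
      have n1: "?n \<le> 2 * ?M * norm x"
        using norm_triangle_ineq4[of "blinfun_apply (T t) x" "blinfun_apply (T (t + s)) x"]
          norm_sg_apply[OF sg, of t x] norm_sg_apply[OF sg, of "t + s" x] t s by linarith
      have key: "?n / norm x \<le> yosida_const * (s / (t + s)) + 4 * ?M * (c0 * s / (1 + c0 * s))"
      proof (cases "t = 0")
        case True
        have "?n / norm x \<le> 2 * ?M" using n1 nx by (simp add: divide_le_eq)
        also have "\<dots> \<le> yosida_const * (s / (t + s))" using True s0 M by (simp add: yosida_const_def)
        also have "0 \<le> 4 * ?M * (c0 * s / (1 + c0 * s))"
          using M c0 s0 by (intro mult_nonneg_nonneg divide_nonneg_nonneg) auto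
        then have "yosida_const * (s / (t + s)) \<le> yosida_const * (s / (t + s)) + 4 * ?M * (c0 * s / (1 + c0 * s))" by simp
        finally show ?thesis .
      next
        case False
        then have t0: "t > 0" using t by simp
        have n2: "?n / norm x \<le> s * (c0 + c1 / t)"
          using sg_increment_bound[OF t0 s0, of x] nx by (simp add: divide_le_eq mult.assoc)
        have n1': "?n / norm x \<le> 2 * ?M" using n1 nx by (simp add: divide_le_eq)
        show ?thesis unfolding yosida_const_def by (rule increment_bound_split[OF M c0 c1 s0 t0 n1' n2])
      qed
      have e1: "levy_density s = s / ?q" using s0 by (simp add: levy_density_def)
      have e2: "?c = (c0 * s / (1 + c0 * s)) / ?q"
      proof (cases "c0 = 0")
        case False
        then have "1 / c0 + s = (1 + c0 * s) / c0" by (simp add: field_simps)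
        then show ?thesis using False by (simp add: e1 mult.commute)
      qed simp
      have "norm (blinfun_apply (diff_quot t s) x) = ?n / ?q"
        using s0 q by (simp add: diff_quot_def blinfun.scaleR_left blinfun.diff_left divide_inverse_commute)
      also have "\<dots> = norm x * ((?n / norm x) / ?q)" using nx by simp
      also have "\<dots> \<le> norm x * ((yosida_const * (s / (t + s)) + 4 * ?M * (c0 * s / (1 + c0 * s))) / ?q)"
        using key q by (intro mult_left_mono divide_right_mono) auto
      also have "(yosida_const * (s / (t + s)) + 4 * ?M * (c0 * s / (1 + c0 * s))) / ?q
          = yosida_const * ((s / ?q) / (t + s)) + 4 * ?M * ((c0 * s / (1 + c0 * s)) / ?q)"
        by (simp add: add_divide_distrib mult.commute)
      also have "\<dots> = yosida_const * (levy_density s / (t + s)) + 4 * ?M * ?c"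
        by (simp only: e1[symmetric] e2[symmetric])
      finally show ?thesis .
    qed
    then show ?thesis unfolding r by (simp add: ennreal_leI flip: ennreal_mult')
  next
    case False
    then have "t = 0" "s = 0" using t s by auto
    then show ?thesis by (simp add: diff_quot_def)
  qed
qed simp

lemma diff_quot_shift:
  assumes "t > 0" "r \<ge> 0" "s \<ge> 0"
  shows "blinfun_apply (diff_quot (t + r) s) x = blinfun_apply (T r) (blinfun_apply (diff_quot t s) x)"
proof (cases "s = 0")
  case True
  then show ?thesis using assms generator_sg_shift[OF assms(1,2)] by (simp add: diff_quot_def)
next
  case False
  have "blinfun_apply (T (t + r)) x = blinfun_apply (T r) (blinfun_apply (T t) x)"
    "blinfun_apply (T (t + r + s)) x = blinfun_apply (T r) (blinfun_apply (T (t + s)) x)"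
    using sg_add[OF sg, of r t x] sg_add[OF sg, of r "t + s" x] assms by (simp_all add: ac_simps)
  then show ?thesis using False
    by (simp add: diff_quot_def blinfun.scaleR_left blinfun.diff_left blinfun.scaleR_right blinfun.diff_right)
qed

context
  fixes \<rho> :: "real measure"
  assumes \<rho>: "finite_measure_halfline \<rho>"
begin

text \<open>
  Bounds the norm of the operator \<open>bernstein_orbit\<close> below.
\<close>

definition orbit_rate :: "real \<Rightarrow> ennreal" where
  "orbit_rate t = ennreal yosida_const * (\<integral>\<^sup>+s. exp_kernel t s \<partial>\<rho>)
     + ennreal (4 * semigroup_bound T) * (if c0 = 0 then 0 else \<integral>\<^sup>+s. exp_kernel (1 / c0) s \<partial>\<rho>)"

lemma orbit_rate_eq: "orbit_rate t = (\<integral>\<^sup>+s. diff_quot_rate t s \<partial>\<rho>)"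
proof -
  have [measurable]: "exp_kernel \<tau> \<in> borel_measurable \<rho>" for \<tau> by (rule exp_kernel_section[OF \<rho>])
  show ?thesis unfolding orbit_rate_def diff_quot_rate_def
    by (cases "c0 = 0") (simp_all add: nn_integral_add nn_integral_cmult)
qed

lemma orbit_rate_finite: "0 < t \<Longrightarrow> orbit_rate t < \<infinity>"
  unfolding orbit_rate_def using exp_kernel_integral_finite[OF \<rho>, of t] exp_kernel_integral_finite[OF \<rho>, of "1 / c0"] c0
  by (auto simp: ennreal_mult_less_top)

lemma diff_quot_integral_bound:
  assumes t: "0 \<le> t"
  shows "(\<integral>\<^sup>+s. ennreal (norm (blinfun_apply (diff_quot t s) x)) \<partial>\<rho>) \<le> ennreal (norm x) * orbit_rate t"
proof -
  have [measurable]: "exp_kernel \<tau> \<in> borel_measurable \<rho>" for \<tau> by (rule exp_kernel_section[OF \<rho>])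
  have rm: "diff_quot_rate t \<in> borel_measurable \<rho>" unfolding diff_quot_rate_def[abs_def] by measurable
  have "(\<integral>\<^sup>+s. ennreal (norm (blinfun_apply (diff_quot t s) x)) \<partial>\<rho>) \<le> (\<integral>\<^sup>+s. ennreal (norm x) * diff_quot_rate t s \<partial>\<rho>)"
    by (intro nn_integral_mono norm_diff_quot t) (simp add: halflineD(2)[OF \<rho>])
  also have "\<dots> = ennreal (norm x) * orbit_rate t" unfolding orbit_rate_eq by (rule nn_integral_cmult[OF rm])
  finally show ?thesis .
qed

lemma diff_quot_integrable:
  assumes t: "0 \<le> t" and fin: "orbit_rate t < \<infinity>"
  shows "vec_integrable \<rho> (\<lambda>s. blinfun_apply (diff_quot t s) x)"
proof -
  have "continuous_on {0<..} (\<lambda>s. (blinfun_apply (T t) x - blinfun_apply (T (t + s)) x) /\<^sub>R (1 - exp (- s)))"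
  proof -
    have "continuous_on {0<..} (\<lambda>s. blinfun_apply (T (t + s)) x)"
      by (rule continuous_on_compose2[OF sg_continuous[OF sg]]) (use t in \<open>auto intro!: continuous_intros\<close>)
    then show ?thesis
      by (intro continuous_on_scaleR continuous_on_inverse continuous_on_diff continuous_on_const
          continuous_on_exp continuous_on_minus continuous_on_id) auto
  qed
  then have "continuous_on {0<..} (\<lambda>s. blinfun_apply (diff_quot t s) x)"
    by (rule continuous_on_cong[THEN iffD1, OF refl, rotated])
       (simp add: diff_quot_def blinfun.scaleR_left blinfun.diff_left)
  moreover have "ennreal (norm x) * orbit_rate t < \<infinity>" using fin by (simp add: ennreal_mult_less_top)
  ultimately show ?thesis
    using le_less_trans[OF diff_quot_integral_bound[OF t]]
    by (simp add: vec_integrable_def strongly_measurable_continuous[OF \<rho>])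
qed

text \<open>
  The operator \<open>(\<psi>(A) - \<psi>(0)) e\<^sup>-\<^sup>t\<^sup>A\<close>, for those \<open>t\<close> at which the rate guarantees convergence: all \<open>t > 0\<close>, and
  \<open>t = 0\<close> when \<open>\<psi>\<close> is bounded.
\<close>

definition bernstein_orbit :: "real \<Rightarrow> 'a \<Rightarrow>\<^sub>L 'a" where
  "bernstein_orbit t = (SOME F. \<forall>x. blinfun_apply F x =
     (if 0 \<le> t \<and> orbit_rate t < \<infinity> then vec_integral \<rho> (\<lambda>s. blinfun_apply (diff_quot t s) x) else 0))"

lemma bernstein_orbit_apply: "blinfun_apply (bernstein_orbit t) x =
     (if 0 \<le> t \<and> orbit_rate t < \<infinity> then vec_integral \<rho> (\<lambda>s. blinfun_apply (diff_quot t s) x) else 0)"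
proof -
  have "\<exists>F. \<forall>x. blinfun_apply F x =
     (if 0 \<le> t \<and> orbit_rate t < \<infinity> then vec_integral \<rho> (\<lambda>s. blinfun_apply (diff_quot t s) x) else 0)"
  proof (cases "0 \<le> t \<and> orbit_rate t < \<infinity>")
    case True
    have "\<exists>F. \<forall>x. blinfun_apply F x = vec_integral \<rho> (\<lambda>s. blinfun_apply (diff_quot t s) x)"
    proof (rule vec_integral_blinfun[OF halflineD(1)[OF \<rho>], of "enn2real (orbit_rate t)"])
      show "vec_integrable \<rho> (\<lambda>s. blinfun_apply (diff_quot t s) x)" for x
        using True by (intro diff_quot_integrable) auto
      show "(\<integral>\<^sup>+s. ennreal (norm (blinfun_apply (diff_quot t s) x)) \<partial>\<rho>) \<le> ennreal (enn2real (orbit_rate t) * norm x)" for x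
        using diff_quot_integral_bound[of t x] True by (simp add: ennreal_mult mult.commute)
    qed simp
    then show ?thesis using True by simp
  next
    case False
    then show ?thesis by (auto intro!: exI[of _ 0])
  qed
  from someI_ex[OF this] show ?thesis unfolding bernstein_orbit_def by blast
qed

lemma norm_bernstein_orbit:
  assumes "0 \<le> t" shows "ennreal (norm (blinfun_apply (bernstein_orbit t) x)) \<le> ennreal (norm x) * orbit_rate t"
proof (cases "orbit_rate t < \<infinity>")
  case True
  then show ?thesis
    using order_trans[OF norm_vec_integral_le[OF halflineD(1)[OF \<rho>] diff_quot_integrable[OF assms True, of x]]
      diff_quot_integral_bound[OF assms, of x]] assms
    by (simp add: bernstein_orbit_apply)
qed (simp add: bernstein_orbit_apply)

lemma bernstein_orbit_shift:
  assumes "t > 0" "r \<ge> 0"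
  shows "blinfun_apply (bernstein_orbit (t + r)) x = blinfun_apply (T r) (blinfun_apply (bernstein_orbit t) x)"
proof -
  have bl: "bounded_linear (blinfun_apply (T r))" by (rule blinfun.bounded_linear_right)
  have "blinfun_apply (bernstein_orbit (t + r)) x = vec_integral \<rho> (\<lambda>s. blinfun_apply (diff_quot (t + r) s) x)"
    using assms orbit_rate_finite[of "t + r"] by (simp add: bernstein_orbit_apply)
  also have "\<dots> = vec_integral \<rho> (\<lambda>s. blinfun_apply (T r) (blinfun_apply (diff_quot t s) x))"
    by (rule vec_integral_cong) (simp add: diff_quot_shift assms halflineD(2)[OF \<rho>])
  also have "\<dots> = blinfun_apply (T r) (vec_integral \<rho> (\<lambda>s. blinfun_apply (diff_quot t s) x))"
    using assms orbit_rate_finite[of t]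
    by (intro vec_integral_bounded_linear[OF halflineD(1)[OF \<rho>] diff_quot_integrable bl]) auto
  also have "\<dots> = blinfun_apply (T r) (blinfun_apply (bernstein_orbit t) x)"
    using assms orbit_rate_finite[of t] by (simp add: bernstein_orbit_apply)
  finally show ?thesis .
qed

lemma bernstein_orbit_continuous: "continuous_on {0<..} (\<lambda>t. blinfun_apply (bernstein_orbit t) x)"
proof (rule continuous_at_imp_continuous_on, rule ballI)
  fix t :: real assume t: "t \<in> {0<..}"
  let ?a = "t / 2"
  have a: "?a > 0" using t by simp
  have "continuous_on {?a<..} (\<lambda>u. blinfun_apply (T (u - ?a)) (blinfun_apply (bernstein_orbit ?a) x))"
    by (rule continuous_on_compose2[OF sg_continuous[OF sg]]) (auto intro!: continuous_intros)
  then have "continuous_on {?a<..} (\<lambda>u. blinfun_apply (bernstein_orbit u) x)"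
  proof (rule continuous_on_cong[THEN iffD1, OF refl, rotated])
    fix u assume "u \<in> {?a<..}"
    then show "blinfun_apply (T (u - ?a)) (blinfun_apply (bernstein_orbit ?a) x) = blinfun_apply (bernstein_orbit u) x"
      using bernstein_orbit_shift[OF a, of "u - ?a" x] by simp
  qed
  then show "isCont (\<lambda>t. blinfun_apply (bernstein_orbit t) x) t"
    using t by (simp add: continuous_on_eq_continuous_at)
qed

text \<open>
  For \<open>s > 0\<close> the integrands agree by construction. At \<open>s = 0\<close> they agree if \<open>t > 0\<close>, because \<open>1 - R = R A\<close> on the
  range of \<open>T t\<close>, and for \<open>t = 0\<close> the measure does not charge that point.
\<close>

lemma regularized_calc_on_orbit:
  assumes psi: "psi \<in> BF" and a: "0 \<le> a"
    and rep: "\<And>z. z > 0 \<Longrightarrow> psi z = a + (LINT s|\<rho>. levy_kernel s z)"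
    and t: "0 \<le> t" and fin: "orbit_rate t < \<infinity>"
  shows "blinfun_apply (calc T (\<lambda>z. psi z / (1 + z))) (blinfun_apply (T t) x)
     = blinfun_apply (resolvent T) (a *\<^sub>R blinfun_apply (T t) x + blinfun_apply (bernstein_orbit t) x)"
proof -
  let ?y = "blinfun_apply (T t) x" and ?R = "blinfun_apply (resolvent T)"
  let ?E = "\<lambda>s. if s = 0 then ?y - ?R ?y else ?R ((?y - blinfun_apply (T s) ?y) /\<^sub>R (1 - exp (- s)))"
  have bl: "bounded_linear ?R" by (rule blinfun.bounded_linear_right)
  have hfin: "finite_measure \<rho>" by (rule halflineD(1)[OF \<rho>])
  note B = bernstein_regularized_calc[OF sg psi \<rho> a rep, of ?y]
  have pos: "?E s = ?R (blinfun_apply (diff_quot t s) x)" if s: "s > 0" for s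
    using s t sg_add[OF sg, of s t x]
    by (simp add: diff_quot_def blinfun.scaleR_left blinfun.diff_left add.commute)
  have "AE s in \<rho>. ?E s = ?R (blinfun_apply (diff_quot t s) x)"
  proof (cases "t > 0")
    case True
    have "?R (- blinfun_apply (generator_sg t) x) = ?R ?y - ?y"
      by (rule resolvent_generator[OF sg generator_sg(1)[OF True]])
    then have "?R (blinfun_apply (generator_sg t) x) = ?y - ?R ?y" 
      by (simp add: blinfun.minus_right minus_equation_iff[of _ "?R ?y - ?y"])
    then have "?E 0 = ?R (blinfun_apply (diff_quot t 0) x)" using True by (simp add: diff_quot_def)
    moreover have "s = 0 \<or> s > 0" if "s \<in> space \<rho>" for s
      using that by (auto simp: halflineD(2)[OF \<rho>])
    ultimately show ?thesis using pos by (intro AE_I2) blast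
  next
    case False
    then have t0: "t = 0" using t by simp
    \<comment> \<open>finiteness of the rate at \<open>t = 0\<close> means that \<open>\<rho>\<close> does not charge 0\<close>
    have K: "0 < yosida_const" using c1 by (simp add: yosida_const_def)
    have "(\<integral>\<^sup>+s. exp_kernel 0 s \<partial>\<rho>) \<noteq> \<infinity>"
      using fin K by (auto simp: orbit_rate_def t0 ennreal_mult_less_top)
    then have "AE s in \<rho>. exp_kernel 0 s \<noteq> \<infinity>" by (rule nn_integral_PInf_AE[OF exp_kernel_section[OF \<rho>]])
    then have "AE s in \<rho>. s \<noteq> 0" by eventually_elim (use exp_kernel_0_0 in auto)
    with AE_space show ?thesis
      by eventually_elim (use pos in \<open>auto simp: halflineD(2)[OF \<rho>]\<close>)
  qed
  then have "vec_integral \<rho> ?E = vec_integral \<rho> (\<lambda>s. ?R (blinfun_apply (diff_quot t s) x))"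
    using B(1) vec_integrable_bounded_linear[OF hfin diff_quot_integrable[OF t fin] bl]
    by (intro vec_integral_cong_AE) (auto simp: vec_integrable_def)
  also have "\<dots> = ?R (blinfun_apply (bernstein_orbit t) x)"
    using vec_integral_bounded_linear[OF hfin diff_quot_integrable[OF t fin] bl] t fin by (simp add: bernstein_orbit_apply)
  finally show ?thesis using B(2) by (simp add: blinfun.add_right blinfun.scaleR_right)
qed

end

end

theorem theorem3p1:
  fixes psi g :: "real \<Rightarrow> real"
    and T :: "real \<Rightarrow> 'a::banach \<Rightarrow>\<^sub>L 'a"
    and A :: "'a \<rightharpoonup> 'a"
    and c0 c1 :: real
  assumes "psi \<in> BF"
    and "g \<in> BCM"
    and "J_functional g psi < \<infinity>"
    and "bounded_C0_semigroup T"
    and "generator T = neg_op A"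
    and "c0 \<ge> 0" and "c1 > 0"
    and "yosida_condition T A c0 c1"
  shows "\<exists>S. is_bounded_op (bernstein_op T A psi \<circ>\<^sub>m of_blinfun (calc T g)) S \<and>
    ennreal (norm S) \<le>
      ennreal (at_zero_plus psi * norm (calc T g))
      + ennreal (2 * max (2 * semigroup_bound T) c1) * J_functional g psi
      + ennreal (4 * semigroup_bound T * at_zero_plus g) * C_functional c0 psi"
proof -
  note psi = assms(1) and sg = assms(4) and c0 = assms(6) and c1 = assms(7)
  note ctx = assms(4-8)
  let ?a = "at_zero_plus psi" and ?G = "calc T g" and ?F = "calc T (\<lambda>z. psi z / (1 + z))"
  let ?R = "blinfun_apply (resolvent T)" and ?M = "semigroup_bound T"
  obtain \<rho> where \<rho>: "finite_measure_halfline \<rho>" and a: "0 \<le> ?a"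
    and rep: "\<And>z. z > 0 \<Longrightarrow> psi z = ?a + (LINT s|\<rho>. levy_kernel s z)"
    using BF_representation[OF psi] by blast
  obtain \<mu> where \<mu>: "finite_measure_halfline \<mu>" and g: "\<And>t. t > 0 \<Longrightarrow> g t = (LINT s|\<mu>. exp (- t * s))"
    and mass: "measure \<mu> {0..} = at_zero_plus g"
    using BCM_laplace_transform[OF assms(2)] by blast
  interpret \<mu>: finite_measure \<mu> by (rule halflineD(1)[OF \<mu>])
  have fin: "finite_measure \<mu>" by (rule \<mu>.finite_measure_axioms)
  let ?w = "orbit_rate T c0 c1 \<rho>" and ?W = "bernstein_orbit T c0 c1 \<rho>"
  have M0: "0 \<le> ?M" by (rule semigroup_bound_nonneg[OF sg])
  \<comment> \<open>the representing measure of \<open>g\<close> is positive, so the negative part is the zero measure\<close>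
  let ?z = "null_measure halfline"
  have hz: "finite_measure_halfline ?z"
    by (auto simp: finite_measure_halfline_def space_restrict_space intro!: finite_measureI)
  have "laplace_representation g \<mu> ?z"
    using \<mu> hz g by (simp add: laplace_representation_def)
  then have Gc: "?G = sg_integral T \<mu> - sg_integral T ?z" by (rule calc_eq[OF sg])
  have "vec_integral ?z (\<lambda>s. blinfun_apply (T s) x) = 0" for x
    using norm_vec_integral_le[OF halflineD(1)[OF hz] sg_integrable[OF sg hz], of x] by simp
  then have G: "blinfun_apply ?G x = vec_integral \<mu> (\<lambda>t. blinfun_apply (T t) x)" for x
    by (simp add: Gc blinfun.diff_left sg_integral_apply[OF sg \<mu>] sg_integral_apply[OF sg hz])
  \<comment> \<open>\<open>?Y\<close> will bound the norm of \<open>S2\<close>; \<open>J[g,\<psi>] < \<infinity>\<close> makes it finite\<close>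
  let ?Y = "\<integral>\<^sup>+t. ?w t \<partial>\<mu>"
  have C: "(if c0 = 0 then 0 else \<integral>\<^sup>+s. exp_kernel (1 / c0) s \<partial>\<rho>) \<le> C_functional c0 psi"
    using exp_kernel_integral_le[OF psi \<rho> rep, of "1 / c0"] by (simp add: C_functional_def)
  let ?C = "if c0 = 0 then 0 else \<integral>\<^sup>+s. exp_kernel (1 / c0) s \<partial>\<rho>"
  have Cfin: "?C < \<infinity>" using exp_kernel_integral_finite[OF \<rho>, of "1 / c0"] c0 by auto
  have km: "(\<lambda>t. \<integral>\<^sup>+s. exp_kernel t s \<partial>\<rho>) \<in> borel_measurable \<mu>"
    by (rule halfline_measurable[OF \<mu> exp_kernel_integral_measurable[OF \<rho>]])
  have w: "?w = (\<lambda>t. ennreal (2 * max (2 * ?M) c1) * (\<integral>\<^sup>+s. exp_kernel t s \<partial>\<rho>) + ennreal (4 * ?M) * ?C)"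
    by (rule ext) (simp only: orbit_rate_def[OF ctx \<rho>] yosida_const_def[OF ctx])
  have wm: "?w \<in> borel_measurable \<mu>" unfolding w using km by measurable
  have "?Y = ennreal (2 * max (2 * ?M) c1) * (\<integral>\<^sup>+t. (\<integral>\<^sup>+s. exp_kernel t s \<partial>\<rho>) \<partial>\<mu>)
     + ennreal (4 * ?M) * ?C * emeasure \<mu> (space \<mu>)"
    unfolding w using km by (subst nn_integral_add) (auto simp: nn_integral_cmult)
  also have "emeasure \<mu> (space \<mu>) = ennreal (at_zero_plus g)"
    using mass by (simp add: \<mu>.emeasure_eq_measure halflineD(2)[OF \<mu>])
  finally have Y: "?Y = ennreal (2 * max (2 * ?M) c1) * (\<integral>\<^sup>+t. (\<integral>\<^sup>+s. exp_kernel t s \<partial>\<rho>) \<partial>\<mu>)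
     + ennreal (4 * ?M) * ?C * ennreal (at_zero_plus g)" .
  have J: "(\<integral>\<^sup>+t. (\<integral>\<^sup>+s. exp_kernel t s \<partial>\<rho>) \<partial>\<mu>) \<le> J_functional g psi"
    by (rule exp_kernel_double_integral_le[OF psi \<rho> rep \<mu> g])
  have Yfin: "?Y < \<infinity>"
    unfolding Y using le_less_trans[OF J assms(3)] Cfin by (simp add: ennreal_mult_less_top)
  have g0: "0 \<le> at_zero_plus g" using mass by (metis measure_nonneg)
  have "?Y \<le> ennreal (2 * max (2 * ?M) c1) * J_functional g psi
     + ennreal (4 * ?M) * C_functional c0 psi * ennreal (at_zero_plus g)"
    unfolding Y by (intro add_mono mult_mono J C) auto
  also have "ennreal (4 * ?M) * C_functional c0 psi * ennreal (at_zero_plus g)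
     = ennreal (4 * ?M * at_zero_plus g) * C_functional c0 psi"
    using M0 g0 by (simp add: ennreal_mult ac_simps)
  finally have Y_le: "?Y \<le> ennreal (2 * max (2 * ?M) c1) * J_functional g psi
     + ennreal (4 * ?M * at_zero_plus g) * C_functional c0 psi" .
  have "AE t in \<mu>. ?w t \<noteq> \<infinity>" using Yfin by (intro nn_integral_PInf_AE[OF wm]) auto
  then have AEw: "AE t in \<mu>. 0 \<le> t \<and> ?w t < \<infinity>"
    using AE_space by eventually_elim (simp add: halflineD(2)[OF \<mu>] less_top)
  have Wbound: "(\<integral>\<^sup>+t. ennreal (norm (blinfun_apply (?W t) x)) \<partial>\<mu>) \<le> ennreal (enn2real ?Y * norm x)" for x
  proof -
    have "(\<integral>\<^sup>+t. ennreal (norm (blinfun_apply (?W t) x)) \<partial>\<mu>) \<le> (\<integral>\<^sup>+t. ennreal (norm x) * ?w t \<partial>\<mu>)"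
      by (intro nn_integral_mono norm_bernstein_orbit[OF ctx \<rho>]) (simp add: halflineD(2)[OF \<mu>])
    also have "\<dots> = ennreal (norm x) * ?Y" by (rule nn_integral_cmult[OF wm])
    also have "\<dots> = ennreal (enn2real ?Y * norm x)" using Yfin by (simp add: ennreal_mult mult.commute)
    finally show ?thesis .
  qed
  have Wint: "vec_integrable \<mu> (\<lambda>t. blinfun_apply (?W t) x)" for x
    using strongly_measurable_continuous[OF \<mu> bernstein_orbit_continuous[OF ctx \<rho>, of x]] le_less_trans[OF Wbound[of x]]
    by (simp add: vec_integrable_def)
  obtain S2 where S2: "\<And>x. blinfun_apply S2 x = vec_integral \<mu> (\<lambda>t. blinfun_apply (?W t) x)"
    using vec_integral_blinfun[OF fin _ Wint Wbound] by auto
  define S where "S = ?a *\<^sub>R ?G + S2"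
  have FG: "blinfun_apply ?F (blinfun_apply ?G x) = ?R (blinfun_apply S x)" for x
  proof -
    let ?u = "\<lambda>t. ?a *\<^sub>R blinfun_apply (T t) x + blinfun_apply (?W t) x"
    have Tint: "vec_integrable \<mu> (\<lambda>t. blinfun_apply (T t) x)" by (rule sg_integrable[OF sg \<mu>])
    have aT: "vec_integrable \<mu> (\<lambda>t. ?a *\<^sub>R blinfun_apply (T t) x)"
      by (rule vec_integrable_bounded_linear[OF fin Tint bounded_linear_scaleR_right])
    have u: "vec_integrable \<mu> ?u" by (rule vec_integrable_add[OF fin aT Wint])
    have blF: "bounded_linear (blinfun_apply ?F)" and blR: "bounded_linear ?R"
      by (rule blinfun.bounded_linear_right)+
    have "blinfun_apply ?F (blinfun_apply ?G x) = vec_integral \<mu> (\<lambda>t. blinfun_apply ?F (blinfun_apply (T t) x))"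
      unfolding G by (rule vec_integral_bounded_linear[OF fin Tint blF, symmetric])
    also have "\<dots> = vec_integral \<mu> (\<lambda>t. ?R (?u t))"
    proof (rule vec_integral_cong_AE)
      show "strongly_measurable \<mu> (\<lambda>t. blinfun_apply ?F (blinfun_apply (T t) x))"
        using vec_integrable_bounded_linear[OF fin Tint blF] by (simp add: vec_integrable_def)
      show "strongly_measurable \<mu> (\<lambda>t. ?R (?u t))"
        using vec_integrable_bounded_linear[OF fin u blR] by (simp add: vec_integrable_def)
      show "AE t in \<mu>. blinfun_apply ?F (blinfun_apply (T t) x) = ?R (?u t)"
        using AEw by eventually_elim (use regularized_calc_on_orbit[OF ctx \<rho> psi a rep] in blast)
    qed
    also have "\<dots> = ?R (vec_integral \<mu> ?u)" by (rule vec_integral_bounded_linear[OF fin u blR])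
    also have "vec_integral \<mu> ?u = blinfun_apply S x"
      unfolding vec_integral_add[OF fin aT Wint] vec_integral_bounded_linear[OF fin Tint bounded_linear_scaleR_right]
      by (simp add: S_def blinfun.add_left blinfun.scaleR_left S2 G)
    finally show ?thesis .
  qed
  have "is_bounded_op (bernstein_op T A psi \<circ>\<^sub>m of_blinfun ?G) S"
    unfolding is_bounded_op_def
  proof
    fix x
    let ?y = "blinfun_apply S x"
    have "neg_op A (?R ?y) = Some (?R ?y - ?y)" using generator_resolvent[OF sg, of ?y] assms(5) by simp
    then have "A (?R ?y) = Some (?y - ?R ?y)" by (auto simp: neg_op_def minus_equation_iff[of _ "?R ?y - ?y"])
    then show "(bernstein_op T A psi \<circ>\<^sub>m of_blinfun ?G) x = of_blinfun S x"
      by (simp add: bernstein_op_def map_comp_def of_blinfun_def one_plus_op_def FG)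
  qed
  moreover have "ennreal (norm S) \<le> ennreal (?a * norm ?G)
      + ennreal (2 * max (2 * ?M) c1) * J_functional g psi
      + ennreal (4 * ?M * at_zero_plus g) * C_functional c0 psi"
  proof -
    have "norm S2 \<le> enn2real ?Y"
    proof (rule norm_blinfun_bound)
      fix x
      have "ennreal (norm (blinfun_apply S2 x)) \<le> ennreal (enn2real ?Y * norm x)"
        unfolding S2 by (rule order_trans[OF norm_vec_integral_le[OF fin Wint] Wbound])
      then show "norm (blinfun_apply S2 x) \<le> enn2real ?Y * norm x" by (simp add: ennreal_le_iff)
    qed simp
    then have "norm S \<le> ?a * norm ?G + enn2real ?Y"
      unfolding S_def using norm_triangle_ineq[of "?a *\<^sub>R ?G" S2] a by simp
    then have "ennreal (norm S) \<le> ennreal (?a * norm ?G) + ennreal (enn2real ?Y)"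
    proof -
      have "ennreal u \<le> ennreal v + ennreal w" if "u \<le> v + w" "0 \<le> v" "0 \<le> w" for u v w
        using that by (simp add: ennreal_leI flip: ennreal_plus)
      from this[OF \<open>norm S \<le> ?a * norm ?G + enn2real ?Y\<close>] a show ?thesis by simp
    qed
    also have "ennreal (enn2real ?Y) = ?Y" using Yfin by simp
    also have "ennreal (?a * norm ?G) + ?Y \<le> ennreal (?a * norm ?G)
      + (ennreal (2 * max (2 * ?M) c1) * J_functional g psi
      + ennreal (4 * ?M * at_zero_plus g) * C_functional c0 psi)"
      by (rule add_left_mono[OF Y_le])
    finally show ?thesis by (simp add: add.assoc)
  qed
  ultimately show ?thesis by blast
qed

end
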